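(* Let $p\in(0,1]$ and $\psi\in L^p(\mathbb{R}^d)$, and suppose $\phi\in L^\infty(\mathbb{R}^d)$ with $P|\phi|\in L^\infty(\mathbb{R}^d)$ and $\int_{\mathbb{R}^d}\phi\,dx=1$. Then $$\lim_{j\to\infty}\|S_jT_jf-f\|_p=\|P\psi(b\,\cdot)-1\|_{L^p(\mathcal{C})}\,\|f\|_p,\qquad f\in L^p(\mathbb{R}^d).$$ In particular, if $\psi$ has constant periodization $P\psi=1$ a.e., then $S_jT_jf\to f$ in $L^p(\mathbb{R}^d)$ as $j\to\infty$.
   Context: Fix a dimension $d\in\mathbb{N}$. Functions and sequences are complex valued. Fix invertible real $d\times d$ matrices $a_j$ (integers $j>0$) with $\|a_j^{-1}\|\to0$ as $j\to\infty$ (operator norm), and an invertible real $d\times d$ matrix $b$. $\mathcal{C}=[0,1)^d$. For $p\in(0,1]$, $\|f\|_p=(\int_{\mathbb{R}^d}|f|^p\,dx)^{1/p}$, and similarly $\|\cdot\|_{L^p(\mathcal{C})}$ with integration over $\mathcal{C}$; convergence in $L^p$ is with respect to the metric $d_p(f,g)=\|f-g\|_p^p$. $\psi_{j,k}(x)=|\det a_j|^{1/p}\psi(a_jx-bk)$. Synthesis operator at scale $j$: $S_js=\sum_{k\in\mathbb{Z}^d}s_k\psi_{j,k}$ for $s=\{s_k\}_{k\in\mathbb{Z}^d}\in\ell^p(\mathbb{Z}^d)$ (the series converges absolutely a.e. to a function in $L^p$). Radial stretch: $\Theta(z)=|z|^{p-1}z$ for $z\in\mathbb{C}$ (with $\Theta(0)=0$),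 a homeomorphism of $\mathbb{C}$; $(\Theta f)(x)=\Theta(f(x))$. Write $\langle F,G\rangle=\int_{\mathbb{R}^d}F\overline{G}\,dx$. Analysis operator at scale $j$ (nonlinear): $T_jf=\{|\det b|\,\Theta^{-1}(\langle\Theta f,\phi(a_j\,\cdot-bk)\rangle)\}_{k\in\mathbb{Z}^d}$, which maps $L^p(\mathbb{R}^d)$ into $\ell^p(\mathbb{Z}^d)$. Periodization: $Pg(x)=|\det b|\sum_{k\in\mathbb{Z}^d}g(x-bk)$; for $g=\psi\in L^p$, the series $P\psi(bx)$ converges absolutely a.e. and belongs to $L^p(\mathcal{C})$. $P\psi(b\,\cdot)$ denotes the function $x\mapsto (P\psi)(bx)$. *)

theory Defs
  imports "HOL-Analysis.Analysis"
begin

text \<open>Lebesgue spaces of complex functions (0 < p). Since the Bochner integral is 0 on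
  non-integrable functions, \<open>Lp_norm\<close> is meaningful only on members of \<open>Lp_space\<close>.\<close>

definition Lp_space :: "real \<Rightarrow> 'a measure \<Rightarrow> ('a \<Rightarrow> complex) set" where
  "Lp_space p M = {f \<in> borel_measurable M. integrable M (\<lambda>x. cmod (f x) powr p)}"

definition Lp_norm :: "real \<Rightarrow> 'a measure \<Rightarrow> ('a \<Rightarrow> complex) \<Rightarrow> real" where
  "Lp_norm p M f = (\<integral>x. cmod (f x) powr p \<partial>M) powr (1 / p)"

definition Lp_dist :: "real \<Rightarrow> 'a measure \<Rightarrow> ('a \<Rightarrow> complex) \<Rightarrow> ('a \<Rightarrow> complex) \<Rightarrow> real" where
  "Lp_dist p M f g = Lp_norm p M (\<lambda>x. f x - g x) powr p"

definition Lp_tendsto ::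
  "real \<Rightarrow> 'a measure \<Rightarrow> (nat \<Rightarrow> 'a \<Rightarrow> complex) \<Rightarrow> ('a \<Rightarrow> complex) \<Rightarrow> bool" where
  "Lp_tendsto p M F f \<longleftrightarrow>
     f \<in> Lp_space p M \<and> (\<forall>\<^sub>F j in sequentially. F j \<in> Lp_space p M) \<and>
     (\<lambda>j. Lp_dist p M (F j) f) \<longlonglongrightarrow> 0"

definition Linf_space :: "'a measure \<Rightarrow> ('a \<Rightarrow> complex) set" where
  "Linf_space M = {f \<in> borel_measurable M. \<exists>K. AE x in M. cmod (f x) \<le> K}"

definition unit_cube :: "(real ^ 'd) set" where
  "unit_cube = {x. \<forall>i. 0 \<le> x $ i \<and> x $ i < 1}"

definition lattice_point :: "real ^ 'd ^ 'd \<Rightarrow> int ^ 'd \<Rightarrow> real ^ 'd" where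
  "lattice_point b k = b *v (\<chi> i. real_of_int (k $ i))"

text \<open>The series below are unconditional sums, which for complex terms means absolute
  convergence; \<open>infsum\<close> is 0 at the points where the series does not converge.\<close>

definition periodization ::
  "real ^ 'd ^ 'd \<Rightarrow> (real ^ 'd \<Rightarrow> complex) \<Rightarrow> real ^ 'd \<Rightarrow> complex" where
  "periodization b g x = of_real \<bar>det b\<bar> * (\<Sum>\<^sub>\<infinity>k. g (x - lattice_point b k))"

text \<open>Membership of the periodization of \<open>g\<close> in the space of essentially bounded functions
  includes a.e. convergence, which has to be required separately because of the convention above.\<close>

definition periodization_in_Linf ::
  "real ^ 'd ^ 'd \<Rightarrow> (real ^ 'd \<Rightarrow> complex) \<Rightarrow> bool" where
  "periodization_in_Linf b g \<longleftrightarrow>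
     (AE x in lebesgue. (\<lambda>k. g (x - lattice_point b k)) summable_on UNIV) \<and>
     periodization b g \<in> Linf_space lebesgue"

definition wavelet ::
  "real \<Rightarrow> real ^ 'd ^ 'd \<Rightarrow> real ^ 'd ^ 'd \<Rightarrow> (real ^ 'd \<Rightarrow> complex) \<Rightarrow> int ^ 'd \<Rightarrow> real ^ 'd \<Rightarrow> complex" where
  "wavelet p A b \<psi> k x = of_real (\<bar>det A\<bar> powr (1 / p)) * \<psi> (A *v x - lattice_point b k)"

definition synthesis ::
  "real \<Rightarrow> real ^ 'd ^ 'd \<Rightarrow> real ^ 'd ^ 'd \<Rightarrow> (real ^ 'd \<Rightarrow> complex) \<Rightarrow> (int ^ 'd \<Rightarrow> complex)
     \<Rightarrow> real ^ 'd \<Rightarrow> complex" where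
  "synthesis p A b \<psi> s x = (\<Sum>\<^sub>\<infinity>k. s k * wavelet p A b \<psi> k x)"

definition radial_stretch :: "real \<Rightarrow> complex \<Rightarrow> complex" where
  "radial_stretch p z = of_real (cmod z powr (p - 1)) * z"

definition pairing :: "(real ^ 'd \<Rightarrow> complex) \<Rightarrow> (real ^ 'd \<Rightarrow> complex) \<Rightarrow> complex" where
  "pairing F G = (\<integral>x. F x * cnj (G x) \<partial>lebesgue)"

definition analysis ::
  "real \<Rightarrow> real ^ 'd ^ 'd \<Rightarrow> real ^ 'd ^ 'd \<Rightarrow> (real ^ 'd \<Rightarrow> complex) \<Rightarrow> (real ^ 'd \<Rightarrow> complex)
     \<Rightarrow> int ^ 'd \<Rightarrow> complex" where
  "analysis p A b \<phi> f k = of_real \<bar>det b\<bar> *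
     inv (radial_stretch p)
       (pairing (\<lambda>x. radial_stretch p (f x)) (\<lambda>x. \<phi> (A *v x - lattice_point b k)))"

end

theory Submission
  imports Defs
begin

text \<open>Substituting \<open>H = \<Theta> f\<close> turns \<open>f\<close> into an integrable function, and the sampling coefficients
  become linear in \<open>H\<close>; replacing \<open>a\<^sub>j\<close> by \<open>M = b\<inverse> a\<^sub>j\<close> and \<open>\<psi>\<close>, \<open>\<phi>\<close> by their
  dilates by \<open>b\<close> turns the lattice into the integer lattice. Everything nonlinear is controlled by
  \<open>\<bar>\<Theta>\<inverse> z - \<Theta>\<inverse> w\<bar>\<^sup>p \<le> \<epsilon> (\<bar>z\<bar> + \<bar>w\<bar>) + C \<bar>z - w\<bar>\<close>, which follows by homogeneity from the uniform
  continuity of \<open>\<Theta>\<inverse>\<close> on the unit disc. It gives equicontinuity in \<open>j\<close>, so that \<open>H\<close> may be assumed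
  continuous with compact support. For such \<open>H\<close>, the normalised sum over the lattice of
  \<open>\<bar>H (M\<inverse> (z + k)) - H (M\<inverse> k)\<bar>\<close> is bounded and tends to 0 for every \<open>z\<close>. By dominated convergence,
  first against \<open>\<bar>\<phi>\<bar>\<close> and \<open>\<bar>\<psi>\<bar>\<^sup>p\<close>, \<open>S\<^sub>j T\<^sub>j f\<close> may be replaced by \<open>f\<close> times the periodization of \<open>\<psi>\<close>
  at \<open>M x\<close>; then, against \<open>\<bar>P\<psi> - 1\<bar>\<^sup>p\<close> on the unit cube, the periodic factor equidistributes.\<close>

section \<open>Linear change of variables\<close>

text \<open>The term \<open>\<epsilon> (|z| + |w|)\<close> of the pointwise bound cannot be dropped
  when p < 1: near z = 1 the difference
  \<open>|\<Theta>\<inverse> z - \<Theta>\<inverse> w|^p\<close> is of order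
  \<open>|z - w|^p\<close>, which no multiple of \<open>|z - w|\<close> dominates. The bound is
  useful because all its terms are of first order: summed over the lattice they become
  \<open>L^1\<close> norms of data, with constants independent of j. This replaces the operator
  bound of a linear density argument. Continuity of \<open>H\<close> enters because the lattice sums
  use point values, which mean nothing for a general integrable function. They are Riemann sums
  whose cells have volume \<open>1 / |det M|\<close>, and this volume cancels the determinant in the
  coefficients. For p < 1 the norm is not subadditive but its p-th power is, so estimates concern
  p-th powers and the root is taken only at the end. They live in the extended nonnegative reals,
  where sums and integrals may be exchanged before finiteness is known; lacking subtraction, a
  nonzero limit is obtained from a pair of inequalities with additive errors.\<close>

text \<open>The change of variables theorems of the library need a well-ordered index type. What follows
  is a version for arbitrary finite index types.\<close>

lemma det_shear:
  assumes "m \<noteq> n"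
  shows "det (matrix (\<lambda>v::real^'n. \<chi> i. if i = m then v $ m + v $ n else v $ i)) = 1"
proof -
  have "matrix (\<lambda>v::real^'n. \<chi> i. if i = m then v $ m + v $ n else v $ i)
     = (\<chi> k. if k = m then row m (mat 1) + 1 *s row n (mat 1) else row k (mat 1))"
    by (auto simp: matrix_def row_def mat_def axis_def vec_eq_iff)
  then show ?thesis using det_row_operation[OF assms, of "mat 1" "1::real"] by simp
qed

lemma measure_shear_cbox:
  assumes "m \<noteq> n"
  shows "measure lebesgue ((\<lambda>v::real^'n. \<chi> i. if i = m then v $ m + v $ n else v $ i) ` cbox a b)
     = measure lebesgue (cbox a b)"
proof (cases "cbox a b = {}")
  case False
  let ?h = "\<lambda>v::real^'n. \<chi> i. if i = m then v $ m + v $ n else v $ i"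
  \<comment> \<open>Moving the box by its lower bound in direction \<open>n\<close> makes that bound
    0, which satisfies the sign condition of \<open>measure_shear_interval\<close>.\<close>
  let ?t = "axis n (a $ n)"
  have tr: "cbox a b = (+) ?t ` cbox (a - ?t) (b - ?t)"
    by (simp add: cbox_translation[symmetric])
  have e: "?h ` cbox a b = (+) (?h ?t) ` ?h ` cbox (a - ?t) (b - ?t)"
    unfolding tr image_comp o_def by (intro image_cong) (auto simp: vec_eq_iff)
  have f: "measure lebesgue (?h ` cbox (a - ?t) (b - ?t)) = measure lebesgue (cbox (a - ?t) (b - ?t))"
  proof (rule measure_shear_interval[OF assms])
    show "cbox (a - ?t) (b - ?t) \<noteq> {}" using False tr by blast
  qed simp
  show ?thesis
    unfolding e measure_translation f by (subst tr, subst measure_translation) (rule refl)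
qed simp

lemma measure_coordinate_swap_cbox:
  fixes m n :: "'n::finite"
  shows "measure lebesgue ((\<lambda>v::real^'n. \<chi> i. v $ Transposition.transpose m n i) ` cbox a b)
     = measure lebesgue (cbox a b)"
proof (cases "cbox a b = {}")
  case False
  let ?h = "\<lambda>v::real^'n. \<chi> i. v $ Transposition.transpose m n i"
  have hh: "?h (?h v) = v" for v by (simp add: vec_eq_iff)
  have mem: "?h v \<in> cbox (?h a) (?h b) \<longleftrightarrow> v \<in> cbox a b" for v a b
    by (simp add: mem_box_cart) (metis transpose_involutory)
  have eq: "?h ` cbox a b = cbox (?h a) (?h b)"
  proof (intro equalityI subsetI)
    fix y assume "y \<in> cbox (?h a) (?h b)"
    then have "?h y \<in> cbox a b" using mem[of "?h y" a b] by (simp only: hh)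
    then show "y \<in> ?h ` cbox a b" by (intro image_eqI[of _ _ "?h y"]) (simp_all only: hh)
  qed (use mem in blast)
  then have "cbox (?h a) (?h b) \<noteq> {}" using False by (metis image_is_empty)
  then show ?thesis
    using False prod.permute[of "Transposition.transpose m n" UNIV "\<lambda>i. b$i - a$i"]
    by (simp add: eq content_cbox_cart o_def permutes_swap_id)
qed simp

lemma det_coordinate_swap:
  fixes m n :: "'n::finite"
  shows "\<bar>det (matrix (\<lambda>v::real^'n. \<chi> i. v $ Transposition.transpose m n i))\<bar> = 1"
proof -
  have "matrix (\<lambda>v::real^'n. \<chi> i. v $ Transposition.transpose m n i)
      = (\<chi> i. mat 1 $ Transposition.transpose m n i)"
    by (simp add: matrix_def mat_def axis_def vec_eq_iff)
  then show ?thesis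
    using det_permute_rows[of "Transposition.transpose m n" "mat 1 :: real^'n^'n"]
    by (auto simp: sign_swap_id permutes_swap_id)
qed

text \<open>Preserving the volume of closed boxes suffices: \<open>measure_linear_sufficient\<close>
  extends this to open boxes, and a measure that agrees with \<open>lborel\<close> on these is
  \<open>lborel\<close>. Images under \<open>f\<close> are preimages under \<open>g\<close>, whence
  the first claim; the second is the first one for the preimage of \<open>A\<close> under
  \<open>f\<close>.\<close>

lemma emeasure_lborel_vimage_of_measure_cbox:
  fixes f g :: "'a::euclidean_space \<Rightarrow> 'a"
  assumes lf: "linear f" and lg: "linear g"
    and fg: "\<And>x. f (g x) = x" and gf: "\<And>x. g (f x) = x"
    and f: "\<And>a b. measure lebesgue (f ` cbox a b) = measure lebesgue (cbox a b)"
    and A: "A \<in> sets borel"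
  shows "emeasure lborel (g -` A) = emeasure lborel A" and "emeasure lborel (f -` A) = emeasure lborel A"
proof -
  have im: "f ` S = g -` S" for S
  proof (intro equalityI subsetI)
    fix x assume "x \<in> g -` S"
    then show "x \<in> f ` S" using fg[of x] by (metis image_eqI vimageE)
  qed (auto simp: gf)
  have bf[measurable]: "f \<in> borel_measurable borel" and bg[measurable]: "g \<in> borel_measurable borel"
    using lf lg by (auto intro!: borel_measurable_continuous_onI linear_continuous_on simp: linear_conv_bounded_linear)
  have "lborel = distr lborel borel g"
  proof (rule lborel_eqI)
    fix l u :: 'a assume lu: "\<And>b. b \<in> Basis \<Longrightarrow> l \<bullet> b \<le> u \<bullet> b"
    have "f ` box l u \<in> lmeasurable \<and> 1 * measure lebesgue (box l u) = measure lebesgue (f ` box l u)"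
      by (rule measure_linear_sufficient[OF lf]) (auto simp: f)
    then have fm: "f ` box l u \<in> lmeasurable" and eq: "measure lebesgue (f ` box l u) = measure lebesgue (box l u)" by auto
    have "emeasure (distr lborel borel g) (box l u) = emeasure lebesgue (f ` box l u)"
      by (simp add: emeasure_distr im measurable_sets_borel[OF bg])
    also have "\<dots> = ennreal (measure lebesgue (box l u))"
      using fm eq by (simp add: emeasure_eq_measure2)
    also have "\<dots> = emeasure lborel (box l u)"
      by (simp add: emeasure_eq_measure2)
    finally show "emeasure (distr lborel borel g) (box l u) = (\<Prod>b\<in>Basis. (u - l) \<bullet> b)"
      using lu by simp
  qed simp
  then have "emeasure lborel A = emeasure (distr lborel borel g) A" for A by (rule arg_cong)
  then have *: "emeasure lborel (g -` A) = emeasure lborel A" if "A \<in> sets borel" for A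
    using that by (simp add: emeasure_distr)
  from *[OF A] show "emeasure lborel (g -` A) = emeasure lborel A" .
  have "f -` A \<in> sets borel" using A bf by (metis measurable_sets_borel)
  from *[OF this] show "emeasure lborel (f -` A) = emeasure lborel A"
    using fg by (simp add: vimage_comp o_def)
qed

text \<open>Linear maps are compositions of elementary ones. Preimages are used because they stay
  Borel and compose; the determinant is multiplicative, so a composition with nonzero determinant
  has only factors of this kind.\<close>

theorem emeasure_lborel_linear_vimage:
  fixes f :: "real^'n \<Rightarrow> real^'n"
  assumes "linear f" "det (matrix f) \<noteq> 0" "A \<in> sets borel"
  shows "ennreal \<bar>det (matrix f)\<bar> * emeasure lborel (f -` A) = emeasure lborel A"
proof -
  have "det (matrix f) \<noteq> 0 \<longrightarrow> (\<forall>A\<in>sets borel. ennreal \<bar>det (matrix f)\<bar> * emeasure lborel (f -` A) = emeasure lborel A)"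
  proof (rule induct_linear_elementary[OF \<open>linear f\<close>], goal_cases)
    case (1 f g)
    have m: "matrix (f \<circ> g) = matrix f ** matrix g"
      by (rule matrix_compose) (use 1 in auto)
    have "f \<in> borel_measurable borel"
      using 1 by (auto intro!: borel_measurable_continuous_onI linear_continuous_on simp: linear_conv_bounded_linear)
    then have "f -` A \<in> sets borel" if "A \<in> sets borel" for A using that by (metis measurable_sets_borel)
    note fA = this
    show ?case
    proof (intro impI ballI)
      fix A :: "(real^'n) set" assume nz: "det (matrix (f \<circ> g)) \<noteq> 0" and A: "A \<in> sets borel"
      then have "det (matrix f) \<noteq> 0" "det (matrix g) \<noteq> 0" by (auto simp: m det_mul)
      with 1 have f: "ennreal \<bar>det (matrix f)\<bar> * emeasure lborel (f -` A) = emeasure lborel A"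
        and g: "ennreal \<bar>det (matrix g)\<bar> * emeasure lborel (g -` (f -` A)) = emeasure lborel (f -` A)"
        using A fA[OF A] by blast+
      show "ennreal \<bar>det (matrix (f \<circ> g))\<bar> * emeasure lborel ((f \<circ> g) -` A) = emeasure lborel A"
        unfolding m det_mul abs_mult vimage_comp[symmetric] f[symmetric] g[symmetric]
        by (simp add: ennreal_mult mult.assoc)
    qed
  next
    case (2 f i)
    \<comment> \<open>A map with a vanishing coordinate is singular, so this case contradicts the
      condition on the determinant.\<close>
    then have "\<not> surj f" by (metis surjE vec_component zero_neq_one)
    then have "\<not> inj f" using 2 linear_injective_imp_surjective by blast
    then show ?case using det_nz_iff_inj[OF 2(1)] by blast
  next
    case (3 c)
    let ?f = "\<lambda>x::real^'n. \<chi> i. c i * x $ i"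
    have d: "det (matrix ?f) = (\<Prod>i\<in>UNIV. c i)"
      by (subst det_diagonal) (auto simp: matrix_def axis_def)
    show ?case
    proof (intro impI ballI)
      fix A :: "(real^'n) set" assume nz: "det (matrix ?f) \<noteq> 0" and A: "A \<in> sets borel"
      \<comment> \<open>\<open>lborel_affine_euclidean\<close> indexes its factors by basis vectors,
        hence the transfer of \<open>c\<close> along \<open>axis_index\<close>.\<close>
      define c' where "c' = (\<lambda>v::real^'n. c (axis_index v))"
      have cnz: "c i \<noteq> 0" for i using nz by (auto simp: d)
      have c': "c' j \<noteq> 0" for j using cnz by (auto simp: c'_def)
      have ax: "axis_index (axis i (1::real)) = i" for i :: 'n
        by (rule axis_index_axis)
      have bij_axis: "bij_betw (\<lambda>i::'n. axis i (1::real)) UNIV Basis"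
        by (auto simp: bij_betw_def inj_on_def Basis_vec_def axis_eq_axis)
      have feq: "?f = (\<lambda>x. 0 + (\<Sum>j\<in>Basis. (c' j * (x \<bullet> j)) *\<^sub>R j))"
      proof
        fix x :: "real^'n"
        have "(\<Sum>j\<in>Basis. (c' j * (x \<bullet> j)) *\<^sub>R j) = (\<Sum>i\<in>UNIV. (c i * x $ i) *\<^sub>R axis i 1)"
          by (subst sum.reindex_bij_betw[OF bij_axis, symmetric]) (simp add: c'_def ax cart_eq_inner_axis)
        then show "?f x = 0 + (\<Sum>j\<in>Basis. (c' j * (x \<bullet> j)) *\<^sub>R j)"
          by (simp add: vec_eq_iff axis_def if_distrib cong: if_cong)
      qed
      have pr: "(\<Prod>j\<in>Basis. \<bar>c' j\<bar>) = \<bar>det (matrix ?f)\<bar>"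
        by (subst prod.reindex_bij_betw[OF bij_axis, symmetric]) (simp add: c'_def ax d abs_prod)
      have bf: "?f \<in> borel_measurable borel"
        unfolding feq by measurable
      have "emeasure lborel A = emeasure (density (distr lborel borel ?f) (\<lambda>_. ennreal (\<Prod>j\<in>Basis. \<bar>c' j\<bar>))) A"
        using lborel_affine_euclidean[of c' 0] c' unfolding feq by simp
      also have "\<dots> = ennreal \<bar>det (matrix ?f)\<bar> * emeasure lborel (?f -` A)"
        using A bf unfolding pr
        by (subst emeasure_density) (auto simp: nn_integral_cmult emeasure_distr)
      finally show "ennreal \<bar>det (matrix ?f)\<bar> * emeasure lborel (?f -` A) = emeasure lborel A" ..
    qed
  next
    case (4 m n)
    let ?h = "\<lambda>v::real^'n. \<chi> i. v $ Transposition.transpose m n i"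
    have "linear ?h" by (rule linearI) (simp_all add: plus_vec_def scaleR_vec_def)
    from emeasure_lborel_vimage_of_measure_cbox(1)[OF this this _ _ measure_coordinate_swap_cbox]
    show ?case by (simp add: det_coordinate_swap)
  next
    case (5 m n)
    let ?h = "\<lambda>v::real^'n. \<chi> i. if i = m then v $ m + v $ n else v $ i"
    let ?g = "\<lambda>v::real^'n. \<chi> i. if i = m then v $ m - v $ n else v $ i"
    have l: "linear ?h" "linear ?g"
      by (rule linearI; auto simp: vec_eq_iff algebra_simps)+
    show ?case using 5
      by (simp add: det_shear emeasure_lborel_vimage_of_measure_cbox(2)[OF l _ _ measure_shear_cbox[OF 5]] vec_eq_iff)
  qed
  with assms show ?thesis by blast
qed


section \<open>Lebesgue measure under affine maps\<close>

lemma
  fixes M :: "real^'n^'n"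
  assumes d: "det M \<noteq> 0"
  shows lebesgue_linear: "lebesgue = density (distr lebesgue lebesgue ((*v) M)) (\<lambda>_. ennreal \<bar>det M\<bar>)"
    and measurable_lebesgue_linear: "(*v) M \<in> lebesgue \<rightarrow>\<^sub>M lebesgue"
proof -
  have T[measurable]: "(*v) M \<in> borel \<rightarrow>\<^sub>M borel"
    by (intro borel_measurable_continuous_onI linear_continuous_on matrix_vector_mul_bounded_linear)
  have em: "ennreal \<bar>det M\<bar> * emeasure lborel ((*v) M -` A) = emeasure lborel A" if "A \<in> sets borel" for A
    using emeasure_lborel_linear_vimage[of "(*v) M" A] d that by simp
  have lb: "lborel = density (distr lborel borel ((*v) M)) (\<lambda>_. ennreal \<bar>det M\<bar>)"
    by (rule measure_eqI) (auto simp: emeasure_density nn_integral_cmult emeasure_distr em)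
  \<comment> \<open>As \<open>det M\<close> is nonzero, a set is null exactly when its preimage is;
    this carries the Borel statement over to the completion.\<close>
  have "emeasure lborel A = 0 \<longleftrightarrow> emeasure (distr lebesgue lborel ((*v) M)) A = 0" if A: "A \<in> sets borel" for A
    using em[OF A] d A measurable_sets_borel[OF T A]
    by (subst emeasure_distr) (auto simp: measurable_completion)
  then have eq: "null_sets lborel = null_sets (distr lebesgue lborel ((*v) M))"
    by (auto simp: null_sets_def)
  show "(*v) M \<in> lebesgue \<rightarrow>\<^sub>M lebesgue"
    by (simp add: completion.measurable_completion2 eq measurable_completion)
  have "lebesgue = completion (density (distr lborel borel ((*v) M)) (\<lambda>_. ennreal \<bar>det M\<bar>))"
    by (subst lb) rule
  also have "\<dots> = density (completion (distr lebesgue lborel ((*v) M))) (\<lambda>_. ennreal \<bar>det M\<bar>)"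
    using d by (auto intro!: completion_density_eq simp: distr_completion cong: distr_cong)
  also have "\<dots> = density (distr lebesgue lebesgue ((*v) M)) (\<lambda>_. ennreal \<bar>det M\<bar>)"
    by (subst completion.completion_distr_eq) (auto simp: eq measurable_completion)
  finally show "lebesgue = density (distr lebesgue lebesgue ((*v) M)) (\<lambda>_. ennreal \<bar>det M\<bar>)" .
qed

lemma
  fixes t :: "'a::euclidean_space"
  shows lebesgue_translation: "lebesgue = distr lebesgue lebesgue (\<lambda>x. x + t)"
    and measurable_lebesgue_translation: "(\<lambda>x. x + t) \<in> lebesgue \<rightarrow>\<^sub>M lebesgue"
proof -
  have *: "(\<lambda>x. t + (\<Sum>j\<in>Basis. (1 * (x \<bullet> j)) *\<^sub>R j)) = (\<lambda>x. x + t)"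
    by (simp add: euclidean_representation add.commute)
  show "lebesgue = distr lebesgue lebesgue (\<lambda>x. x + t)"
    using lebesgue_affine_euclidean[of "\<lambda>_. 1" t] unfolding * by (simp add: density_1)
  show "(\<lambda>x. x + t) \<in> lebesgue \<rightarrow>\<^sub>M lebesgue"
    using lebesgue_affine_measurable[of "\<lambda>_. 1" t] unfolding * by simp
qed

lemma measurable_lebesgue_affine:
  fixes M :: "real^'n^'n"
  assumes "det M \<noteq> 0"
  shows "(\<lambda>x. M *v x + t) \<in> lebesgue \<rightarrow>\<^sub>M lebesgue"
  using measurable_compose[OF measurable_lebesgue_linear[OF assms] measurable_lebesgue_translation] .

lemma nn_integral_lebesgue_translation:
  fixes t :: "'a::euclidean_space"
  assumes "g \<in> borel_measurable lebesgue"
  shows "(\<integral>\<^sup>+x. g (x + t) \<partial>lebesgue) = (\<integral>\<^sup>+x. g x \<partial>lebesgue)"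
  by (subst (2) lebesgue_translation[of t])
    (simp add: nn_integral_distr measurable_lebesgue_translation assms)

lemma nn_integral_lebesgue_affine:
  fixes M :: "real^'n^'n"
  assumes d: "det M \<noteq> 0" and g: "g \<in> borel_measurable lebesgue"
  shows "ennreal \<bar>det M\<bar> * (\<integral>\<^sup>+x. g (M *v x + t) \<partial>lebesgue) = (\<integral>\<^sup>+x. g x \<partial>lebesgue)"
proof -
  have m: "(\<lambda>x. g (x + t)) \<in> borel_measurable lebesgue"
    using measurable_compose[OF measurable_lebesgue_translation g] .
  have m': "(\<lambda>x. g (M *v x + t)) \<in> borel_measurable lebesgue"
    using measurable_compose[OF measurable_lebesgue_affine[OF d] g] .
  have "(\<integral>\<^sup>+x. g x \<partial>lebesgue) = (\<integral>\<^sup>+x. g (x + t) \<partial>lebesgue)"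
    using nn_integral_lebesgue_translation[OF g] by simp
  also have "\<dots> = (\<integral>\<^sup>+x. g (x + t) \<partial>density (distr lebesgue lebesgue ((*v) M)) (\<lambda>_. ennreal \<bar>det M\<bar>))"
    by (subst lebesgue_linear[OF d]) rule
  also have "\<dots> = ennreal \<bar>det M\<bar> * (\<integral>\<^sup>+x. g (M *v x + t) \<partial>lebesgue)"
    using m m' measurable_lebesgue_linear[OF d]
    by (simp add: nn_integral_density nn_integral_distr nn_integral_cmult)
  finally show ?thesis ..
qed

lemma AE_lebesgue_affine:
  fixes M :: "real^'n^'n"
  assumes d: "det M \<noteq> 0" and ae: "AE x in lebesgue. P x"
  shows "AE x in lebesgue. P (M *v x + t)"
proof -
  obtain N where N: "N \<in> null_sets lebesgue" "{x. \<not> P x} \<subseteq> N"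
    using ae by (auto simp: eventually_ae_filter)
  let ?N = "(\<lambda>x. M *v x + t) -` N"
  have s: "?N \<in> sets lebesgue"
    using measurable_sets[OF measurable_lebesgue_affine[OF d]] N by auto
  have "(\<lambda>x. indicator N (M *v x + t) :: ennreal) = indicator ?N"
    by (auto simp: indicator_def)
  then have "ennreal \<bar>det M\<bar> * emeasure lebesgue ?N = emeasure lebesgue N"
    using nn_integral_lebesgue_affine[OF d borel_measurable_indicator[OF null_setsD2[OF N(1)]], of t] s
      null_setsD2[OF N(1)]
    by (simp add: nn_integral_indicator del: nn_integral_completion emeasure_completion)
  with N d have "?N \<in> null_sets lebesgue" using s by (auto simp: null_sets_def)
  then show ?thesis using N(2) by (auto intro!: AE_I'[of ?N])
qed

section \<open>The radial stretch and sums of powers\<close>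

lemma cmod_radial_stretch: "cmod (radial_stretch q z) = cmod z powr q"
  by (cases "z = 0") (auto simp: radial_stretch_def norm_mult norm_divide powr_diff)

lemma radial_stretch_0 [simp]: "radial_stretch q 0 = 0"
  by (simp add: radial_stretch_def)

lemma radial_stretch_scale:
  "t \<ge> 0 \<Longrightarrow> radial_stretch q (of_real t * z) = of_real (t powr q) * radial_stretch q z"
  by (cases "t = 0") (auto simp: radial_stretch_def norm_mult powr_mult powr_diff)

lemma radial_stretch_inverse:
  assumes "p \<noteq> 0"
  shows "radial_stretch p (radial_stretch (1 / p) z) = z"
proof (cases "z = 0")
  case False
  have "cmod z powr (1 / p * (p - 1)) * cmod z powr (1 / p - 1) = cmod z powr 0"
    unfolding powr_add[symmetric] using assms by (simp add: field_simps)
  then show ?thesis using False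
    by (simp add: radial_stretch_def[of p] cmod_radial_stretch powr_powr)
      (simp add: radial_stretch_def mult.assoc[symmetric] flip: of_real_mult)
qed simp

lemma inv_radial_stretch:
  assumes "p \<noteq> 0"
  shows "inv (radial_stretch p) = radial_stretch (1 / p)"
proof (rule inv_equality)
  show "radial_stretch (1 / p) (radial_stretch p z) = z" for z
    using radial_stretch_inverse[of "1 / p" z] assms by simp
qed (use radial_stretch_inverse[OF assms] in auto)

lemma continuous_on_radial_stretch:
  assumes "0 < q"
  shows "continuous_on UNIV (radial_stretch q)"
  unfolding continuous_on_eq_continuous_at[OF open_UNIV]
proof
  fix z :: complex
  show "isCont (radial_stretch q) z"
  proof (cases "z = 0")
    case True
    have "((\<lambda>w::complex. cmod w powr q) \<longlongrightarrow> 0) (at 0)"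
      using assms by (auto intro!: tendsto_zero_powrI[where b=q] tendsto_norm_zero tendsto_ident_at)
    then have "(radial_stretch q \<longlongrightarrow> 0) (at 0)"
      by (subst tendsto_norm_zero_iff[symmetric]) (simp add: cmod_radial_stretch)
    then show ?thesis using True by (simp add: isCont_def)
  next
    case False
    then show ?thesis unfolding radial_stretch_def[abs_def]
      by (intro continuous_intros) auto
  qed
qed

lemma radial_stretch_diff_bound:
  assumes q: "0 < q" and e: "0 < \<epsilon>"
  obtains C where "C \<ge> 0"
    "\<And>z w. cmod (radial_stretch q z - radial_stretch q w) powr (1 / q)
        \<le> \<epsilon> * (cmod z + cmod w) + C * cmod (z - w)"
proof -
  have "uniformly_continuous_on (cball 0 1) (radial_stretch q)"
    by (rule compact_uniformly_continuous[OF continuous_on_subset[OF continuous_on_radial_stretch[OF q]]]) auto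
  moreover have "\<epsilon> powr q > 0" using e by simp
  ultimately obtain \<delta> where \<delta>: "\<delta> > 0"
    and uc: "\<And>z w. z \<in> cball 0 1 \<Longrightarrow> w \<in> cball 0 1 \<Longrightarrow> dist w z < \<delta> \<Longrightarrow>
       dist (radial_stretch q w) (radial_stretch q z) < \<epsilon> powr q"
    unfolding uniformly_continuous_on_def by meson
  \<comment> \<open>Stretched points of the unit disc differ by at most 2, and arguments that are
    not \<delta>-close satisfy 1 \<le> |z - w| / \<delta>, so this constant pays for them.\<close>
  let ?C = "2 powr (1 / q) / \<delta>"
  have unit: "cmod (radial_stretch q z - radial_stretch q w) powr (1 / q) \<le> \<epsilon> + ?C * cmod (z - w)"
    if z: "cmod z \<le> 1" and w: "cmod w \<le> 1" for z w
  proof (cases "cmod (z - w) < \<delta>")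
    case True
    then have "cmod (radial_stretch q z - radial_stretch q w) \<le> \<epsilon> powr q"
      using uc[of w z] z w by (simp add: dist_norm)
    then have "cmod (radial_stretch q z - radial_stretch q w) powr (1 / q) \<le> (\<epsilon> powr q) powr (1 / q)"
      using q by (intro powr_mono2) auto
    also have "\<dots> = \<epsilon>" using q e by (simp add: powr_powr)
    finally show ?thesis using \<delta> by (simp add: add_increasing2)
  next
    case False
    have "cmod (radial_stretch q z) \<le> 1" "cmod (radial_stretch q w) \<le> 1"
      using z w q powr_mono2[of q "cmod z" 1] powr_mono2[of q "cmod w" 1] by (auto simp: cmod_radial_stretch)
    then have "cmod (radial_stretch q z - radial_stretch q w) \<le> 2"
      using norm_triangle_ineq4[of "radial_stretch q z" "radial_stretch q w"] by linarith
    then have "cmod (radial_stretch q z - radial_stretch q w) powr (1 / q) \<le> 2 powr (1 / q)"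
      using q by (intro powr_mono2) auto
    also have "\<dots> \<le> ?C * cmod (z - w)"
      using False \<delta> by (simp add: field_simps)
    finally show ?thesis using e by simp
  qed
  have "cmod (radial_stretch q z - radial_stretch q w) powr (1 / q)
        \<le> \<epsilon> * (cmod z + cmod w) + ?C * cmod (z - w)" for z w
  proof (cases "cmod z + cmod w = 0")
    case True
    then have "z = 0" "w = 0" by (smt (verit) norm_ge_zero norm_le_zero_iff)+
    then show ?thesis using q by simp
  next
    case False
    \<comment> \<open>Dividing by \<open>s\<close> puts both points into the unit disc. The
      exponents \<open>q\<close> and \<open>1 / q\<close> cancel, so \<open>s\<close> comes out of
      the left side to the first power, as it does on the right.\<close>
    define s where "s = cmod z + cmod w"
    have s: "s > 0" using False unfolding s_def by (smt (verit) norm_ge_zero)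
    define z' w' where "z' = z / of_real s" and "w' = w / of_real s"
    have zw: "z = of_real s * z'" "w = of_real s * w'" using s by (auto simp: z'_def w'_def)
    have "cmod z' \<le> 1" "cmod w' \<le> 1"
      using s norm_ge_zero[of z] norm_ge_zero[of w]
      by (simp_all add: z'_def w'_def norm_divide divide_le_eq) (simp_all add: s_def)
    note u = unit[OF this]
    have d: "radial_stretch q z - radial_stretch q w = of_real (s powr q) * (radial_stretch q z' - radial_stretch q w')"
      using s unfolding zw by (simp add: radial_stretch_scale right_diff_distrib)
    have "cmod (radial_stretch q z - radial_stretch q w) powr (1 / q)
        = s * cmod (radial_stretch q z' - radial_stretch q w') powr (1 / q)"
      unfolding d using s q by (simp add: norm_mult powr_mult powr_powr)
    also have "\<dots> \<le> s * (\<epsilon> + ?C * cmod (z' - w'))"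
      using u s by (intro mult_left_mono) auto
    also have "\<dots> = \<epsilon> * s + ?C * cmod (z - w)"
      unfolding zw right_diff_distrib[symmetric] norm_mult using s by (simp add: algebra_simps)
    finally show ?thesis unfolding s_def .
  qed
  moreover have "?C \<ge> 0" using \<delta> by simp
  ultimately show thesis using that by blast
qed

section \<open>Subadditivity of the \<open>p\<close>-th power and p-summable families\<close>

lemma powr_add_le_add_powr:
  fixes x y p :: real
  assumes "0 \<le> x" "0 \<le> y" "0 < p" "p \<le> 1"
  shows "(x + y) powr p \<le> x powr p + y powr p"
proof (cases "x + y = 0")
  case False
  define s where "s = x + y"
  have s: "s > 0" using False assms by (simp add: s_def)
  \<comment> \<open>A number in [0,1] is at most its \<open>p\<close>-th power; it is applied to the
    shares \<open>x / s\<close> and \<open>y / s\<close>, which add up to 1.\<close>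
  have *: "t / s \<le> t powr p / s powr p" if "0 \<le> t" "t \<le> s" for t
  proof -
    have "(t / s) powr 1 \<le> (t / s) powr p"
      by (rule powr_mono') (use that s assms in auto)
    then show ?thesis using that s by (simp add: powr_divide)
  qed
  have "1 = x / s + y / s" using s by (simp add: s_def add_divide_distrib[symmetric])
  also have "\<dots> \<le> (x powr p + y powr p) / s powr p"
    using *[of x] *[of y] assms by (simp add: s_def add_divide_distrib)
  finally show ?thesis using s by (simp add: field_simps s_def)
qed (use assms in auto)

lemma cmod_powr_triangle:
  assumes "0 < p" "p \<le> 1"
  shows "cmod (z + w) powr p \<le> cmod z powr p + cmod w powr p"
  by (rule order_trans[OF powr_mono2[OF _ _ norm_triangle_ineq] powr_add_le_add_powr]) (use assms in auto)

text \<open>If \<sigma> is the sum of the \<open>p\<close>-th powers, each term is at most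
  \<open>\<sigma> powr (1 / p)\<close>. Splitting \<open>|g k|\<close> into its powers 1 - p and p
  and bounding the first factor gives an absolute sum of at most
  \<open>\<sigma> powr (1 / p)\<close>. Thus p-summability yields both convergence and the
  bound.\<close>

lemma
  fixes g :: "'i \<Rightarrow> complex"
  assumes p: "0 < p" "p \<le> 1" and fin: "(\<integral>\<^sup>+k. ennreal (cmod (g k) powr p) \<partial>count_space UNIV) < \<infinity>"
  shows integrable_count_space_of_powr: "integrable (count_space UNIV) g"
    and integral_count_space_powr_le:
      "ennreal (cmod (\<integral>k. g k \<partial>count_space UNIV) powr p) \<le> (\<integral>\<^sup>+k. ennreal (cmod (g k) powr p) \<partial>count_space UNIV)"
proof -
  obtain \<sigma> where \<sigma>: "\<sigma> \<ge> 0" and S: "(\<integral>\<^sup>+k. ennreal (cmod (g k) powr p) \<partial>count_space UNIV) = ennreal \<sigma>"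
    using fin by (metis ennreal_cases infinity_ennreal_def less_irrefl)
  have term_le: "cmod (g k) powr p \<le> \<sigma>" for k
  proof -
    have "ennreal (cmod (g k) powr p) \<le> (\<integral>\<^sup>+k. ennreal (cmod (g k) powr p) \<partial>count_space UNIV)"
      by (rule nn_integral_ge_point) simp
    then show ?thesis using \<sigma> S by simp
  qed
  \<comment> \<open>The exponent that turns a bound on \<open>|g k|^p\<close> into one on
    \<open>|g k|^(1 - p)\<close>.\<close>
  define r where "r = (1 - p) / p"
  have r: "r \<ge> 0" "p * r = 1 - p" "1 + r = 1 / p" using p by (auto simp: r_def field_simps)
  have "cmod (g k) \<le> \<sigma> powr r * cmod (g k) powr p" for k
  proof -
    have "cmod (g k) = cmod (g k) powr (p * r) * cmod (g k) powr p"
      unfolding powr_add[symmetric] r by simp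
    also have "\<dots> \<le> \<sigma> powr r * cmod (g k) powr p"
      unfolding powr_powr[symmetric] by (intro mult_right_mono powr_mono2 term_le r) auto
    finally show ?thesis .
  qed
  then have "(\<integral>\<^sup>+k. ennreal (cmod (g k)) \<partial>count_space UNIV) \<le> (\<integral>\<^sup>+k. ennreal (\<sigma> powr r) * ennreal (cmod (g k) powr p) \<partial>count_space UNIV)"
    by (intro nn_integral_mono) (simp add: ennreal_mult[symmetric])
  also have "\<dots> = ennreal (\<sigma> powr r * \<sigma>)"
    using \<sigma> by (simp add: nn_integral_cmult S ennreal_mult)
  also have "\<sigma> powr r * \<sigma> = \<sigma> powr (1 / p)"
    using \<sigma> by (cases "\<sigma> = 0") (auto simp: r(3)[symmetric] powr_add)
  finally have le: "(\<integral>\<^sup>+k. ennreal (cmod (g k)) \<partial>count_space UNIV) \<le> ennreal (\<sigma> powr (1 / p))" .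
  then show int: "integrable (count_space UNIV) g"
    by (intro integrableI_bounded) (auto simp: less_top[symmetric] top_unique)
  have "ennreal (cmod (\<integral>k. g k \<partial>count_space UNIV)) \<le> ennreal (\<sigma> powr (1 / p))"
    using integral_norm_bound_ennreal[OF int] le by (rule order_trans)
  then have "cmod (\<integral>k. g k \<partial>count_space UNIV) \<le> \<sigma> powr (1 / p)" by simp
  then have "cmod (\<integral>k. g k \<partial>count_space UNIV) powr p \<le> (\<sigma> powr (1 / p)) powr p"
    using p by (intro powr_mono2) auto
  also have "\<dots> = \<sigma>" using p \<sigma> by (simp add: powr_powr)
  finally show "ennreal (cmod (\<integral>k. g k \<partial>count_space UNIV) powr p) \<le> (\<integral>\<^sup>+k. ennreal (cmod (g k) powr p) \<partial>count_space UNIV)"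
    unfolding S using \<sigma> by simp
qed

text \<open>No convergence is needed, since the Bochner integral of a non-integrable function is 0.\<close>

lemma integral_count_space_powr_le':
  fixes g :: "'i \<Rightarrow> complex"
  assumes p: "0 < p" "p \<le> 1"
  shows "ennreal (cmod (\<integral>k. g k \<partial>count_space UNIV) powr p) \<le> (\<integral>\<^sup>+k. ennreal (cmod (g k) powr p) \<partial>count_space UNIV)"
  using integral_count_space_powr_le[OF p] by (metis infinity_ennreal_def less_top top_greatest)

text \<open>Unconditional and absolute summability agree for complex families, and both operators
  take the value 0 otherwise. From here on, series are treated as integrals.\<close>

lemma infsum_eq_integral_count_space:
  fixes g :: "'i \<Rightarrow> complex"
  shows "(\<Sum>\<^sub>\<infinity>k. g k) = (\<integral>k. g k \<partial>count_space UNIV)"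
proof (cases "integrable (count_space UNIV) g")
  case True
  then have "Infinite_Set_Sum.abs_summable_on g UNIV" by (simp add: Infinite_Set_Sum.abs_summable_on_def)
  from infsetsum_infsum[OF this] show ?thesis by (simp add: infsetsum_def)
next
  case False
  then have "\<not> Infinite_Set_Sum.abs_summable_on g UNIV" by (simp add: Infinite_Set_Sum.abs_summable_on_def)
  then have "\<not> g summable_on UNIV"
    using abs_summable_equivalent summable_on_iff_abs_summable_on_complex by blast
  then show ?thesis using False by (simp add: infsum_not_exists not_integrable_integral_eq)
qed

lemma borel_measurable_integral_count_space:
  fixes F :: "'i::countable \<Rightarrow> 'a \<Rightarrow> complex"
  assumes "\<And>k. F k \<in> borel_measurable M"
  shows "(\<lambda>x. \<integral>k. F k x \<partial>count_space UNIV) \<in> borel_measurable M"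
proof -
  interpret sigma_finite_measure "count_space (UNIV :: 'i set)"
    by (rule sigma_finite_measure_count_space)
  show ?thesis
  proof (rule borel_measurable_lebesgue_integral)
    have "(\<lambda>(k, x). F k x) \<in> borel_measurable (count_space UNIV \<Otimes>\<^sub>M M)"
      by (rule measurable_pair_measure_countable1) (use assms in auto)
    from measurable_compose[OF measurable_pair_swap' this]
    show "(\<lambda>(x, k). F k x) \<in> borel_measurable (M \<Otimes>\<^sub>M count_space UNIV)"
      by (simp add: split_beta' case_prod_unfold)
  qed
qed

lemma nn_integral_count_space_reindex:
  assumes "bij g"
  shows "(\<integral>\<^sup>+k. f (g k) \<partial>count_space UNIV) = (\<integral>\<^sup>+k. f k \<partial>count_space UNIV)"
  by (rule nn_integral_bij_count_space) (use assms in simp)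

lemma integral_count_space_reindex:
  fixes f :: "'i \<Rightarrow> complex"
  assumes "bij g"
  shows "(\<integral>k. f (g k) \<partial>count_space UNIV) = (\<integral>k. f k \<partial>count_space UNIV)"
  by (rule integral_bij_count_space) (use assms in simp)

section \<open>Density of compactly supported functions and unfolding over the unit cube\<close>

text \<open>A Urysohn function that is 1 on an inner closed set and 0 off an outer open set differs
  from the indicator only on two sets of small measure, and there by at most 1.\<close>

lemma indicator_L1_approx_continuous:
  fixes A :: "'a::euclidean_space set"
  assumes A: "A \<in> sets lebesgue" and e: "0 < e"
  obtains u :: "'a \<Rightarrow> real" where "continuous_on UNIV u"
    "(\<integral>\<^sup>+x. ennreal \<bar>indicator A x - u x\<bar> \<partial>lebesgue) < ennreal e"
proof -
  obtain U where U: "open U" "A \<subseteq> U" "U - A \<in> lmeasurable" "emeasure lebesgue (U - A) < ennreal (e/2)"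
    using sets_lebesgue_outer_open[OF A, of "e/2"] e by auto
  obtain K where K: "closed K" "K \<subseteq> A" "A - K \<in> lmeasurable" "emeasure lebesgue (A - K) < ennreal (e/2)"
    using sets_lebesgue_inner_closed[OF A, of "e/2"] e by auto
  obtain u :: "'a \<Rightarrow> real" where u: "continuous_on UNIV u" "\<And>x. u x \<in> closed_segment 1 0"
    "\<And>x. x \<in> K \<Longrightarrow> u x = 1" "\<And>x. x \<in> - U \<Longrightarrow> u x = 0"
    by (rule Urysohn[of K "- U" 1 0]) (use U K in auto)
  have u01: "0 \<le> u x" "u x \<le> 1" for x using u(2)[of x] by (auto simp: closed_segment_eq_real_ivl)
  have s: "U - A \<in> sets lebesgue" "A - K \<in> sets lebesgue" using U K by auto
  have "(\<integral>\<^sup>+x. ennreal \<bar>indicator A x - u x\<bar> \<partial>lebesgue) \<le> (\<integral>\<^sup>+x. indicator (U - A) x + indicator (A - K) x \<partial>lebesgue)"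
  proof (rule nn_integral_mono)
    fix x
    show "ennreal \<bar>indicator A x - u x\<bar> \<le> indicator (U - A) x + indicator (A - K) x"
      using u01[of x] u(3,4)[of x] U(2) K(2) by (auto simp: indicator_def)
  qed
  also have "\<dots> = emeasure lebesgue (U - A) + emeasure lebesgue (A - K)"
    using s by (subst nn_integral_add) (auto simp del: nn_integral_completion emeasure_completion)
  also have "\<dots> < ennreal (e/2) + ennreal (e/2)"
    using U(4) K(4) by (rule add_strict_mono)
  also have "\<dots> = ennreal e" using e by (simp flip: ennreal_plus)
  finally show thesis using that u(1) by blast
qed

lemma L1_approx_continuous:
  fixes h :: "'a::euclidean_space \<Rightarrow> complex"
  assumes "integrable lebesgue h" "0 < e"
  shows "\<exists>g. continuous_on UNIV g \<and> (\<integral>\<^sup>+x. ennreal (cmod (h x - g x)) \<partial>lebesgue) < ennreal e"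
  using assms
proof (induction arbitrary: e rule: integrable_induct)
  case (base A c)
  \<comment> \<open>The summand 1 covers the case \<open>c = 0\<close>.\<close>
  have d: "e / (1 + cmod c) > 0" using base by (simp add: add_pos_nonneg)
  obtain u :: "'a \<Rightarrow> real" where u: "continuous_on UNIV u"
    "(\<integral>\<^sup>+x. ennreal \<bar>indicator A x - u x\<bar> \<partial>lebesgue) < ennreal (e / (1 + cmod c))"
    using indicator_L1_approx_continuous[OF base(1) d] by blast
  have um: "u \<in> borel_measurable lebesgue"
    using borel_measurable_continuous_onI[OF u(1)] by (intro measurable_completion) auto
  have im: "(indicator A :: 'a \<Rightarrow> real) \<in> borel_measurable lebesgue" using base(1) by simp
  have "cmod (indicator A x *\<^sub>R c - of_real (u x) * c) = cmod c * \<bar>indicator A x - u x\<bar>" for x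
    by (simp add: scaleR_conv_of_real left_diff_distrib[symmetric] norm_mult flip: of_real_diff)
  then have "(\<integral>\<^sup>+x. ennreal (cmod (indicator A x *\<^sub>R c - of_real (u x) * c)) \<partial>lebesgue)
      = ennreal (cmod c) * (\<integral>\<^sup>+x. ennreal \<bar>indicator A x - u x\<bar> \<partial>lebesgue)"
    using um im by (simp add: ennreal_mult nn_integral_cmult del: nn_integral_completion)
  also have "\<dots> \<le> ennreal (cmod c) * ennreal (e / (1 + cmod c))"
    using u(2) by (intro mult_left_mono) auto
  also have "\<dots> = ennreal (cmod c * (e / (1 + cmod c)))"
    using d by (intro ennreal_mult[symmetric]) auto
  also have "\<dots> < ennreal e"
    using base(3) by (intro ennreal_lessI) (auto simp: field_simps add_pos_nonneg)
  finally show ?case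
    using u(1) by (intro exI[of _ "\<lambda>x. of_real (u x) * c"]) (auto intro!: continuous_intros)
next
  case (add f g)
  from add.IH(1)[of "e/2"] add.prems obtain f' where f': "continuous_on UNIV f'"
    "(\<integral>\<^sup>+x. ennreal (cmod (f x - f' x)) \<partial>lebesgue) < ennreal (e/2)" by auto
  from add.IH(2)[of "e/2"] add.prems obtain g' where g': "continuous_on UNIV g'"
    "(\<integral>\<^sup>+x. ennreal (cmod (g x - g' x)) \<partial>lebesgue) < ennreal (e/2)" by auto
  have m: "f' \<in> borel_measurable lebesgue" "g' \<in> borel_measurable lebesgue"
    using borel_measurable_continuous_onI[OF f'(1)] borel_measurable_continuous_onI[OF g'(1)]
    by (auto intro!: measurable_completion)
  have m': "f \<in> borel_measurable lebesgue" "g \<in> borel_measurable lebesgue"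
    using add.hyps by auto
  have "(\<integral>\<^sup>+x. ennreal (cmod (f x + g x - (f' x + g' x))) \<partial>lebesgue)
    \<le> (\<integral>\<^sup>+x. ennreal (cmod (f x - f' x)) + ennreal (cmod (g x - g' x)) \<partial>lebesgue)"
    by (intro nn_integral_mono) (simp add: norm_diff_triangle_ineq flip: ennreal_plus)
  also have "\<dots> = (\<integral>\<^sup>+x. ennreal (cmod (f x - f' x)) \<partial>lebesgue) + (\<integral>\<^sup>+x. ennreal (cmod (g x - g' x)) \<partial>lebesgue)"
    using m m' by (intro nn_integral_add) auto
  also have "\<dots> < ennreal (e/2) + ennreal (e/2)" using f'(2) g'(2) by (rule add_strict_mono)
  also have "\<dots> = ennreal e" using add.prems by (simp flip: ennreal_plus)
  finally show ?case
    using f'(1) g'(1) by (intro exI[of _ "\<lambda>x. f' x + g' x"]) (auto intro!: continuous_intros)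
next
  case (lim f s)
  have "(\<lambda>i. \<integral>\<^sup>+x. ennreal (cmod (f x - s i x)) \<partial>lebesgue) \<longlonglongrightarrow> 0"
    using lim.hyps by (intro nn_integral_dominated_convergence_norm[where w="\<lambda>x. 2 * cmod (f x)"])
      (auto simp: integrable_iff_bounded ennreal_mult nn_integral_cmult ennreal_mult_less_top simp del: nn_integral_completion)
  moreover have "0 < ennreal (e/2)" using lim.prems by simp
  ultimately have "\<forall>\<^sub>F i in sequentially. (\<integral>\<^sup>+x. ennreal (cmod (f x - s i x)) \<partial>lebesgue) < ennreal (e/2)"
    by (rule order_tendstoD(2))
  then obtain i where i: "(\<integral>\<^sup>+x. ennreal (cmod (f x - s i x)) \<partial>lebesgue) < ennreal (e/2)"
    by (auto simp: eventually_sequentially)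
  from lim.IH[of "e/2" i] lim.prems obtain g where g: "continuous_on UNIV g"
    "(\<integral>\<^sup>+x. ennreal (cmod (s i x - g x)) \<partial>lebesgue) < ennreal (e/2)" by auto
  have m: "g \<in> borel_measurable lebesgue" "f \<in> borel_measurable lebesgue" "s i \<in> borel_measurable lebesgue"
    using borel_measurable_continuous_onI[OF g(1)] lim.hyps by (auto intro!: measurable_completion)
  have "(\<integral>\<^sup>+x. ennreal (cmod (f x - g x)) \<partial>lebesgue)
    \<le> (\<integral>\<^sup>+x. ennreal (cmod (f x - s i x)) + ennreal (cmod (s i x - g x)) \<partial>lebesgue)"
    using norm_triangle_ineq[of "f x - s i x" "s i x - g x" for x]
    by (intro nn_integral_mono) (simp flip: ennreal_plus)
  also have "\<dots> = (\<integral>\<^sup>+x. ennreal (cmod (f x - s i x)) \<partial>lebesgue) + (\<integral>\<^sup>+x. ennreal (cmod (s i x - g x)) \<partial>lebesgue)"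
    using m by (intro nn_integral_add) auto
  also have "\<dots> < ennreal (e/2) + ennreal (e/2)" using i g(2) by (rule add_strict_mono)
  also have "\<dots> = ennreal e" using lim.prems by (simp flip: ennreal_plus)
  finally show ?case using g(1) by blast
qed

lemma L1_approx_compactly_supported:
  fixes h :: "'a::euclidean_space \<Rightarrow> complex"
  assumes h: "integrable lebesgue h" and e: "0 < e"
  obtains g R where "continuous_on UNIV g" "\<And>x. R < norm x \<Longrightarrow> g x = 0"
    "(\<integral>\<^sup>+x. ennreal (cmod (h x - g x)) \<partial>lebesgue) < ennreal e"
proof -
  obtain g where g: "continuous_on UNIV g" "(\<integral>\<^sup>+x. ennreal (cmod (h x - g x)) \<partial>lebesgue) < ennreal (e/2)"
    using L1_approx_continuous[OF h, of "e/2"] e by auto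
  \<comment> \<open>A continuous radial cutoff: 1 on the ball of radius \<open>n\<close>, 0 outside
    the ball of radius \<open>n + 1\<close>.\<close>
  define u where "u n x = max 0 (min 1 (real n + 1 - norm x))" for n and x :: 'a
  have u: "continuous_on UNIV (u n)" "0 \<le> u n x" "u n x \<le> 1" for n x
    unfolding u_def[abs_def] by (auto intro!: continuous_intros)
  define G where "G n x = of_real (u n x) * g x" for n x
  have G: "continuous_on UNIV (G n)" for n
    unfolding G_def[abs_def] by (intro continuous_intros g(1) continuous_on_subset[OF u(1)]) auto
  have m: "g \<in> borel_measurable lebesgue" "G n \<in> borel_measurable lebesgue" for n
    using borel_measurable_continuous_onI[OF g(1)] borel_measurable_continuous_onI[OF G]
    by (auto intro!: measurable_completion)
  have hm: "h \<in> borel_measurable lebesgue" using h by auto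
  \<comment> \<open>So far \<open>g\<close> is merely continuous; it inherits integrability from
    \<open>h\<close>, and \<open>|g|\<close> can then dominate the truncation errors.\<close>
  have gi: "(\<integral>\<^sup>+x. ennreal (cmod (g x)) \<partial>lebesgue) < \<infinity>"
  proof -
    have "(\<integral>\<^sup>+x. ennreal (cmod (g x)) \<partial>lebesgue) \<le> (\<integral>\<^sup>+x. ennreal (cmod (h x)) + ennreal (cmod (h x - g x)) \<partial>lebesgue)"
      by (intro nn_integral_mono) (auto simp flip: ennreal_plus intro: norm_triangle_sub simp: norm_minus_commute)
    also have "\<dots> = (\<integral>\<^sup>+x. ennreal (cmod (h x)) \<partial>lebesgue) + (\<integral>\<^sup>+x. ennreal (cmod (h x - g x)) \<partial>lebesgue)"
      using m hm by (intro nn_integral_add) auto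
    also have "\<dots> < \<infinity>"
      using h order.strict_trans[OF g(2) ennreal_less_top] by (auto simp: integrable_iff_bounded)
    finally show ?thesis .
  qed
  have "(\<lambda>n. \<integral>\<^sup>+x. ennreal (cmod (g x - G n x)) \<partial>lebesgue) \<longlonglongrightarrow> 0"
  proof (rule nn_integral_dominated_convergence_norm[where w="\<lambda>x. cmod (g x)"])
    show "AE x in lebesgue. (\<lambda>n. G n x) \<longlonglongrightarrow> g x"
    proof (intro AE_I2)
      fix x :: 'a
      have "G n x = g x" if "n \<ge> nat \<lceil>norm x\<rceil>" for n
      proof -
        have "norm x \<le> n" using that by linarith
        then show ?thesis by (simp add: G_def u_def)
      qed
      then show "(\<lambda>n. G n x) \<longlonglongrightarrow> g x"
        by (intro tendsto_eventually eventually_sequentiallyI) 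
    qed
    show "AE x in lebesgue. cmod (G n x) \<le> cmod (g x)" for n
      using u by (auto simp: G_def norm_mult mult_left_le_one_le)
  qed (use m gi in auto)
  moreover have "0 < ennreal (e/2)" using e by simp
  ultimately have "\<forall>\<^sub>F n in sequentially. (\<integral>\<^sup>+x. ennreal (cmod (g x - G n x)) \<partial>lebesgue) < ennreal (e/2)"
    by (rule order_tendstoD(2))
  then obtain n where n: "(\<integral>\<^sup>+x. ennreal (cmod (g x - G n x)) \<partial>lebesgue) < ennreal (e/2)"
    by (auto simp: eventually_sequentially)
  have "(\<integral>\<^sup>+x. ennreal (cmod (h x - G n x)) \<partial>lebesgue)
    \<le> (\<integral>\<^sup>+x. ennreal (cmod (h x - g x)) + ennreal (cmod (g x - G n x)) \<partial>lebesgue)"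
    by (intro nn_integral_mono) (metis diff_add_cancel add_diff_eq ennreal_leI ennreal_plus norm_ge_zero norm_triangle_ineq)
  also have "\<dots> = (\<integral>\<^sup>+x. ennreal (cmod (h x - g x)) \<partial>lebesgue) + (\<integral>\<^sup>+x. ennreal (cmod (g x - G n x)) \<partial>lebesgue)"
    using m hm by (intro nn_integral_add) auto
  also have "\<dots> < ennreal (e/2) + ennreal (e/2)" using g(2) n by (rule add_strict_mono)
  also have "\<dots> = ennreal e" using e by (simp flip: ennreal_plus)
  finally have "(\<integral>\<^sup>+x. ennreal (cmod (h x - G n x)) \<partial>lebesgue) < ennreal e" .
  moreover have "G n x = 0" if "norm x > real n + 1" for x using that by (simp add: G_def u_def)
  ultimately show thesis using that[of "G n" "real n + 1"] G by blast
qed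

section \<open>The integer lattice and its fundamental cube\<close>

definition lattice_vec :: "int ^ 'n \<Rightarrow> real ^ 'n" where
  "lattice_vec k = (\<chi> i. real_of_int (k $ i))"

lemma unit_cube_borel: "(unit_cube :: (real^'n) set) \<in> sets borel"
proof -
  have "(unit_cube :: (real^'n) set) = (\<Inter>i\<in>UNIV. {x. 0 \<le> x $ i} \<inter> {x. x $ i < 1})"
    by (auto simp: unit_cube_def)
  also have "\<dots> \<in> sets borel"
    by (intro sets.finite_INT sets.Int) (auto intro!: borel_closed borel_open closed_Collect_le open_Collect_less continuous_intros)
  finally show ?thesis .
qed

text \<open>In each coordinate exactly one integer shift, minus the floor, leads into [0,1); this is
  where the cube has to be half-open.\<close>

lemma unit_cube_translates: "(\<integral>\<^sup>+k. indicator unit_cube (x + lattice_vec k) \<partial>count_space UNIV) = (1::ennreal)"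
proof -
  let ?k = "\<chi> i. - \<lfloor>x $ i\<rfloor>"
  have fl: "0 \<le> t + real_of_int m \<and> t + real_of_int m < 1 \<longleftrightarrow> m = - \<lfloor>t\<rfloor>" for t m by linarith
  have "x + lattice_vec k \<in> unit_cube \<longleftrightarrow> k = ?k" for k
    by (simp add: unit_cube_def lattice_vec_def fl vec_eq_iff)
  then have "(\<lambda>k. indicator unit_cube (x + lattice_vec k) :: ennreal) = indicator {?k}"
    by (auto simp: indicator_def)
  then show ?thesis by simp
qed

text \<open>The translates of the cube tile the space: insert their indicators, which sum to 1,
  exchange sum and integral, and move each piece back to the cube.\<close>

lemma nn_integral_unfold:
  fixes g :: "real^'n \<Rightarrow> ennreal"
  assumes g: "g \<in> borel_measurable lebesgue"
  shows "(\<integral>\<^sup>+x. g x \<partial>lebesgue) = (\<integral>\<^sup>+x. indicator unit_cube x * (\<integral>\<^sup>+k. g (x - lattice_vec k) \<partial>count_space UNIV) \<partial>lebesgue)"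
proof -
  have tr: "(\<lambda>x. f (x + t)) \<in> borel_measurable lebesgue" if "f \<in> borel_measurable lebesgue"
    for f :: "real^'n \<Rightarrow> ennreal" and t
    using measurable_compose[OF measurable_lebesgue_translation that] .
  have ic: "(indicator unit_cube :: real^'n \<Rightarrow> ennreal) \<in> borel_measurable lebesgue"
    using unit_cube_borel by (intro borel_measurable_indicator) auto
  have "(\<integral>\<^sup>+x. g x \<partial>lebesgue) = (\<integral>\<^sup>+x. (\<integral>\<^sup>+k. g x * indicator unit_cube (x + lattice_vec k) \<partial>count_space UNIV) \<partial>lebesgue)"
    by (simp add: nn_integral_cmult unit_cube_translates)
  also have "\<dots> = (\<integral>\<^sup>+k. (\<integral>\<^sup>+x. g x * indicator unit_cube (x + lattice_vec k) \<partial>lebesgue) \<partial>count_space UNIV)"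
    by (rule nn_integral_count_space_nn_integral) (auto intro: borel_measurable_times_ennreal[OF g tr[OF ic]])
  also have "\<dots> = (\<integral>\<^sup>+k. (\<integral>\<^sup>+x. g (x - lattice_vec k) * indicator unit_cube x \<partial>lebesgue) \<partial>count_space UNIV)"
  proof (rule nn_integral_cong)
    fix k :: "int^'n"
    have "(\<lambda>x. g (x - lattice_vec k)) \<in> borel_measurable lebesgue" using tr[OF g, of "- lattice_vec k"] by simp
    from nn_integral_lebesgue_translation[OF borel_measurable_times_ennreal[OF this ic], of "lattice_vec k"]
    show "(\<integral>\<^sup>+x. g x * indicator unit_cube (x + lattice_vec k) \<partial>lebesgue)
       = (\<integral>\<^sup>+x. g (x - lattice_vec k) * indicator unit_cube x \<partial>lebesgue)" by simp
  qed
  also have "\<dots> = (\<integral>\<^sup>+x. (\<integral>\<^sup>+k. g (x - lattice_vec k) * indicator unit_cube x \<partial>count_space UNIV) \<partial>lebesgue)"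
    using borel_measurable_times_ennreal[OF tr[OF g, of "- lattice_vec k" for k] ic]
    by (intro nn_integral_count_space_nn_integral[symmetric]) auto
  finally show ?thesis by (simp add: nn_integral_cmult mult.commute)
qed

lemma emeasure_unit_cube: "emeasure lebesgue (unit_cube :: (real^'n) set) = 1"
proof -
  have "box 0 1 \<subseteq> (unit_cube :: (real^'n) set)" "(unit_cube :: (real^'n) set) \<subseteq> cbox 0 1"
    by (auto simp: unit_cube_def mem_box_cart less_imp_le)
  moreover have "(1::real^'n) \<bullet> b = 1" if "b \<in> Basis" for b
    using that by (auto simp: Basis_vec_def inner_axis)
  then have "emeasure lborel (cbox 0 (1::real^'n)) = 1" "emeasure lborel (box 0 (1::real^'n)) = 1"
    by (simp_all add: emeasure_lborel_cbox_eq emeasure_lborel_box_eq)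
  moreover have "emeasure lebesgue (unit_cube :: (real^'n) set) = emeasure lborel (unit_cube :: (real^'n) set)"
    by (simp add: unit_cube_borel)
  ultimately have "emeasure lborel (unit_cube :: (real^'n) set) \<le> 1" "1 \<le> emeasure lborel (unit_cube :: (real^'n) set)"
    using emeasure_mono[of "box 0 1" "unit_cube :: (real^'n) set" lborel]
      emeasure_mono[of unit_cube "cbox 0 (1::real^'n)" lborel] unit_cube_borel[where 'n='n] by auto
  then have "emeasure lborel (unit_cube :: (real^'n) set) = 1" by (rule antisym)
  then show ?thesis by (simp add: unit_cube_borel)
qed

section \<open>Oscillation over a shrinking lattice\<close>

text \<open>The lower bound carries its error on the side of \<open>f\<close>, which avoids
  subtraction. Finiteness of \<open>L\<close> ensures that \<open>L + e\<close> lies strictly above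
  \<open>L\<close>.\<close>

lemma tendsto_ennreal_sandwich:
  fixes f :: "nat \<Rightarrow> ennreal"
  assumes fin: "L < \<infinity>"
    and up: "\<And>e::real. e > 0 \<Longrightarrow> \<forall>\<^sub>F n in F. f n \<le> L + ennreal e"
    and lo: "\<And>e::real. e > 0 \<Longrightarrow> \<forall>\<^sub>F n in F. L \<le> f n + ennreal e"
  shows "(f \<longlongrightarrow> L) F"
proof -
  obtain l where l: "l \<ge> 0" "L = ennreal l" using fin by (cases L) auto
  show ?thesis
  proof (rule order_tendstoI)
    fix a assume a: "a < L"
    then obtain a' where a': "a' \<ge> 0" "a = ennreal a'" "a' < l" using l by (cases a) (auto simp: ennreal_less_iff)
    have "\<forall>\<^sub>F n in F. L \<le> f n + ennreal ((l - a') / 2)" using lo a' by simp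
    then show "\<forall>\<^sub>F n in F. a < f n"
    proof eventually_elim
      case (elim n)
      show ?case
      proof (cases "f n")
        case (real r)
        then have "l \<le> r + (l - a') / 2" using elim l a' by (simp flip: ennreal_plus)
        then have "a' < r" using a'(3) by (simp add: field_simps)
        then show ?thesis using real a' by (simp add: ennreal_less_iff)
      qed (use a' in simp)
    qed
  next
    fix a assume a: "L < a"
    show "\<forall>\<^sub>F n in F. f n < a"
    proof (cases a)
      case (real a')
      then have la: "l < a'" using a l by (simp add: ennreal_less_iff)
      have "\<forall>\<^sub>F n in F. f n \<le> L + ennreal ((a' - l) / 2)" using up la by simp
      then show ?thesis
      proof eventually_elim
        case (elim n)
        also have "L + ennreal ((a' - l) / 2) = ennreal (l + (a' - l) / 2)" using l la by simp
        also have "\<dots> < a" unfolding real(2) by (rule ennreal_lessI) (use la l in \<open>auto simp: field_simps\<close>)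
        finally show ?case .
      qed
    next
      case top
      have "\<forall>\<^sub>F n in F. f n \<le> L + ennreal 1" using up[of 1] by simp
      then show ?thesis
      proof eventually_elim
        case (elim n)
        also have "L + ennreal 1 = ennreal (l + 1)" using l by simp
        also have "\<dots> < a" using top by simp
        finally show ?case .
      qed
    qed
  qed
qed

lemma tendsto_zero_ennrealI:
  fixes f :: "nat \<Rightarrow> ennreal"
  assumes "\<And>e::real. e > 0 \<Longrightarrow> \<forall>\<^sub>F n in F. f n \<le> ennreal e"
  shows "(f \<longlongrightarrow> 0) F"
  by (rule tendsto_ennreal_sandwich) (use assms in auto)

lemma lattice_vec_uminus: "lattice_vec (- k) = - lattice_vec k"
  by (simp add: lattice_vec_def vec_eq_iff)

lemma lattice_vec_add: "lattice_vec (k + l) = lattice_vec k + lattice_vec l"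
  by (simp add: lattice_vec_def vec_eq_iff)

lemma bij_uminus_vec: "bij (uminus :: int ^ 'n \<Rightarrow> int ^ 'n)"
  by (rule o_bij[of uminus]) auto

lemma nn_integral_lattice_uminus:
  "(\<integral>\<^sup>+k. f (x - lattice_vec k) \<partial>count_space UNIV) = (\<integral>\<^sup>+k. f (x + lattice_vec k) \<partial>count_space UNIV)"
  using nn_integral_count_space_reindex[OF bij_uminus_vec, of "\<lambda>k. f (x + lattice_vec k)"]
  by (simp add: lattice_vec_uminus)

lemma norm_unit_cube_le: "x \<in> unit_cube \<Longrightarrow> norm (x :: real^'n) \<le> CARD('n)"
proof -
  assume "x \<in> unit_cube"
  then have "\<bar>x $ i\<bar> \<le> 1" for i by (auto simp: unit_cube_def less_imp_le abs_of_nonneg)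
  then have "(\<Sum>i\<in>UNIV. \<bar>x $ i\<bar>) \<le> (\<Sum>i\<in>(UNIV::'n set). 1)" by (intro sum_mono)
  with norm_le_l1_cart[of x] show ?thesis by simp
qed

lemma
  fixes M :: "'a::semiring_1^'n^'n"
  assumes "invertible M"
  shows matrix_inv_mult_left: "matrix_inv M ** M = mat 1"
    and matrix_inv_mult_right: "M ** matrix_inv M = mat 1"
  using someI_ex[OF assms[unfolded invertible_def]] unfolding matrix_inv_def by blast+

lemma det_matrix_inv:
  fixes M :: "real^'n^'n"
  assumes "det M \<noteq> 0"
  shows "det (matrix_inv M) = inverse (det M)" and "M *v (matrix_inv M *v x) = x"
    and "matrix_inv M *v (M *v x) = x"
proof -
  have i: "invertible M" using assms by (simp add: invertible_det_nz)
  then have "det (matrix_inv M ** M) = 1" by (simp add: matrix_inv_mult_left)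
  then show "det (matrix_inv M) = inverse (det M)" 
    using inverse_unique[of "det M" "det (matrix_inv M)"] by (simp add: det_mul mult.commute)
  show "M *v (matrix_inv M *v x) = x" "matrix_inv M *v (M *v x) = x"
    using i by (simp_all add: matrix_vector_mul_assoc matrix_inv_mult_left matrix_inv_mult_right)
qed

lemma norm_matrix_inv_le: "norm (matrix_inv M *v x) \<le> onorm ((*v) (matrix_inv M)) * norm (x :: real^'n)"
  by (rule onorm) (rule matrix_vector_mul_bounded_linear)

text \<open>\<open>CARD('n)\<close> bounds the norm on the unit cube, so an expanding matrix pulls the cube back into the
  unit ball.\<close>

definition expanding :: "real^'n^'n \<Rightarrow> bool" where
  "expanding M \<longleftrightarrow> det M \<noteq> 0 \<and> onorm ((*v) (matrix_inv M)) * CARD('n) \<le> 1"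

text \<open>A volume count: the cells \<open>matrix_inv M *v (z + k + cube)\<close> are disjoint,
  have volume \<open>1 / |det M|\<close> and diameter small enough that every cell whose corner lies
  in the ball of radius \<open>R\<close> stays within radius \<open>R + 1\<close>.\<close>

lemma lattice_count_bound:
  fixes M :: "real^'n^'n"
  assumes M: "expanding M"
  shows "ennreal (inverse \<bar>det M\<bar>) * (\<integral>\<^sup>+k. indicator (cball 0 R) (matrix_inv M *v (z + lattice_vec k)) \<partial>count_space UNIV)
     \<le> emeasure lebesgue (cball 0 (R + 1) :: (real^'n) set)"
proof -
  have d: "det M \<noteq> 0" using M by (simp add: expanding_def)
  have d': "det (matrix_inv M) \<noteq> 0" using d by (simp add: det_matrix_inv)
  let ?S = "\<integral>\<^sup>+k. indicator (cball 0 R) (matrix_inv M *v (z + lattice_vec k)) \<partial>count_space UNIV :: ennreal"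
  let ?B = "cball 0 (R + 1) :: (real^'n) set"
  define G :: "real^'n \<Rightarrow> ennreal" where "G x = indicator ?B (matrix_inv M *v x + matrix_inv M *v z)" for x
  have iB: "(indicator ?B :: real^'n \<Rightarrow> ennreal) \<in> borel_measurable lebesgue" by (intro borel_measurable_indicator) auto
  have Gm: "G \<in> borel_measurable lebesgue"
    unfolding G_def[abs_def] using measurable_compose[OF measurable_lebesgue_affine[OF d'] iB] .
  have cube: "unit_cube \<in> sets lebesgue" by (simp add: unit_cube_borel)
  \<comment> \<open>The number \<open>?S\<close> is spread over the cube, of measure 1, so that each
    counted point becomes a whole cell.\<close>
  have "?S = ?S * emeasure lebesgue (unit_cube :: (real^'n) set)" by (simp only: emeasure_unit_cube mult_1_right)
  also have "\<dots> = (\<integral>\<^sup>+x. indicator unit_cube (x :: real^'n) * ?S \<partial>lebesgue)"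
    by (subst nn_integral_multc[OF borel_measurable_indicator[OF cube]])
      (simp add: mult.commute nn_integral_indicator[OF cube] del: nn_integral_completion emeasure_completion)
  also have "\<dots> \<le> (\<integral>\<^sup>+x. indicator unit_cube x * (\<integral>\<^sup>+k. G (x - lattice_vec k) \<partial>count_space UNIV) \<partial>lebesgue)"
  proof (rule nn_integral_mono)
    fix x :: "real^'n"
    have "?S \<le> (\<integral>\<^sup>+k. G (x + lattice_vec k) \<partial>count_space UNIV)" if x: "x \<in> unit_cube"
    proof (rule nn_integral_mono)
      fix k :: "int^'n"
      have "norm (matrix_inv M *v x) \<le> onorm ((*v) (matrix_inv M)) * CARD('n)"
        using norm_unit_cube_le[OF x] by (intro order_trans[OF norm_matrix_inv_le] mult_left_mono onorm_pos_le) auto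
      also have "\<dots> \<le> 1" using M by (simp add: expanding_def)
      finally have n: "norm (matrix_inv M *v x) \<le> 1" .
      have "norm (matrix_inv M *v (x + lattice_vec k) + matrix_inv M *v z) \<le> R + 1"
        if "norm (matrix_inv M *v (z + lattice_vec k)) \<le> R"
      proof -
        have "matrix_inv M *v (x + lattice_vec k) + matrix_inv M *v z = matrix_inv M *v x + matrix_inv M *v (z + lattice_vec k)"
          by (simp add: matrix_vector_right_distrib)
        then show ?thesis using n that norm_triangle_ineq[of "matrix_inv M *v x" "matrix_inv M *v (z + lattice_vec k)"]
          by simp
      qed
      then show "indicator (cball 0 R) (matrix_inv M *v (z + lattice_vec k)) \<le> G (x + lattice_vec k)"
        by (auto simp: G_def indicator_def)
    qed
    then show "indicator unit_cube x * ?S \<le> indicator unit_cube x * (\<integral>\<^sup>+k. G (x - lattice_vec k) \<partial>count_space UNIV)"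
      by (auto simp: indicator_def nn_integral_lattice_uminus)
  qed
  also have "\<dots> = (\<integral>\<^sup>+x. G x \<partial>lebesgue)" by (rule nn_integral_unfold[OF Gm, symmetric])
  finally have "ennreal \<bar>det (matrix_inv M)\<bar> * ?S \<le> ennreal \<bar>det (matrix_inv M)\<bar> * (\<integral>\<^sup>+x. G x \<partial>lebesgue)"
    by (rule mult_left_mono) simp
  also have "\<dots> = emeasure lebesgue ?B"
    unfolding G_def nn_integral_lebesgue_affine[OF d' iB] by simp
  finally show ?thesis using d by (simp add: det_matrix_inv)
qed

text \<open>A Riemann sum with cell volume \<open>1 / |det M|\<close>. The unshifted lattice is the
  common reference, so that two shifts can be compared by the triangle inequality.\<close>

definition lattice_osc :: "real^'n^'n \<Rightarrow> (real^'n \<Rightarrow> complex) \<Rightarrow> real^'n \<Rightarrow> ennreal" where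
  "lattice_osc M h z = ennreal (inverse \<bar>det M\<bar>) *
     (\<integral>\<^sup>+k. ennreal (cmod (h (matrix_inv M *v (z + lattice_vec k)) - h (matrix_inv M *v lattice_vec k))) \<partial>count_space UNIV)"

text \<open>Two points at distance less than 1 lie either both in the ball of radius
  \<open>R + 1\<close>, which is compact, or both where \<open>h\<close> vanishes.\<close>

lemma compactly_supported_uniformly_continuous:
  fixes h :: "'a::euclidean_space \<Rightarrow> complex"
  assumes h: "continuous_on UNIV h" "\<And>x. R < norm x \<Longrightarrow> h x = 0" and e: "0 < e"
  obtains d where "0 < d" "\<And>u v :: 'a. norm (u - v) < d \<Longrightarrow> cmod (h u - h v) < e"
proof -
  have "uniformly_continuous_on (cball 0 (R + 1)) h"
    by (rule compact_uniformly_continuous[OF continuous_on_subset[OF h(1)]]) auto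
  with e obtain d where d: "d > 0" and u: "\<And>x x'. x \<in> cball 0 (R + 1) \<Longrightarrow> x' \<in> cball 0 (R + 1) \<Longrightarrow> dist x' x < d \<Longrightarrow> dist (h x') (h x) < e"
    unfolding uniformly_continuous_on_def by meson
  show thesis
  proof (rule that[of "min d 1"])
    fix u v :: 'a assume uv: "norm (u - v :: 'a) < min d 1"
    show "cmod (h u - h v) < e"
    proof (cases "norm u \<le> R + 1 \<and> norm v \<le> R + 1")
      case True
      then show ?thesis using u[of v u] uv by (simp add: dist_norm)
    next
      case False
      then have "R < norm u" "R < norm v"
        using uv norm_triangle_ineq2[of u v] norm_triangle_ineq2[of v u] by (auto simp: norm_minus_commute)
      then show ?thesis using h(2) e by simp
    qed
  qed (use d in auto)
qed

text \<open>A term vanishes unless the shifted or the unshifted sample lies in the ball of radius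
  \<open>R\<close>. Each of the two families is counted by \<open>lattice_count_bound\<close>, hence
  the factor 2.\<close>

lemma lattice_osc_le:
  fixes M :: "real^'n^'n"
  assumes M: "expanding M" and supp: "\<And>x. R < norm x \<Longrightarrow> h x = 0" and c: "0 \<le> c"
    and le: "\<And>k. cmod (h (matrix_inv M *v (z + lattice_vec k)) - h (matrix_inv M *v lattice_vec k)) \<le> c"
  shows "lattice_osc M h z \<le> ennreal (2 * c) * emeasure lebesgue (cball 0 (R + 1) :: (real^'n) set)"
proof -
  let ?I = "\<lambda>z k. indicator (cball 0 R) (matrix_inv M *v (z + lattice_vec k)) :: ennreal"
  let ?V = "emeasure lebesgue (cball 0 (R + 1) :: (real^'n) set)"
  have "ennreal (cmod (h (matrix_inv M *v (z + lattice_vec k)) - h (matrix_inv M *v lattice_vec k)))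
      \<le> ennreal c * (?I z k + ?I 0 k)" for k
  proof (cases "norm (matrix_inv M *v (z + lattice_vec k)) \<le> R \<or> norm (matrix_inv M *v lattice_vec k) \<le> R")
    case True
    have "ennreal (cmod (h (matrix_inv M *v (z + lattice_vec k)) - h (matrix_inv M *v lattice_vec k))) \<le> ennreal c * 1"
      using le[of k] by (simp add: ennreal_leI)
    also have "\<dots> \<le> ennreal c * (?I z k + ?I 0 k)"
      using True by (intro mult_left_mono) (auto simp: indicator_def)
    finally show ?thesis .
  next
    case False
    then show ?thesis using supp by simp
  qed
  then have "lattice_osc M h z \<le> ennreal (inverse \<bar>det M\<bar>) * (\<integral>\<^sup>+k. ennreal c * (?I z k + ?I 0 k) \<partial>count_space UNIV)"
    unfolding lattice_osc_def by (intro mult_left_mono nn_integral_mono) auto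
  also have "\<dots> = ennreal c * (ennreal (inverse \<bar>det M\<bar>) * (\<integral>\<^sup>+k. ?I z k \<partial>count_space UNIV)
       + ennreal (inverse \<bar>det M\<bar>) * (\<integral>\<^sup>+k. ?I 0 k \<partial>count_space UNIV))"
    by (simp add: nn_integral_cmult nn_integral_add algebra_simps)
  also have "\<dots> \<le> ennreal c * (?V + ?V)"
    by (intro mult_left_mono add_mono lattice_count_bound M) auto
  also have "\<dots> = ennreal (2 * c) * ?V"
    using c by (simp add: ennreal_mult algebra_simps mult_2 del: emeasure_completion)
  finally show ?thesis .
qed

lemma lattice_osc_bound:
  fixes M :: "real^'n^'n"
  assumes M: "expanding M" and supp: "\<And>x. R < norm x \<Longrightarrow> h x = 0" and H: "\<And>x. cmod (h x) \<le> H"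
  shows "lattice_osc M h z \<le> ennreal (4 * H) * emeasure lebesgue (cball 0 (R + 1) :: (real^'n) set)"
proof -
  have "0 \<le> H" using H[of 0] norm_ge_zero[of "h 0"] by linarith
  moreover have "cmod (h u - h v) \<le> 2 * H" for u v
    using norm_triangle_ineq4[of "h u" "h v"] H[of u] H[of v] by linarith
  ultimately show ?thesis using lattice_osc_le[of M R h "2 * H" z, OF M supp] by simp
qed

lemma emeasure_cball_finite: "emeasure lebesgue (cball x r :: 'a::euclidean_space set) < \<infinity>"
  using emeasure_bounded_finite[of "cball x r"] by simp

lemma lattice_osc_tendsto_0:
  fixes M :: "nat \<Rightarrow> real^'n^'n"
  assumes M: "\<And>j. expanding (M j)" and lim: "(\<lambda>j. onorm ((*v) (matrix_inv (M j)))) \<longlonglongrightarrow> 0"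
    and h: "continuous_on UNIV h" and supp: "\<And>x. R < norm x \<Longrightarrow> h x = 0"
  shows "(\<lambda>j. lattice_osc (M j) h z) \<longlonglongrightarrow> 0"
proof (rule tendsto_zero_ennrealI)
  fix e :: real assume e: "0 < e"
  obtain v where v: "v \<ge> 0" "emeasure lebesgue (cball 0 (R + 1) :: (real^'n) set) = ennreal v"
    using emeasure_cball_finite[of "0::real^'n" "R+1"] by (metis ennreal_cases infinity_ennreal_def less_irrefl)
  \<comment> \<open>Chosen so that \<open>2 * c * v \<le> e\<close>; the summand 1 covers a ball of
    volume 0.\<close>
  define c where "c = e / (2 * (v + 1))"
  have c: "c > 0" using e v by (simp add: c_def)
  obtain d where d: "d > 0" "\<And>u v. norm (u - v) < d \<Longrightarrow> cmod (h u - h v) < c"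
    using compactly_supported_uniformly_continuous[OF h supp c] by blast
  have "(\<lambda>j. onorm ((*v) (matrix_inv (M j))) * norm z) \<longlonglongrightarrow> 0" using tendsto_mult_right[OF lim, of "norm z"] by simp
  then have "\<forall>\<^sub>F j in sequentially. onorm ((*v) (matrix_inv (M j))) * norm z < d" using d(1) by (rule order_tendstoD(2))
  then show "\<forall>\<^sub>F j in sequentially. lattice_osc (M j) h z \<le> ennreal e"
  proof eventually_elim
    case (elim j)
    have "cmod (h (matrix_inv (M j) *v (z + lattice_vec k)) - h (matrix_inv (M j) *v lattice_vec k)) \<le> c" for k
    proof (rule less_imp_le, rule d(2))
      have "matrix_inv (M j) *v (z + lattice_vec k) - matrix_inv (M j) *v lattice_vec k = matrix_inv (M j) *v z"
        by (simp add: matrix_vector_right_distrib)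
      then show "norm (matrix_inv (M j) *v (z + lattice_vec k) - matrix_inv (M j) *v lattice_vec k) < d"
        using norm_matrix_inv_le[of "M j" z] elim by simp
    qed
    then have "lattice_osc (M j) h z \<le> ennreal (2 * c) * ennreal v"
      using lattice_osc_le[of "M j" R h c z, OF M supp less_imp_le[OF c]] v(2) by simp
    also have "\<dots> = ennreal (2 * c * v)" using c v by (simp add: ennreal_mult)
    also have "\<dots> \<le> ennreal e"
      using e v by (intro ennreal_leI) (simp add: c_def field_simps)
    finally show ?case .
  qed
qed

section \<open>Sampling coefficients and synthesis\<close>

lemma integral_lebesgue_affine:
  fixes M :: "real^'n^'n" and g :: "real^'n \<Rightarrow> complex"
  assumes d: "det M \<noteq> 0" and g: "g \<in> borel_measurable lebesgue"
  shows "of_real \<bar>det M\<bar> * (\<integral>x. g (M *v x + t) \<partial>lebesgue) = (\<integral>x. g x \<partial>lebesgue)"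
proof -
  have m: "(\<lambda>x. g (x + t)) \<in> borel_measurable lebesgue"
    using measurable_compose[OF measurable_lebesgue_translation g] .
  have m': "(\<lambda>x. g (M *v x + t)) \<in> borel_measurable lebesgue"
    using measurable_compose[OF measurable_lebesgue_affine[OF d] g] .
  have "(\<integral>x. g x \<partial>lebesgue) = (\<integral>x. g x \<partial>distr lebesgue lebesgue (\<lambda>x. x + t))"
    by (subst lebesgue_translation[of t]) rule
  also have "\<dots> = (\<integral>x. g (x + t) \<partial>lebesgue)"
    by (rule integral_distr[OF measurable_lebesgue_translation g])
  also have "\<dots> = (\<integral>x. g (x + t) \<partial>density (distr lebesgue lebesgue ((*v) M)) (\<lambda>_. ennreal \<bar>det M\<bar>))"
    by (subst lebesgue_linear[OF d]) rule
  also have "\<dots> = (\<integral>x. \<bar>det M\<bar> *\<^sub>R g (x + t) \<partial>distr lebesgue lebesgue ((*v) M))"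
    using m by (intro integral_density) auto
  also have "\<dots> = (\<integral>x. \<bar>det M\<bar> *\<^sub>R g (M *v x + t) \<partial>lebesgue)"
    using m by (intro integral_distr measurable_lebesgue_linear[OF d]) auto
  finally show ?thesis by (simp add: scaleR_conv_of_real)
qed

lemma borel_measurable_nn_integral_count_space:
  fixes F :: "'i::countable \<Rightarrow> 'a \<Rightarrow> ennreal"
  assumes "\<And>k. F k \<in> borel_measurable M"
  shows "(\<lambda>x. \<integral>\<^sup>+k. F k x \<partial>count_space UNIV) \<in> borel_measurable M"
proof -
  interpret sigma_finite_measure "count_space (UNIV :: 'i set)"
    by (rule sigma_finite_measure_count_space)
  show ?thesis
  proof (rule borel_measurable_nn_integral)
    have "(\<lambda>(k, x). F k x) \<in> borel_measurable (count_space UNIV \<Otimes>\<^sub>M M)"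
      by (rule measurable_pair_measure_countable1) (use assms in auto)
    from measurable_compose[OF measurable_pair_swap' this]
    show "(\<lambda>(x, k). F k x) \<in> borel_measurable (M \<Otimes>\<^sub>M count_space UNIV)"
      by (simp add: split_beta' case_prod_unfold)
  qed
qed

text \<open>To be instantiated with the dilates \<open>|det b| \<psi> (b x)\<close> and
  \<open>|det b| cnj (\<phi> (b x))\<close>: the conjugation of the pairing and the factors
  \<open>|det b|\<close> are absorbed, leaving plain products and sums over the integer
  lattice.\<close>

locale quasi_interpolation =
  fixes p K :: real and \<psi> \<phi> :: "real^'n \<Rightarrow> complex"
  assumes p: "0 < p" "p \<le> 1" and K: "0 \<le> K"
    and psi_meas: "\<psi> \<in> borel_measurable lebesgue"
    and psi_fin: "(\<integral>\<^sup>+x. ennreal (cmod (\<psi> x) powr p) \<partial>lebesgue) < \<infinity>"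
    and phi_meas: "\<phi> \<in> borel_measurable lebesgue"
    and phi_sum: "AE x in lebesgue. (\<integral>\<^sup>+k. ennreal (cmod (\<phi> (x - lattice_vec k))) \<partial>count_space UNIV) \<le> ennreal K"
    and phi_int: "(\<integral>x. \<phi> x \<partial>lebesgue) = 1"
begin

text \<open>The kernel \<open>|det M| \<phi> (M x - k)\<close> has integral 1, so this is an average
  of \<open>h\<close> around \<open>matrix_inv M *v k\<close>. The determinant also accounts for the
  normalisation of the wavelets once the inverse stretch is applied.\<close>

definition coef :: "real^'n^'n \<Rightarrow> (real^'n \<Rightarrow> complex) \<Rightarrow> int^'n \<Rightarrow> complex" where
  "coef M h k = of_real \<bar>det M\<bar> * (\<integral>x. h x * \<phi> (M *v x - lattice_vec k) \<partial>lebesgue)"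

text \<open>With \<open>h = \<Theta> f\<close> this is synthesis after analysis, in the rescaled
  variables.\<close>

definition interpolant :: "real^'n^'n \<Rightarrow> (real^'n \<Rightarrow> complex) \<Rightarrow> real^'n \<Rightarrow> complex" where
  "interpolant M h x = (\<integral>k. radial_stretch (1 / p) (coef M h k) * \<psi> (M *v x - lattice_vec k) \<partial>count_space UNIV)"

definition per :: "real^'n \<Rightarrow> complex" where
  "per x = (\<integral>k. \<psi> (x - lattice_vec k) \<partial>count_space UNIV)"

text \<open>The \<open>p\<close>-th power of the norm rather than the norm, since only the former
  obeys the triangle inequality for p < 1.\<close>

definition Np :: "(real^'n \<Rightarrow> complex) \<Rightarrow> ennreal" where
  "Np u = (\<integral>\<^sup>+x. ennreal (cmod (u x) powr p) \<partial>lebesgue)"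

definition N1 :: "(real^'n \<Rightarrow> complex) \<Rightarrow> ennreal" where
  "N1 u = (\<integral>\<^sup>+x. ennreal (cmod (u x)) \<partial>lebesgue)"

lemma measurable_affine_lattice:
  assumes "det M \<noteq> 0" "f \<in> borel_measurable lebesgue"
  shows "(\<lambda>x. f (M *v x - lattice_vec k)) \<in> borel_measurable lebesgue"
  using measurable_compose[OF measurable_lebesgue_affine[OF assms(1), of "- lattice_vec k"] assms(2)] by simp

lemma phi_sum_affine:
  assumes "det M \<noteq> 0"
  shows "AE x in lebesgue. (\<integral>\<^sup>+k. ennreal (cmod (\<phi> (M *v x - lattice_vec k))) \<partial>count_space UNIV) \<le> ennreal K"
  using AE_lebesgue_affine[OF assms phi_sum, of 0] by simp

lemma phi_bounded_affine:
  assumes "det M \<noteq> 0"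
  shows "AE x in lebesgue. cmod (\<phi> (M *v x - lattice_vec k)) \<le> K"
  using phi_sum_affine[OF assms]
proof eventually_elim
  case (elim x)
  have "ennreal (cmod (\<phi> (M *v x - lattice_vec k))) \<le> (\<integral>\<^sup>+k. ennreal (cmod (\<phi> (M *v x - lattice_vec k))) \<partial>count_space UNIV)"
    by (rule nn_integral_ge_point) simp
  with elim have "ennreal (cmod (\<phi> (M *v x - lattice_vec k))) \<le> ennreal K" by (rule order_trans[rotated])
  then show ?case using K by simp
qed

text \<open>The Bochner integral of a non-integrable function is 0, so the value 1 forces
  integrability.\<close>

lemma phi_integrable: "integrable lebesgue \<phi>"
  using phi_int by (metis not_integrable_integral_eq zero_neq_one)

lemma N1_phi: "N1 \<phi> < \<infinity>"
  using phi_integrable by (simp add: N1_def integrable_iff_bounded)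

lemma coef_integrable:
  assumes "det M \<noteq> 0" "integrable lebesgue h"
  shows "integrable lebesgue (\<lambda>x. h x * \<phi> (M *v x - lattice_vec k))"
proof (rule Bochner_Integration.integrable_bound)
  show "integrable lebesgue (\<lambda>x. K *\<^sub>R h x)" using assms by simp
  show "(\<lambda>x. h x * \<phi> (M *v x - lattice_vec k)) \<in> borel_measurable lebesgue"
    using assms by (intro borel_measurable_times measurable_affine_lattice phi_meas) auto
  show "AE x in lebesgue. norm (h x * \<phi> (M *v x - lattice_vec k)) \<le> norm (K *\<^sub>R h x)"
    using phi_bounded_affine[OF assms(1), of k]
  proof eventually_elim
    case (elim x)
    from mult_left_mono[OF this norm_ge_zero[of "h x"]] show ?case using K by (simp add: norm_mult mult.commute)
  qed
qed

lemma coef_diff: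
  assumes "det M \<noteq> 0" "integrable lebesgue h" "integrable lebesgue g"
  shows "coef M h k - coef M g k = coef M (\<lambda>x. h x - g x) k"
  using coef_integrable[OF assms(1,2)] coef_integrable[OF assms(1,3)]
  by (simp add: coef_def left_diff_distrib right_diff_distrib)

text \<open>After the exchange of sum and integral, \<open>|h x|\<close> is multiplied by the
  lattice sum of \<open>|\<phi>|\<close> at \<open>M x\<close>, which is at most \<open>K\<close>
  almost everywhere.\<close>

lemma coef_sum_le:
  assumes d: "det M \<noteq> 0" and h: "integrable lebesgue h"
  shows "(\<integral>\<^sup>+k. ennreal (cmod (coef M h k)) \<partial>count_space UNIV) \<le> ennreal \<bar>det M\<bar> * (ennreal K * N1 h)"
proof -
  have hm: "h \<in> borel_measurable lebesgue" using h by auto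
  have pm: "(\<lambda>x. ennreal (cmod (\<phi> (M *v x - lattice_vec k)))) \<in> borel_measurable lebesgue" for k
    using measurable_affine_lattice[OF d phi_meas] by simp
  have "ennreal (cmod (coef M h k)) \<le> ennreal \<bar>det M\<bar> * (\<integral>\<^sup>+x. ennreal (cmod (h x)) * ennreal (cmod (\<phi> (M *v x - lattice_vec k))) \<partial>lebesgue)" for k
    unfolding coef_def norm_mult norm_of_real abs_abs
    using integral_norm_bound_ennreal[OF coef_integrable[OF d h, of k]]
    by (simp add: ennreal_mult norm_mult mult_left_mono)
  then have "(\<integral>\<^sup>+k. ennreal (cmod (coef M h k)) \<partial>count_space UNIV)
     \<le> (\<integral>\<^sup>+k. ennreal \<bar>det M\<bar> * (\<integral>\<^sup>+x. ennreal (cmod (h x)) * ennreal (cmod (\<phi> (M *v x - lattice_vec k))) \<partial>lebesgue) \<partial>count_space UNIV)"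
    by (intro nn_integral_mono) 
  also have "\<dots> = ennreal \<bar>det M\<bar> * (\<integral>\<^sup>+k. (\<integral>\<^sup>+x. ennreal (cmod (h x)) * ennreal (cmod (\<phi> (M *v x - lattice_vec k))) \<partial>lebesgue) \<partial>count_space UNIV)"
    by (simp add: nn_integral_cmult)
  also have "(\<integral>\<^sup>+k. (\<integral>\<^sup>+x. ennreal (cmod (h x)) * ennreal (cmod (\<phi> (M *v x - lattice_vec k))) \<partial>lebesgue) \<partial>count_space UNIV)
     = (\<integral>\<^sup>+x. (\<integral>\<^sup>+k. ennreal (cmod (h x)) * ennreal (cmod (\<phi> (M *v x - lattice_vec k))) \<partial>count_space UNIV) \<partial>lebesgue)"
    using hm pm by (intro nn_integral_count_space_nn_integral[symmetric]) auto
  also have "\<dots> \<le> (\<integral>\<^sup>+x. ennreal K * ennreal (cmod (h x)) \<partial>lebesgue)"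
  proof (rule nn_integral_mono_AE, use phi_sum_affine[OF d] in eventually_elim)
    case (elim x)
    then show ?case by (simp add: nn_integral_cmult mult.commute[of "ennreal K"] mult_left_mono)
  qed
  also have "\<dots> = ennreal K * N1 h" using hm unfolding N1_def by (intro nn_integral_cmult) auto
  finally show ?thesis by (simp add: mult_left_mono)
qed

text \<open>Substituting \<open>y = M x - k\<close> in each term moves the dependence on
  \<open>k\<close> from \<psi> to the weight. Weights may vary with \<open>x\<close>, because
  coefficients will be compared with \<open>h x\<close> itself.\<close>

lemma frame_sum_eq:
  assumes d: "det M \<noteq> 0" and W: "\<And>k. W k \<in> borel_measurable lebesgue"
  shows "ennreal \<bar>det M\<bar> * (\<integral>\<^sup>+x. (\<integral>\<^sup>+k. W k x * ennreal (cmod (\<psi> (M *v x - lattice_vec k)) powr p) \<partial>count_space UNIV) \<partial>lebesgue)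
    = (\<integral>\<^sup>+y. (\<integral>\<^sup>+k. W k (matrix_inv M *v (y + lattice_vec k)) \<partial>count_space UNIV) * ennreal (cmod (\<psi> y) powr p) \<partial>lebesgue)"
proof -
  have d': "det (matrix_inv M) \<noteq> 0" using d by (simp add: det_matrix_inv)
  have pm: "(\<lambda>x. ennreal (cmod (\<psi> x) powr p)) \<in> borel_measurable lebesgue" using psi_meas by simp
  have pm': "(\<lambda>x. ennreal (cmod (\<psi> (M *v x - lattice_vec k)) powr p)) \<in> borel_measurable lebesgue" for k
    using measurable_affine_lattice[OF d psi_meas] by simp
  have Wm: "(\<lambda>y. W k (matrix_inv M *v (y + lattice_vec k))) \<in> borel_measurable lebesgue" for k
    using measurable_compose[OF measurable_lebesgue_affine[OF d', of "matrix_inv M *v lattice_vec k"] W[of k]]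
    by (simp add: matrix_vector_right_distrib)
  have "ennreal \<bar>det M\<bar> * (\<integral>\<^sup>+x. W k x * ennreal (cmod (\<psi> (M *v x - lattice_vec k)) powr p) \<partial>lebesgue)
    = (\<integral>\<^sup>+y. W k (matrix_inv M *v (y + lattice_vec k)) * ennreal (cmod (\<psi> y) powr p) \<partial>lebesgue)" for k
    using nn_integral_lebesgue_affine[OF d borel_measurable_times_ennreal[OF Wm[of k] pm], of "- lattice_vec k"]
    by (simp add: det_matrix_inv d)
  then have "(\<integral>\<^sup>+k. ennreal \<bar>det M\<bar> * (\<integral>\<^sup>+x. W k x * ennreal (cmod (\<psi> (M *v x - lattice_vec k)) powr p) \<partial>lebesgue) \<partial>count_space UNIV)
    = (\<integral>\<^sup>+k. (\<integral>\<^sup>+y. W k (matrix_inv M *v (y + lattice_vec k)) * ennreal (cmod (\<psi> y) powr p) \<partial>lebesgue) \<partial>count_space UNIV)"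
    by simp
  moreover have "(\<integral>\<^sup>+k. (\<integral>\<^sup>+x. W k x * ennreal (cmod (\<psi> (M *v x - lattice_vec k)) powr p) \<partial>lebesgue) \<partial>count_space UNIV)
     = (\<integral>\<^sup>+x. (\<integral>\<^sup>+k. W k x * ennreal (cmod (\<psi> (M *v x - lattice_vec k)) powr p) \<partial>count_space UNIV) \<partial>lebesgue)"
    using W pm' by (intro nn_integral_count_space_nn_integral[symmetric] borel_measurable_times_ennreal) auto
  moreover have "(\<integral>\<^sup>+k. (\<integral>\<^sup>+y. W k (matrix_inv M *v (y + lattice_vec k)) * ennreal (cmod (\<psi> y) powr p) \<partial>lebesgue) \<partial>count_space UNIV)
     = (\<integral>\<^sup>+y. (\<integral>\<^sup>+k. W k (matrix_inv M *v (y + lattice_vec k)) * ennreal (cmod (\<psi> y) powr p) \<partial>count_space UNIV) \<partial>lebesgue)"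
    using Wm pm by (intro nn_integral_count_space_nn_integral[symmetric] borel_measurable_times_ennreal) auto
  ultimately show ?thesis by (simp add: nn_integral_cmult nn_integral_multc)
qed

lemma frame_sum_const:
  assumes d: "det M \<noteq> 0"
  shows "ennreal \<bar>det M\<bar> * (\<integral>\<^sup>+x. (\<integral>\<^sup>+k. ennreal (cmod (s k * \<psi> (M *v x - lattice_vec k)) powr p) \<partial>count_space UNIV) \<partial>lebesgue)
    = (\<integral>\<^sup>+k. ennreal (cmod (s k) powr p) \<partial>count_space UNIV) * Np \<psi>"
  using frame_sum_eq[OF d, of "\<lambda>k _. ennreal (cmod (s k) powr p)"] psi_meas
  by (simp add: norm_mult powr_mult ennreal_mult nn_integral_cmult Np_def)

lemma frame_integrable:
  assumes d: "det M \<noteq> 0" and sm: "\<And>k. s k \<in> borel_measurable lebesgue"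
    and fin: "(\<integral>\<^sup>+x. (\<integral>\<^sup>+k. ennreal (cmod (s k x * \<psi> (M *v x - lattice_vec k)) powr p) \<partial>count_space UNIV) \<partial>lebesgue) < \<infinity>"
  shows "AE x in lebesgue. integrable (count_space UNIV) (\<lambda>k. s k x * \<psi> (M *v x - lattice_vec k))"
proof -
  let ?f = "\<lambda>k x. ennreal (cmod (s k x * \<psi> (M *v x - lattice_vec k)) powr p)"
  have "?f k \<in> borel_measurable lebesgue" for k
    using sm measurable_affine_lattice[OF d psi_meas, of k] by simp
  then have "(\<lambda>x. \<integral>\<^sup>+k. ?f k x \<partial>count_space UNIV) \<in> borel_measurable lebesgue"
    by (intro borel_measurable_nn_integral_count_space) auto
  then have "AE x in lebesgue. (\<integral>\<^sup>+k. ?f k x \<partial>count_space UNIV) \<noteq> \<infinity>"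
    using fin by (intro nn_integral_PInf_AE) auto
  then show ?thesis
    by eventually_elim (rule integrable_count_space_of_powr[OF p], simp add: less_top)
qed

lemma interpolant_meas:
  assumes d: "det M \<noteq> 0"
  shows "interpolant M h \<in> borel_measurable lebesgue"
  unfolding interpolant_def[abs_def] using measurable_affine_lattice[OF d psi_meas]
  by (intro borel_measurable_integral_count_space) auto

lemma per_meas: "per \<in> borel_measurable lebesgue"
  unfolding per_def[abs_def] using measurable_affine_lattice[of "mat 1", OF _ psi_meas]
  by (intro borel_measurable_integral_count_space) auto

lemma Np_triangle:
  assumes "u \<in> borel_measurable lebesgue" "v \<in> borel_measurable lebesgue"
  shows "Np (\<lambda>x. u x + v x) \<le> Np u + Np v"
proof -
  have "Np (\<lambda>x. u x + v x) \<le> (\<integral>\<^sup>+x. ennreal (cmod (u x) powr p) + ennreal (cmod (v x) powr p) \<partial>lebesgue)"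
    unfolding Np_def using cmod_powr_triangle[OF p] by (intro nn_integral_mono) (simp flip: ennreal_plus)
  also have "\<dots> = Np u + Np v" unfolding Np_def using assms by (intro nn_integral_add) auto
  finally show ?thesis .
qed

text \<open>The \<open>p\<close>-th power undoes the inverse stretch, so the sum is the linear one
  of \<open>coef_sum_le\<close>; the two factors \<open>|det M|\<close> cancel.\<close>

lemma stretch_coef_sum_finite:
  assumes d: "det M \<noteq> 0" and h: "integrable lebesgue h"
  shows "(\<integral>\<^sup>+x. (\<integral>\<^sup>+k. ennreal (cmod (radial_stretch (1 / p) (coef M h k) * \<psi> (M *v x - lattice_vec k)) powr p) \<partial>count_space UNIV) \<partial>lebesgue)
     \<le> ennreal K * N1 h * Np \<psi>" (is "?I \<le> _")
proof -
  have "ennreal \<bar>det M\<bar> * ?I = (\<integral>\<^sup>+k. ennreal (cmod (coef M h k)) \<partial>count_space UNIV) * Np \<psi>"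
    using p frame_sum_const[OF d, of "\<lambda>k. radial_stretch (1 / p) (coef M h k)"]
    by (simp add: cmod_radial_stretch powr_powr)
  also have "\<dots> \<le> ennreal \<bar>det M\<bar> * (ennreal K * N1 h) * Np \<psi>"
    by (intro mult_right_mono coef_sum_le d h) auto
  finally show ?thesis
    using d by (simp add: mult.assoc ennreal_mult_le_mult_iff)
qed

lemma N1_finite: "integrable lebesgue h \<Longrightarrow> N1 h < \<infinity>"
  by (simp add: N1_def integrable_iff_bounded)

lemma Np_psi: "Np \<psi> < \<infinity>"
  using psi_fin by (simp add: Np_def)

lemma interpolant_terms_integrable:
  assumes d: "det M \<noteq> 0" and h: "integrable lebesgue h"
  shows "AE x in lebesgue. integrable (count_space UNIV) (\<lambda>k. radial_stretch (1 / p) (coef M h k) * \<psi> (M *v x - lattice_vec k))"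
proof (rule frame_integrable[OF d])
  show "(\<integral>\<^sup>+x. (\<integral>\<^sup>+k. ennreal (cmod (radial_stretch (1 / p) (coef M h k) * \<psi> (M *v x - lattice_vec k)) powr p) \<partial>count_space UNIV) \<partial>lebesgue) < \<infinity>"
    using N1_finite[OF h] Np_psi
    by (intro le_less_trans[OF stretch_coef_sum_finite[OF d h]]) (simp add: ennreal_mult_less_top)
qed simp

lemma Np_interpolant:
  assumes d: "det M \<noteq> 0" and h: "integrable lebesgue h"
  shows "Np (interpolant M h) \<le> ennreal K * N1 h * Np \<psi>"
  unfolding Np_def[of "interpolant M h"] interpolant_def
  by (rule order_trans[OF nn_integral_mono stretch_coef_sum_finite[OF d h]]) (rule integral_count_space_powr_le'[OF p])

text \<open>This is the equicontinuity: the determinant from the coefficient sums cancels the one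
  from the frame sum, so the bound is the same for all \<open>M\<close>.\<close>

lemma Np_interpolant_diff:
  assumes d: "det M \<noteq> 0" and h: "integrable lebesgue h" and g: "integrable lebesgue g"
    and C: "0 \<le> \<epsilon>" "0 \<le> C" "\<And>z w. cmod (radial_stretch (1 / p) z - radial_stretch (1 / p) w) powr p
        \<le> \<epsilon> * (cmod z + cmod w) + C * cmod (z - w)"
  shows "Np (\<lambda>x. interpolant M h x - interpolant M g x) \<le> ennreal K * (ennreal \<epsilon> * (N1 h + N1 g) + ennreal C * N1 (\<lambda>x. h x - g x)) * Np \<psi>"
proof -
  let ?s = "\<lambda>k. radial_stretch (1 / p) (coef M h k) - radial_stretch (1 / p) (coef M g k)"
  let ?I = "\<integral>\<^sup>+x. (\<integral>\<^sup>+k. ennreal (cmod (?s k * \<psi> (M *v x - lattice_vec k)) powr p) \<partial>count_space UNIV) \<partial>lebesgue"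
  let ?S = "\<lambda>h. \<integral>\<^sup>+k. ennreal (cmod (coef M h k)) \<partial>count_space UNIV"
  have "Np (\<lambda>x. interpolant M h x - interpolant M g x) \<le> ?I"
    unfolding Np_def
  \<comment> \<open>The two series may be subtracted termwise only where both converge absolutely,
    which is almost everywhere.\<close>
  proof (rule nn_integral_mono_AE, use interpolant_terms_integrable[OF d h] interpolant_terms_integrable[OF d g] in eventually_elim)
    case (elim x)
    then have "interpolant M h x - interpolant M g x = (\<integral>k. ?s k * \<psi> (M *v x - lattice_vec k) \<partial>count_space UNIV)"
      by (simp add: interpolant_def left_diff_distrib)
    then show ?case by (simp add: integral_count_space_powr_le'[OF p])
  qed
  then have "ennreal \<bar>det M\<bar> * Np (\<lambda>x. interpolant M h x - interpolant M g x) \<le> ennreal \<bar>det M\<bar> * ?I"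
    by (intro mult_left_mono) auto
  also have "\<dots> = (\<integral>\<^sup>+k. ennreal (cmod (?s k) powr p) \<partial>count_space UNIV) * Np \<psi>"
    by (rule frame_sum_const[OF d])
  also have "\<dots> \<le> (\<integral>\<^sup>+k. ennreal \<epsilon> * (ennreal (cmod (coef M h k)) + ennreal (cmod (coef M g k)))
       + ennreal C * ennreal (cmod (coef M (\<lambda>x. h x - g x) k)) \<partial>count_space UNIV) * Np \<psi>"
    using C by (intro mult_right_mono nn_integral_mono)
      (simp_all add: coef_diff[OF d h g, symmetric] flip: ennreal_plus ennreal_mult)
  also have "\<dots> = (ennreal \<epsilon> * (?S h + ?S g) + ennreal C * ?S (\<lambda>x. h x - g x)) * Np \<psi>"
    by (simp add: nn_integral_add nn_integral_cmult)
  also have "\<dots> \<le> (ennreal \<epsilon> * (ennreal \<bar>det M\<bar> * (ennreal K * N1 h) + ennreal \<bar>det M\<bar> * (ennreal K * N1 g))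
       + ennreal C * (ennreal \<bar>det M\<bar> * (ennreal K * N1 (\<lambda>x. h x - g x)))) * Np \<psi>"
    using h g by (intro mult_right_mono add_mono mult_left_mono coef_sum_le d) auto
  also have "\<dots> = ennreal \<bar>det M\<bar> * (ennreal K * (ennreal \<epsilon> * (N1 h + N1 g) + ennreal C * N1 (\<lambda>x. h x - g x)) * Np \<psi>)"
    by (simp add: algebra_simps)
  finally show ?thesis
    using d by (simp add: ennreal_mult_le_mult_iff)
qed

end

section \<open>Compactly supported functions and weighted oscillation\<close>

lemma compactly_supported_bounded:
  fixes h :: "'a::euclidean_space \<Rightarrow> complex"
  assumes h: "continuous_on UNIV h" "\<And>x. R < norm x \<Longrightarrow> h x = 0"
  obtains H where "0 \<le> H" "\<And>x. cmod (h x) \<le> H"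
proof -
  have "compact (h ` cball 0 R)"
    by (intro compact_continuous_image continuous_on_subset[OF h(1)]) auto
  then obtain B where B: "\<And>z. z \<in> h ` cball 0 R \<Longrightarrow> cmod z \<le> B"
    using compact_imp_bounded bounded_iff by meson
  have "cmod (h x) \<le> max 0 B" for x
  proof (cases "norm x \<le> R")
    case True
    then show ?thesis using B[of "h x"] by auto
  qed (use h(2) in auto)
  then show thesis using that[of "max 0 B"] by simp
qed

lemma continuous_imp_lebesgue_measurable:
  "continuous_on UNIV h \<Longrightarrow> h \<in> borel_measurable lebesgue"
  by (intro measurable_completion) (simp add: borel_measurable_continuous_onI)

lemma compactly_supported_integrable:
  fixes h :: "'a::euclidean_space \<Rightarrow> complex"
  assumes h: "continuous_on UNIV h" "\<And>x. R < norm x \<Longrightarrow> h x = 0"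
  shows "integrable lebesgue h"
proof -
  obtain H where H: "0 \<le> H" "\<And>x. cmod (h x) \<le> H" using compactly_supported_bounded[OF h] by blast
  show ?thesis
  proof (rule Bochner_Integration.integrable_bound)
    show "integrable lebesgue (\<lambda>x::'a. H * indicator (cball 0 R) x)"
      using emeasure_cball_finite[of "0::'a" R]
      by (intro integrable_mult_right integrable_real_indicator) auto
    show "AE x in lebesgue. norm (h x) \<le> norm (H * indicator (cball 0 R) x)"
      using H h(2) by (auto simp: indicator_def)
  qed (rule continuous_imp_lebesgue_measurable[OF h(1)])
qed

lemma measurable_lattice_sample:
  fixes M :: "real^'n^'n"
  assumes d: "det M \<noteq> 0" and h: "h \<in> borel_measurable lebesgue"
  shows "(\<lambda>y. h (matrix_inv M *v (y + lattice_vec k))) \<in> borel_measurable lebesgue"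
proof -
  have d': "det (matrix_inv M) \<noteq> 0" using d by (simp add: det_matrix_inv)
  show ?thesis
    using measurable_compose[OF measurable_lebesgue_affine[OF d', of "matrix_inv M *v lattice_vec k"] h]
    by (simp add: matrix_vector_right_distrib)
qed

lemma lattice_osc_measurable:
  fixes M :: "real^'n^'n"
  assumes d: "det M \<noteq> 0" and h: "h \<in> borel_measurable lebesgue"
  shows "lattice_osc M h \<in> borel_measurable lebesgue"
proof -
  have "(\<lambda>z. ennreal (cmod (h (matrix_inv M *v (z + lattice_vec k)) - h (matrix_inv M *v lattice_vec k)))) \<in> borel_measurable lebesgue" for k
    using measurable_lattice_sample[OF d h, of k] by simp
  from borel_measurable_nn_integral_count_space[OF this]
  show ?thesis unfolding lattice_osc_def[abs_def] by (intro borel_measurable_times_ennreal) auto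
qed

lemma lattice_osc_weighted_tendsto_0:
  fixes M :: "nat \<Rightarrow> real^'n^'n"
  assumes M: "\<And>j. expanding (M j)" and lim: "(\<lambda>j. onorm ((*v) (matrix_inv (M j)))) \<longlonglongrightarrow> 0"
    and h: "continuous_on UNIV h" and supp: "\<And>x. R < norm x \<Longrightarrow> h x = 0"
    and w: "w \<in> borel_measurable lebesgue" and fin: "(\<integral>\<^sup>+x. w x \<partial>lebesgue) < \<infinity>"
  shows "(\<lambda>j. \<integral>\<^sup>+x. lattice_osc (M j) h x * w x \<partial>lebesgue) \<longlonglongrightarrow> 0"
proof -
  obtain H where H: "0 \<le> H" "\<And>x. cmod (h x) \<le> H" using compactly_supported_bounded[OF h supp] by blast
  let ?B = "ennreal (4 * H) * emeasure lebesgue (cball 0 (R + 1) :: (real^'n) set)"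
  have B: "?B < \<infinity>" using emeasure_cball_finite[of "0::real^'n" "R + 1"] by (simp add: ennreal_mult_less_top)
  have d: "det (M j) \<noteq> 0" for j using M[of j] by (simp add: expanding_def)
  \<comment> \<open>Pointwise convergence of the product needs a finite weight: multiplication by
    \<open>top\<close> is not continuous at 0.\<close>
  have wfin: "AE x in lebesgue. w x \<noteq> \<infinity>" using fin w by (intro nn_integral_PInf_AE) auto
  have "(\<lambda>j. \<integral>\<^sup>+x. lattice_osc (M j) h x * w x \<partial>lebesgue) \<longlonglongrightarrow> (\<integral>\<^sup>+x. 0 \<partial>(lebesgue :: (real^'n) measure))"
  proof (rule nn_integral_dominated_convergence[where w="\<lambda>x. ?B * w x"])
    show "(\<lambda>x. lattice_osc (M j) h x * w x) \<in> borel_measurable lebesgue" for j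
      using lattice_osc_measurable[OF d continuous_imp_lebesgue_measurable[OF h]] w by (rule borel_measurable_times_ennreal)
    show "(\<lambda>x. ?B * w x) \<in> borel_measurable lebesgue" using w by (intro borel_measurable_times_ennreal) auto
    show "AE x in lebesgue. lattice_osc (M j) h x * w x \<le> ?B * w x" for j
      using lattice_osc_bound[OF M supp H(2)] by (intro AE_I2 mult_right_mono) auto
    show "(\<integral>\<^sup>+x. ?B * w x \<partial>lebesgue) < \<infinity>"
      using B fin w by (subst nn_integral_cmult) (auto simp: ennreal_mult_less_top)
    show "AE x in lebesgue. (\<lambda>j. lattice_osc (M j) h x * w x) \<longlonglongrightarrow> 0"
      using wfin
    proof eventually_elim
      case (elim x)
      then have "w x < top" by (simp add: less_top)
      from ennreal_tendsto_cmult[OF this lattice_osc_tendsto_0[of M h R x, OF M lim h supp]]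
      show ?case by (simp add: mult.commute)
    qed
  qed simp
  then show ?thesis by simp
qed

section \<open>Replacing coefficients by point values\<close>

context quasi_interpolation
begin

text \<open>As \<phi> has integral 1, coefficient minus sample is the integral of
  \<open>u k w - u k y\<close> against \<phi>. Passing through \<open>u k 0\<close> splits this into
  two differences whose sums over \<open>k\<close> are lattice oscillations.\<close>

lemma coef_deviation:
  assumes d: "det M \<noteq> 0" and h: "continuous_on UNIV h" and supp: "\<And>x. R < norm x \<Longrightarrow> h x = 0"
  shows "(\<integral>\<^sup>+k. ennreal (cmod (coef M h k - h (matrix_inv M *v (y + lattice_vec k)))) \<partial>count_space UNIV)
    \<le> ennreal \<bar>det M\<bar> * ((\<integral>\<^sup>+w. lattice_osc M h w * ennreal (cmod (\<phi> w)) \<partial>lebesgue) + lattice_osc M h y * N1 \<phi>)"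
proof -
  \<comment> \<open>The function \<open>h\<close> in the variable \<open>w = M x - k\<close>, in
    which every coefficient uses the same \<phi>.\<close>
  define u where "u k w = h (matrix_inv M *v (w + lattice_vec k))" for k w
  obtain H where H: "0 \<le> H" "\<And>x. cmod (h x) \<le> H" using compactly_supported_bounded[OF h supp] by blast
  have hm: "h \<in> borel_measurable lebesgue" by (rule continuous_imp_lebesgue_measurable[OF h])
  have um: "u k \<in> borel_measurable lebesgue" for k
    unfolding u_def[abs_def] by (rule measurable_lattice_sample[OF d hm])
  have ui: "integrable lebesgue (\<lambda>w. u k w * \<phi> w)" for k
  proof (rule Bochner_Integration.integrable_bound)
    show "integrable lebesgue (\<lambda>w. H *\<^sub>R \<phi> w)" using phi_integrable by simp
    show "AE w in lebesgue. norm (u k w * \<phi> w) \<le> norm (H *\<^sub>R \<phi> w)"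
      using H by (auto simp: u_def norm_mult intro!: mult_right_mono)
  qed (use um phi_meas in auto)
  have coef_eq: "coef M h k = (\<integral>w. u k w * \<phi> w \<partial>lebesgue)" for k
  proof -
    have "(\<lambda>w. u k w * \<phi> w) \<in> borel_measurable lebesgue" using um phi_meas by auto
    from integral_lebesgue_affine[OF d this, of "- lattice_vec k"]
    show ?thesis by (simp add: coef_def u_def det_matrix_inv d)
  qed
  define v where "v k y w = (ennreal (cmod (u k w - u k 0)) + ennreal (cmod (u k y - u k 0))) * ennreal (cmod (\<phi> w))" for k y w
  have vm: "v k y \<in> borel_measurable lebesgue" for k
    unfolding v_def[abs_def] using um phi_meas by (intro borel_measurable_times_ennreal) auto
  have "ennreal (cmod (coef M h k - u k y)) \<le> (\<integral>\<^sup>+w. v k y w \<partial>lebesgue)" for k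
  proof -
    have "coef M h k - u k y = (\<integral>w. u k w * \<phi> w \<partial>lebesgue) - (\<integral>w. u k y * \<phi> w \<partial>lebesgue)"
      using phi_int by (simp add: coef_eq)
    also have "\<dots> = (\<integral>w. u k w * \<phi> w - u k y * \<phi> w \<partial>lebesgue)"
      using ui phi_integrable by (intro Bochner_Integration.integral_diff[symmetric]) auto
    finally have eq: "coef M h k - u k y = (\<integral>w. u k w * \<phi> w - u k y * \<phi> w \<partial>lebesgue)" .
    have "integrable lebesgue (\<lambda>w. u k w * \<phi> w - u k y * \<phi> w)"
      using ui phi_integrable by (intro Bochner_Integration.integrable_diff) auto
    from integral_norm_bound_ennreal[OF this]
    have "ennreal (cmod (coef M h k - u k y)) \<le> (\<integral>\<^sup>+w. ennreal (cmod (u k w * \<phi> w - u k y * \<phi> w)) \<partial>lebesgue)"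
      unfolding eq .
    also have "\<dots> \<le> (\<integral>\<^sup>+w. v k y w \<partial>lebesgue)"
    proof (rule nn_integral_mono)
      fix w
      have "cmod (u k w * \<phi> w - u k y * \<phi> w) = cmod ((u k w - u k 0) - (u k y - u k 0)) * cmod (\<phi> w)"
        by (simp add: left_diff_distrib[symmetric] norm_mult)
      also have "\<dots> \<le> (cmod (u k w - u k 0) + cmod (u k y - u k 0)) * cmod (\<phi> w)"
        by (intro mult_right_mono norm_triangle_ineq4) auto
      finally show "ennreal (cmod (u k w * \<phi> w - u k y * \<phi> w)) \<le> v k y w"
        unfolding v_def by (simp flip: ennreal_plus ennreal_mult)
    qed
    finally show ?thesis .
  qed
  then have "(\<integral>\<^sup>+k. ennreal (cmod (coef M h k - u k y)) \<partial>count_space UNIV) \<le> (\<integral>\<^sup>+k. (\<integral>\<^sup>+w. v k y w \<partial>lebesgue) \<partial>count_space UNIV)"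
    by (intro nn_integral_mono)
  also have "\<dots> = (\<integral>\<^sup>+w. (\<integral>\<^sup>+k. v k y w \<partial>count_space UNIV) \<partial>lebesgue)"
    using vm by (intro nn_integral_count_space_nn_integral[symmetric]) auto
  also have "\<dots> = (\<integral>\<^sup>+w. ennreal \<bar>det M\<bar> * ((lattice_osc M h w + lattice_osc M h y) * ennreal (cmod (\<phi> w))) \<partial>lebesgue)"
  proof (rule nn_integral_cong)
    fix w
    have *: "(\<integral>\<^sup>+k. ennreal (cmod (u k w - u k 0)) \<partial>count_space UNIV) = ennreal \<bar>det M\<bar> * lattice_osc M h w" for w
      using d by (simp add: lattice_osc_def u_def mult.assoc[symmetric] flip: ennreal_mult)
    show "(\<integral>\<^sup>+k. v k y w \<partial>count_space UNIV) = ennreal \<bar>det M\<bar> * ((lattice_osc M h w + lattice_osc M h y) * ennreal (cmod (\<phi> w)))"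
      unfolding v_def by (subst nn_integral_multc, simp, subst nn_integral_add) (simp_all add: * distrib_left distrib_right mult.assoc)
  qed
  also have "\<dots> = ennreal \<bar>det M\<bar> * ((\<integral>\<^sup>+w. lattice_osc M h w * ennreal (cmod (\<phi> w)) \<partial>lebesgue) + lattice_osc M h y * N1 \<phi>)"
    using lattice_osc_measurable[OF d hm] phi_meas
    by (simp add: distrib_right nn_integral_cmult nn_integral_add N1_def del: nn_integral_completion)
  finally show ?thesis by (simp add: u_def)
qed

text \<open>The product \<open>radial_stretch (1 / p) (h x) * per (M *v x)\<close> is the synthesis
  series whose coefficients all equal the inverse stretch of \<open>h x\<close>. In the variable
  \<open>y = M x - k\<close> the point \<open>x\<close> becomes
  \<open>matrix_inv M *v (y + lattice_vec k)\<close>, so for fixed \<open>y\<close> the coefficient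
  errors are those of \<open>coef_deviation\<close>.\<close>

lemma Np_interpolant_remainder:
  assumes M: "expanding M" and h: "continuous_on UNIV h" and supp: "\<And>x. R < norm x \<Longrightarrow> h x = 0"
    and C: "0 \<le> \<epsilon>" "0 \<le> C" "\<And>z w. cmod (radial_stretch (1 / p) z - radial_stretch (1 / p) w) powr p
        \<le> \<epsilon> * (cmod z + cmod w) + C * cmod (z - w)"
  shows "Np (\<lambda>x. interpolant M h x - radial_stretch (1 / p) (h x) * per (M *v x))
    \<le> ennreal \<epsilon> * (2 * ennreal K * N1 h * Np \<psi>)
      + ennreal (\<epsilon> + C) * ((\<integral>\<^sup>+w. lattice_osc M h w * ennreal (cmod (\<phi> w)) \<partial>lebesgue) * Np \<psi>
         + N1 \<phi> * (\<integral>\<^sup>+y. lattice_osc M h y * ennreal (cmod (\<psi> y) powr p) \<partial>lebesgue))" (is "_ \<le> ?rhs")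
proof -
  have d: "det M \<noteq> 0" using M by (simp add: expanding_def)
  have hm: "h \<in> borel_measurable lebesgue" by (rule continuous_imp_lebesgue_measurable[OF h])
  have hi: "integrable lebesgue h" by (rule compactly_supported_integrable[OF h supp])
  define s where "s k x = radial_stretch (1 / p) (coef M h k) - radial_stretch (1 / p) (h x)" for k x
  have Lm: "(\<lambda>x. radial_stretch (1 / p) (h x)) \<in> borel_measurable lebesgue"
    using p by (intro measurable_compose[OF hm borel_measurable_continuous_onI] continuous_on_radial_stretch) auto
  have sm: "s k \<in> borel_measurable lebesgue" for k
    unfolding s_def[abs_def] using Lm by simp
  let ?I = "\<integral>\<^sup>+x. (\<integral>\<^sup>+k. ennreal (cmod (s k x * \<psi> (M *v x - lattice_vec k)) powr p) \<partial>count_space UNIV) \<partial>lebesgue"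
  let ?A = "\<integral>\<^sup>+w. lattice_osc M h w * ennreal (cmod (\<phi> w)) \<partial>lebesgue"
  let ?B = "\<integral>\<^sup>+y. lattice_osc M h y * ennreal (cmod (\<psi> y) powr p) \<partial>lebesgue"
  let ?D = "\<lambda>y. \<integral>\<^sup>+k. ennreal (cmod (coef M h k - h (matrix_inv M *v (y + lattice_vec k)))) \<partial>count_space UNIV"
  have inner: "(\<integral>\<^sup>+k. ennreal (cmod (s k (matrix_inv M *v (y + lattice_vec k))) powr p) \<partial>count_space UNIV)
      \<le> ennreal \<bar>det M\<bar> * (ennreal \<epsilon> * (2 * ennreal K * N1 h) + ennreal (\<epsilon> + C) * (?A + lattice_osc M h y * N1 \<phi>))" for y
  proof -
    have "cmod (s k x) powr p \<le> \<epsilon> * (2 * cmod (coef M h k)) + (\<epsilon> + C) * cmod (coef M h k - h x)" for k x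
    proof -
      have "cmod (s k x) powr p \<le> \<epsilon> * (cmod (coef M h k) + cmod (h x)) + C * cmod (coef M h k - h x)"
        unfolding s_def by (rule C)
      \<comment> \<open>Since \<open>|h x|\<close> is at most the coefficient plus the deviation,
        the \<epsilon>-term is charged to the coefficients, whose sum is known, and to the
        deviation; hence the factor \<open>\<epsilon> + C\<close>.\<close>
      also have "\<dots> \<le> \<epsilon> * (2 * cmod (coef M h k) + cmod (coef M h k - h x)) + C * cmod (coef M h k - h x)"
        using norm_triangle_ineq3[of "coef M h k" "h x"] by (intro add_right_mono mult_left_mono[OF _ C(1)]) linarith
      finally show ?thesis by (simp add: algebra_simps)
    qed
    then have "(\<integral>\<^sup>+k. ennreal (cmod (s k (matrix_inv M *v (y + lattice_vec k))) powr p) \<partial>count_space UNIV)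
      \<le> (\<integral>\<^sup>+k. ennreal \<epsilon> * (2 * ennreal (cmod (coef M h k))) + ennreal (\<epsilon> + C) * ennreal (cmod (coef M h k - h (matrix_inv M *v (y + lattice_vec k)))) \<partial>count_space UNIV)"
      using C(1,2) by (intro nn_integral_mono) (simp add: ennreal_leI flip: ennreal_plus ennreal_mult ennreal_numeral)
    also have "\<dots> = ennreal \<epsilon> * (2 * (\<integral>\<^sup>+k. ennreal (cmod (coef M h k)) \<partial>count_space UNIV)) + ennreal (\<epsilon> + C) * ?D y"
      by (simp add: nn_integral_add nn_integral_cmult)
    also have "\<dots> \<le> ennreal \<epsilon> * (2 * (ennreal \<bar>det M\<bar> * (ennreal K * N1 h))) + ennreal (\<epsilon> + C) * (ennreal \<bar>det M\<bar> * (?A + lattice_osc M h y * N1 \<phi>))"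
      by (intro add_mono mult_left_mono coef_sum_le coef_deviation d hi h supp) auto
    also have "\<dots> = ennreal \<bar>det M\<bar> * (ennreal \<epsilon> * (2 * ennreal K * N1 h) + ennreal (\<epsilon> + C) * (?A + lattice_osc M h y * N1 \<phi>))"
      by (simp add: algebra_simps)
    finally show ?thesis .
  qed
  have om: "lattice_osc M h \<in> borel_measurable lebesgue" by (rule lattice_osc_measurable[OF d hm])
  have pm: "(\<lambda>y. ennreal (cmod (\<psi> y) powr p)) \<in> borel_measurable lebesgue" using psi_meas by simp
  have "ennreal \<bar>det M\<bar> * ?I = (\<integral>\<^sup>+y. (\<integral>\<^sup>+k. ennreal (cmod (s k (matrix_inv M *v (y + lattice_vec k))) powr p) \<partial>count_space UNIV) * ennreal (cmod (\<psi> y) powr p) \<partial>lebesgue)"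
    using frame_sum_eq[OF d, of "\<lambda>k x. ennreal (cmod (s k x) powr p)"] sm
    by (simp add: norm_mult powr_mult ennreal_mult del: nn_integral_completion)
  also have "\<dots> \<le> (\<integral>\<^sup>+y. ennreal \<bar>det M\<bar> * (ennreal \<epsilon> * (2 * ennreal K * N1 h) + ennreal (\<epsilon> + C) * (?A + lattice_osc M h y * N1 \<phi>)) * ennreal (cmod (\<psi> y) powr p) \<partial>lebesgue)"
    by (intro nn_integral_mono mult_right_mono inner) auto
  also have "\<dots> = (\<integral>\<^sup>+y. ennreal \<bar>det M\<bar> * ((ennreal \<epsilon> * (2 * ennreal K * N1 h) + ennreal (\<epsilon> + C) * ?A) * ennreal (cmod (\<psi> y) powr p)
      + ennreal (\<epsilon> + C) * N1 \<phi> * (lattice_osc M h y * ennreal (cmod (\<psi> y) powr p))) \<partial>lebesgue)"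
    by (intro nn_integral_cong) (simp add: algebra_simps)
  also have "\<dots> = ennreal \<bar>det M\<bar> * ((ennreal \<epsilon> * (2 * ennreal K * N1 h) + ennreal (\<epsilon> + C) * ?A) * Np \<psi> + ennreal (\<epsilon> + C) * N1 \<phi> * ?B)"
    unfolding Np_def using om pm by (simp add: nn_integral_cmult nn_integral_add del: nn_integral_completion)
  also have "(ennreal \<epsilon> * (2 * ennreal K * N1 h) + ennreal (\<epsilon> + C) * ?A) * Np \<psi> + ennreal (\<epsilon> + C) * N1 \<phi> * ?B = ?rhs"
    by (simp add: algebra_simps)
  finally have I: "?I \<le> ?rhs" using d by (simp add: ennreal_mult_le_mult_iff del: nn_integral_completion)
  show ?thesis
  proof (cases "?rhs < \<infinity>")
    case True
    \<comment> \<open>Finiteness of the bound gives convergence of the difference series; for an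
      infinite bound the claim is trivial.\<close>
    have "AE x in lebesgue. integrable (count_space UNIV) (\<lambda>k. s k x * \<psi> (M *v x - lattice_vec k))"
      using I True by (intro frame_integrable[OF d sm]) (rule le_less_trans)
    note terms = this interpolant_terms_integrable[OF d hi]
    have "Np (\<lambda>x. interpolant M h x - radial_stretch (1 / p) (h x) * per (M *v x)) \<le> ?I"
      unfolding Np_def
    proof (intro nn_integral_mono_AE, use terms in eventually_elim)
      case (elim x)
      have e: "radial_stretch (1 / p) (h x) * per (M *v x) = (\<integral>k. radial_stretch (1 / p) (h x) * \<psi> (M *v x - lattice_vec k) \<partial>count_space UNIV)"
        by (simp add: per_def)
      have "(\<integral>k. s k x * \<psi> (M *v x - lattice_vec k) \<partial>count_space UNIV)
         = (\<integral>k. radial_stretch (1 / p) (coef M h k) * \<psi> (M *v x - lattice_vec k) 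
              - radial_stretch (1 / p) (h x) * \<psi> (M *v x - lattice_vec k) \<partial>count_space UNIV)"
        by (simp add: s_def left_diff_distrib)
      also have "\<dots> = interpolant M h x - radial_stretch (1 / p) (h x) * per (M *v x)"
      proof -
        have "integrable (count_space UNIV) (\<lambda>k. radial_stretch (1 / p) (coef M h k) * \<psi> (M *v x - lattice_vec k) - s k x * \<psi> (M *v x - lattice_vec k))"
          using elim by (intro Bochner_Integration.integrable_diff)
        \<comment> \<open>The series for \<open>per\<close> at \<open>M *v x\<close>, scaled by the
          stretched value, converges as a difference of two convergent series.\<close>
        then have "integrable (count_space UNIV) (\<lambda>k. radial_stretch (1 / p) (h x) * \<psi> (M *v x - lattice_vec k))"
          by (simp add: s_def left_diff_distrib)
        with elim(1) elim(2) show ?thesis unfolding e interpolant_def by (intro Bochner_Integration.integral_diff)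
      qed
      finally show ?case using integral_count_space_powr_le'[OF p, of "\<lambda>k. s k x * \<psi> (M *v x - lattice_vec k)"] by simp
    qed
    also note I
    finally show ?thesis .
  next
    case False
    then have "?rhs = top" unfolding infinity_ennreal_def by (simp only: less_top[symmetric] not_not)
    then show ?thesis by (simp only: top_greatest)
  qed
qed

end

section \<open>Equidistribution\<close>

text \<open>A Riemann sum for the integral of \<open>|h|\<close>, with sample points shifted by
  \<open>y\<close>.\<close>

definition lattice_avg :: "real^'n^'n \<Rightarrow> (real^'n \<Rightarrow> complex) \<Rightarrow> real^'n \<Rightarrow> ennreal" where
  "lattice_avg M h y = ennreal (inverse \<bar>det M\<bar>) *
     (\<integral>\<^sup>+k. ennreal (cmod (h (matrix_inv M *v (y + lattice_vec k)))) \<partial>count_space UNIV)"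

lemma lattice_avg_osc:
  shows "lattice_avg M h y \<le> lattice_avg M h 0 + lattice_osc M h y"
    and "lattice_avg M h 0 \<le> lattice_avg M h y + lattice_osc M h y"
proof -
  let ?u = "\<lambda>k. h (matrix_inv M *v (y + lattice_vec k))" and ?v = "\<lambda>k. h (matrix_inv M *v lattice_vec k)"
  have "(\<integral>\<^sup>+k. ennreal (cmod (?u k)) \<partial>count_space UNIV) \<le> (\<integral>\<^sup>+k. ennreal (cmod (?v k)) + ennreal (cmod (?u k - ?v k)) \<partial>count_space UNIV)"
    by (intro nn_integral_mono) (simp add: norm_triangle_sub flip: ennreal_plus)
  then show "lattice_avg M h y \<le> lattice_avg M h 0 + lattice_osc M h y"
    unfolding lattice_avg_def lattice_osc_def by (simp add: nn_integral_add mult_left_mono flip: distrib_left)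
  have "(\<integral>\<^sup>+k. ennreal (cmod (?v k)) \<partial>count_space UNIV) \<le> (\<integral>\<^sup>+k. ennreal (cmod (?u k)) + ennreal (cmod (?u k - ?v k)) \<partial>count_space UNIV)"
    using norm_triangle_sub[of "?v k" "?u k" for k]
    by (intro nn_integral_mono) (simp add: norm_minus_commute flip: ennreal_plus)
  then show "lattice_avg M h 0 \<le> lattice_avg M h y + lattice_osc M h y"
    unfolding lattice_avg_def lattice_osc_def by (simp add: nn_integral_add mult_left_mono flip: distrib_left)
qed

lemma lattice_avg_measurable:
  fixes M :: "real^'n^'n"
  assumes d: "det M \<noteq> 0" and h: "h \<in> borel_measurable lebesgue"
  shows "lattice_avg M h \<in> borel_measurable lebesgue"
proof -
  have "(\<lambda>z. ennreal (cmod (h (matrix_inv M *v (z + lattice_vec k))))) \<in> borel_measurable lebesgue" for k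
    using measurable_lattice_sample[OF d h, of k] by simp
  from borel_measurable_nn_integral_count_space[OF this]
  show ?thesis unfolding lattice_avg_def[abs_def] by (intro borel_measurable_times_ennreal) auto
qed

text \<open>Substituting \<open>y = M x\<close> and unfolding over the cube, the periodic factor
  leaves the lattice sum; what remains is the Riemann sum.\<close>

lemma nn_integral_periodic:
  fixes M :: "real^'n^'n"
  assumes d: "det M \<noteq> 0" and h: "h \<in> borel_measurable lebesgue" and q: "q \<in> borel_measurable lebesgue"
    and per: "\<And>x k. q (x - lattice_vec k) = q x"
  shows "(\<integral>\<^sup>+x. ennreal (cmod (h x)) * q (M *v x) \<partial>lebesgue)
    = (\<integral>\<^sup>+y. lattice_avg M h y * (indicator unit_cube y * q y) \<partial>lebesgue)"
proof -
  define g where "g y = ennreal (cmod (h (matrix_inv M *v y))) * q y" for y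
  have gm: "g \<in> borel_measurable lebesgue"
    unfolding g_def[abs_def] using measurable_lattice_sample[OF d h, of 0] q
    by (intro borel_measurable_times_ennreal) (auto simp: lattice_vec_def vec_eq_iff zero_vec_def[symmetric])
  have "(\<integral>\<^sup>+x. ennreal (cmod (h x)) * q (M *v x) \<partial>lebesgue) = ennreal (inverse \<bar>det M\<bar>) * (ennreal \<bar>det M\<bar> * (\<integral>\<^sup>+x. g (M *v x + 0) \<partial>lebesgue))"
    using d by (simp add: g_def det_matrix_inv mult.assoc[symmetric] ennreal_mult[symmetric] del: nn_integral_completion)
  also have "ennreal \<bar>det M\<bar> * (\<integral>\<^sup>+x. g (M *v x + 0) \<partial>lebesgue) = (\<integral>\<^sup>+x. g x \<partial>lebesgue)"
    by (rule nn_integral_lebesgue_affine[OF d gm])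
  also have "\<dots> = (\<integral>\<^sup>+y. indicator unit_cube y * (\<integral>\<^sup>+k. g (y - lattice_vec k) \<partial>count_space UNIV) \<partial>lebesgue)"
    by (rule nn_integral_unfold[OF gm])
  also have "\<dots> = (\<integral>\<^sup>+y. ennreal \<bar>det M\<bar> * (lattice_avg M h y * (indicator unit_cube y * q y)) \<partial>lebesgue)"
  proof (rule nn_integral_cong)
    fix y :: "real^'n"
    have "(\<integral>\<^sup>+k. g (y - lattice_vec k) \<partial>count_space UNIV) = (\<integral>\<^sup>+k. ennreal (cmod (h (matrix_inv M *v (y - lattice_vec k)))) \<partial>count_space UNIV) * q y"
      by (simp add: g_def per nn_integral_multc)
    also have "\<dots> = (\<integral>\<^sup>+k. ennreal (cmod (h (matrix_inv M *v (y + lattice_vec k)))) \<partial>count_space UNIV) * q y"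
      by (subst nn_integral_lattice_uminus) rule
    also have "\<dots> = ennreal \<bar>det M\<bar> * lattice_avg M h y * q y"
      using d by (simp add: lattice_avg_def mult.assoc[symmetric] ennreal_mult[symmetric])
    finally show "indicator unit_cube y * (\<integral>\<^sup>+k. g (y - lattice_vec k) \<partial>count_space UNIV) = ennreal \<bar>det M\<bar> * (lattice_avg M h y * (indicator unit_cube y * q y))"
      by (simp add: ac_simps)
  qed
  also have "\<dots> = ennreal \<bar>det M\<bar> * (\<integral>\<^sup>+y. lattice_avg M h y * (indicator unit_cube y * q y) \<partial>lebesgue)"
    using lattice_avg_measurable[OF d h] q
    by (intro nn_integral_cmult borel_measurable_times_ennreal borel_measurable_indicator) (auto simp: unit_cube_borel)
  finally show ?thesis using d by (simp add: mult.assoc[symmetric] ennreal_mult[symmetric] del: nn_integral_completion)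
qed

text \<open>The Riemann sum at \<open>y\<close> is traded for the one at 0, a constant, at the cost
  of the oscillation integrated against the weight.\<close>

lemma periodic_integral_avg:
  fixes M :: "real^'n^'n"
  assumes d: "det M \<noteq> 0" and h: "h \<in> borel_measurable lebesgue" and q: "q \<in> borel_measurable lebesgue"
    and per: "\<And>x k. q (x - lattice_vec k) = q x"
  defines "J \<equiv> \<integral>\<^sup>+y. indicator unit_cube y * q y \<partial>lebesgue"
    and "E \<equiv> \<integral>\<^sup>+y. lattice_osc M h y * (indicator unit_cube y * q y) \<partial>lebesgue"
  shows "(\<integral>\<^sup>+x. ennreal (cmod (h x)) * q (M *v x) \<partial>lebesgue) \<le> lattice_avg M h 0 * J + E" (is "?A \<le> _")
    and "lattice_avg M h 0 * J \<le> (\<integral>\<^sup>+x. ennreal (cmod (h x)) * q (M *v x) \<partial>lebesgue) + E"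
proof -
  note m = lattice_avg_measurable[OF d h] lattice_osc_measurable[OF d h]
  let ?w = "\<lambda>y. indicator unit_cube y * q y"
  have wm: "?w \<in> borel_measurable lebesgue"
    using q by (intro borel_measurable_times_ennreal borel_measurable_indicator) (auto simp: unit_cube_borel)
  have A: "?A = (\<integral>\<^sup>+y. lattice_avg M h y * ?w y \<partial>lebesgue)" by (rule nn_integral_periodic[OF d h q per])
  have c: "lattice_avg M h 0 * J = (\<integral>\<^sup>+y. lattice_avg M h 0 * ?w y \<partial>lebesgue)"
    unfolding J_def using wm by (rule nn_integral_cmult[symmetric])
  have "?A \<le> (\<integral>\<^sup>+y. lattice_avg M h 0 * ?w y + lattice_osc M h y * ?w y \<partial>lebesgue)"
    unfolding A distrib_right[symmetric] by (intro nn_integral_mono mult_right_mono lattice_avg_osc) auto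
  also have "\<dots> = lattice_avg M h 0 * J + E"
    unfolding c E_def by (rule nn_integral_add[OF borel_measurable_times_ennreal[OF borel_measurable_const wm]
        borel_measurable_times_ennreal[OF m(2) wm]])
  finally show "?A \<le> lattice_avg M h 0 * J + E" .
  have "lattice_avg M h 0 * J \<le> (\<integral>\<^sup>+y. lattice_avg M h y * ?w y + lattice_osc M h y * ?w y \<partial>lebesgue)"
    unfolding c distrib_right[symmetric] by (intro nn_integral_mono mult_right_mono lattice_avg_osc) auto
  also have "\<dots> = ?A + E"
    unfolding A E_def by (rule nn_integral_add[OF borel_measurable_times_ennreal[OF m(1) wm]
        borel_measurable_times_ennreal[OF m(2) wm]])
  finally show "lattice_avg M h 0 * J \<le> ?A + E" .
qed

text \<open>The Riemann sum at 0 is never evaluated. It is compared with the integral of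
  \<open>|h|\<close> by the same estimate for the weight 1, and then eliminated.\<close>

lemma equidistribution:
  fixes M :: "nat \<Rightarrow> real^'n^'n"
  assumes M: "\<And>j. expanding (M j)" and lim: "(\<lambda>j. onorm ((*v) (matrix_inv (M j)))) \<longlonglongrightarrow> 0"
    and h: "continuous_on UNIV h" and supp: "\<And>x. R < norm x \<Longrightarrow> h x = 0"
    and q: "q \<in> borel_measurable lebesgue" and per: "\<And>x k. q (x - lattice_vec k) = q x"
    and J: "(\<integral>\<^sup>+y. indicator unit_cube y * q y \<partial>lebesgue) = J" "J < \<infinity>"
  obtains r where "r \<longlonglongrightarrow> (0::ennreal)"
    "\<And>j. (\<integral>\<^sup>+x. ennreal (cmod (h x)) * q (M j *v x) \<partial>lebesgue) \<le> (\<integral>\<^sup>+x. ennreal (cmod (h x)) \<partial>lebesgue) * J + r j"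
    "\<And>j. (\<integral>\<^sup>+x. ennreal (cmod (h x)) \<partial>lebesgue) * J \<le> (\<integral>\<^sup>+x. ennreal (cmod (h x)) * q (M j *v x) \<partial>lebesgue) + r j"
proof -
  have d: "det (M j) \<noteq> 0" for j using M[of j] by (simp add: expanding_def)
  have hm: "h \<in> borel_measurable lebesgue" by (rule continuous_imp_lebesgue_measurable[OF h])
  have cm: "(indicator unit_cube :: real^'n \<Rightarrow> ennreal) \<in> borel_measurable lebesgue"
    by (intro borel_measurable_indicator) (simp add: unit_cube_borel)
  have c1: "(\<integral>\<^sup>+y. indicator unit_cube (y :: real^'n) * 1 \<partial>lebesgue) = (1::ennreal)"
    using emeasure_unit_cube[where 'n='n] nn_integral_indicator[of "unit_cube :: (real^'n) set" lebesgue]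
    by (simp add: unit_cube_borel del: nn_integral_completion emeasure_completion)
  define Eq E1 where "Eq j = (\<integral>\<^sup>+y. lattice_osc (M j) h y * (indicator unit_cube y * q y) \<partial>lebesgue)"
    and "E1 j = (\<integral>\<^sup>+y. lattice_osc (M j) h y * (indicator unit_cube y * 1) \<partial>lebesgue)" for j
  let ?N = "\<integral>\<^sup>+x. ennreal (cmod (h x)) \<partial>lebesgue"
  let ?A = "\<lambda>j. \<integral>\<^sup>+x. ennreal (cmod (h x)) * q (M j *v x) \<partial>lebesgue"
  have "Eq \<longlonglongrightarrow> 0" unfolding Eq_def[abs_def]
    by (rule lattice_osc_weighted_tendsto_0[OF M lim h supp]) (use q cm J in \<open>auto intro: borel_measurable_times_ennreal\<close>)
  moreover have "E1 \<longlonglongrightarrow> 0" unfolding E1_def[abs_def]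
    by (rule lattice_osc_weighted_tendsto_0[OF M lim h supp]) (use cm c1 in \<open>auto simp del: nn_integral_completion\<close>)
  then have "(\<lambda>j. J * E1 j) \<longlonglongrightarrow> J * 0" using J(2) by (intro ennreal_tendsto_cmult) auto
  ultimately have r: "(\<lambda>j. J * E1 j + Eq j) \<longlonglongrightarrow> 0" using tendsto_add[of "\<lambda>j. J * E1 j" "J * 0" _ Eq 0] by simp
  have q1: "?A j \<le> lattice_avg (M j) h 0 * J + Eq j" "lattice_avg (M j) h 0 * J \<le> ?A j + Eq j" for j
    using periodic_integral_avg[OF d hm q per, of j] unfolding J Eq_def by blast+
  \<comment> \<open>The case of constant weight 1, for which the cube contributes the factor
    1.\<close>
  have e1: "?N \<le> lattice_avg (M j) h 0 + E1 j" "lattice_avg (M j) h 0 \<le> ?N + E1 j" for j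
    using periodic_integral_avg[OF d hm, of "\<lambda>_. 1" j] unfolding c1 E1_def by simp_all
  show thesis
  proof (rule that[OF r])
    fix j
    have "?A j \<le> (?N + E1 j) * J + Eq j" using q1(1)[of j] e1(2)[of j]
      by (meson add_right_mono mult_right_mono order_trans zero_le)
    then show "?A j \<le> ?N * J + (J * E1 j + Eq j)" by (simp add: algebra_simps)
    have "?N * J \<le> (lattice_avg (M j) h 0 + E1 j) * J" using e1(1)[of j] by (rule mult_right_mono) simp
    also have "\<dots> = lattice_avg (M j) h 0 * J + E1 j * J" by (rule distrib_right)
    also have "\<dots> \<le> ?A j + Eq j + E1 j * J" using q1(2)[of j] by (rule add_right_mono)
    finally show "?N * J \<le> ?A j + (J * E1 j + Eq j)" by (simp add: ac_simps)
  qed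
qed

section \<open>Periodization on the cube and the vanishing remainder\<close>

context quasi_interpolation
begin

definition defect :: ennreal where
  "defect = (\<integral>\<^sup>+x. indicator unit_cube x * ennreal (cmod (per x - 1) powr p) \<partial>lebesgue)"

lemma per_periodic: "per (x - lattice_vec k) = per x"
proof -
  have "bij (\<lambda>l::int^'n. l + k)" by (rule o_bij[of "\<lambda>l. l - k"]) auto
  from integral_count_space_reindex[OF this, of "\<lambda>l. \<psi> (x - lattice_vec l)"]
  show ?thesis by (simp add: per_def lattice_vec_add diff_diff_eq add.commute)
qed

text \<open>Bounding \<open>|per|^p\<close> by the sum of the \<open>p\<close>-th powers leaves an
  integral over the cube that unfolds to the whole \<open>Np\<close> of the generator.\<close>

lemma cube_per_finite: "(\<integral>\<^sup>+x. indicator unit_cube x * ennreal (cmod (per x) powr p) \<partial>lebesgue) < \<infinity>"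
proof -
  have "(\<integral>\<^sup>+x. indicator unit_cube x * ennreal (cmod (per x) powr p) \<partial>lebesgue)
    \<le> (\<integral>\<^sup>+x. indicator unit_cube x * (\<integral>\<^sup>+k. ennreal (cmod (\<psi> (x - lattice_vec k)) powr p) \<partial>count_space UNIV) \<partial>lebesgue)"
    unfolding per_def by (intro nn_integral_mono mult_left_mono integral_count_space_powr_le'[OF p]) auto
  also have "\<dots> = (\<integral>\<^sup>+x. ennreal (cmod (\<psi> x) powr p) \<partial>lebesgue)"
    using psi_meas by (intro nn_integral_unfold[symmetric]) simp
  finally show ?thesis using psi_fin by (rule le_less_trans)
qed

lemma defect_finite: "defect < \<infinity>"
proof -
  have cm: "(indicator unit_cube :: real^'n \<Rightarrow> ennreal) \<in> borel_measurable lebesgue"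
    by (intro borel_measurable_indicator) (simp add: unit_cube_borel)
  have pm: "(\<lambda>x. ennreal (cmod (per x) powr p)) \<in> borel_measurable lebesgue" using per_meas by simp
  have t: "ennreal (cmod (per x - 1) powr p) \<le> ennreal (cmod (per x) powr p) + 1" for x
    using ennreal_leI[OF cmod_powr_triangle[OF p, of "per x" "-1"]] by simp
  have "defect \<le> (\<integral>\<^sup>+x. indicator unit_cube x * ennreal (cmod (per x) powr p) + indicator unit_cube x \<partial>lebesgue)"
    unfolding defect_def by (intro nn_integral_mono) (use t in \<open>auto simp: indicator_def\<close>)
  also have "\<dots> = (\<integral>\<^sup>+x. indicator unit_cube x * ennreal (cmod (per x) powr p) \<partial>lebesgue) + 1"
    using emeasure_unit_cube[where 'n='n] nn_integral_indicator[of "unit_cube :: (real^'n) set" lebesgue] cm pm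
    by (subst nn_integral_add) (auto simp: unit_cube_borel simp del: nn_integral_completion emeasure_completion intro: borel_measurable_times_ennreal)
  also have "\<dots> < \<infinity>" using cube_per_finite by simp
  finally show ?thesis .
qed

text \<open>The order of choices matters: \<epsilon> first, to make the term without oscillation
  small for every \<open>j\<close>; then \<open>C\<close>, which depends on \<epsilon>; the
  oscillation terms vanish for these fixed constants.\<close>

lemma interpolant_remainder_tendsto_0:
  fixes M :: "nat \<Rightarrow> real^'n^'n"
  assumes M: "\<And>j. expanding (M j)" and lim: "(\<lambda>j. onorm ((*v) (matrix_inv (M j)))) \<longlonglongrightarrow> 0"
    and h: "continuous_on UNIV h" and supp: "\<And>x. R < norm x \<Longrightarrow> h x = 0"
  shows "(\<lambda>j. Np (\<lambda>x. interpolant (M j) h x - radial_stretch (1 / p) (h x) * per (M j *v x))) \<longlonglongrightarrow> 0"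
proof (rule tendsto_zero_ennrealI)
  fix e :: real assume e: "0 < e"
  have "2 * ennreal K * N1 h * Np \<psi> < \<infinity>"
    using N1_finite[OF compactly_supported_integrable[OF h supp]] Np_psi by (simp add: ennreal_mult_less_top)
  then obtain c where c: "c \<ge> 0" "2 * ennreal K * N1 h * Np \<psi> = ennreal c"
    by (metis ennreal_cases infinity_ennreal_def less_irrefl)
  \<comment> \<open>Makes \<open>\<epsilon> * c\<close> at most \<open>e / 2\<close>, also when
    \<open>c = 0\<close>.\<close>
  define \<epsilon> where "\<epsilon> = e / (2 * (c + 1))"
  have \<epsilon>: "\<epsilon> > 0" using e c by (simp add: \<epsilon>_def)
  obtain C where C: "C \<ge> 0" "\<And>z w. cmod (radial_stretch (1 / p) z - radial_stretch (1 / p) w) powr p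
        \<le> \<epsilon> * (cmod z + cmod w) + C * cmod (z - w)"
    using radial_stretch_diff_bound[of "1 / p" \<epsilon>] p \<epsilon> by auto
  define r where "r j = ennreal (\<epsilon> + C) * ((\<integral>\<^sup>+w. lattice_osc (M j) h w * ennreal (cmod (\<phi> w)) \<partial>lebesgue) * Np \<psi>
         + N1 \<phi> * (\<integral>\<^sup>+y. lattice_osc (M j) h y * ennreal (cmod (\<psi> y) powr p) \<partial>lebesgue))" for j
  have "(\<lambda>j. \<integral>\<^sup>+w. lattice_osc (M j) h w * ennreal (cmod (\<phi> w)) \<partial>lebesgue) \<longlonglongrightarrow> 0"
    by (rule lattice_osc_weighted_tendsto_0[OF M lim h supp]) (use phi_meas N1_phi in \<open>auto simp: N1_def\<close>)
  then have 1: "(\<lambda>j. Np \<psi> * (\<integral>\<^sup>+w. lattice_osc (M j) h w * ennreal (cmod (\<phi> w)) \<partial>lebesgue)) \<longlonglongrightarrow> Np \<psi> * 0"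
    using Np_psi by (intro ennreal_tendsto_cmult) auto
  have "(\<lambda>j. \<integral>\<^sup>+y. lattice_osc (M j) h y * ennreal (cmod (\<psi> y) powr p) \<partial>lebesgue) \<longlonglongrightarrow> 0"
    by (rule lattice_osc_weighted_tendsto_0[OF M lim h supp]) (use psi_meas psi_fin in auto)
  then have 2: "(\<lambda>j. N1 \<phi> * (\<integral>\<^sup>+y. lattice_osc (M j) h y * ennreal (cmod (\<psi> y) powr p) \<partial>lebesgue)) \<longlonglongrightarrow> N1 \<phi> * 0"
    using N1_phi by (intro ennreal_tendsto_cmult) auto
  have "r \<longlonglongrightarrow> ennreal (\<epsilon> + C) * (Np \<psi> * 0 + N1 \<phi> * 0)"
    unfolding r_def[abs_def] using tendsto_add[OF 1 2] by (intro ennreal_tendsto_cmult) (simp_all add: mult.commute)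
  then have "r \<longlonglongrightarrow> 0" by simp
  moreover have "0 < ennreal (e / 2)" using e by simp
  ultimately have "\<forall>\<^sub>F j in sequentially. r j < ennreal (e / 2)" by (rule order_tendstoD(2))
  then show "\<forall>\<^sub>F j in sequentially. Np (\<lambda>x. interpolant (M j) h x - radial_stretch (1 / p) (h x) * per (M j *v x)) \<le> ennreal e"
  proof eventually_elim
    case (elim j)
    have "Np (\<lambda>x. interpolant (M j) h x - radial_stretch (1 / p) (h x) * per (M j *v x)) \<le> ennreal \<epsilon> * ennreal c + r j"
      using Np_interpolant_remainder[of "M j" h R \<epsilon> C, OF M h supp less_imp_le[OF \<epsilon>] C] unfolding r_def c .
    also have "\<dots> \<le> ennreal (e / 2) + ennreal (e / 2)"
    proof (rule add_mono)
      have "\<epsilon> * c \<le> e / 2" using e c by (simp add: \<epsilon>_def field_simps)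
      then show "ennreal \<epsilon> * ennreal c \<le> ennreal (e / 2)" using \<epsilon> c by (simp add: ennreal_leI flip: ennreal_mult)
    qed (use elim in simp)
    also have "\<dots> = ennreal e" using e by (simp flip: ennreal_plus)
    finally show ?case .
  qed
qed

end

section \<open>Passage to integrable functions\<close>

lemma nn_integral_norm_triangle:
  fixes u v :: "'a \<Rightarrow> complex"
  assumes "u \<in> borel_measurable M" "v \<in> borel_measurable M"
  shows "(\<integral>\<^sup>+x. ennreal (cmod (u x)) \<partial>M) \<le> (\<integral>\<^sup>+x. ennreal (cmod (v x)) \<partial>M) + (\<integral>\<^sup>+x. ennreal (cmod (u x - v x)) \<partial>M)"
proof -
  have "(\<integral>\<^sup>+x. ennreal (cmod (u x)) \<partial>M) \<le> (\<integral>\<^sup>+x. ennreal (cmod (v x)) + ennreal (cmod (u x - v x)) \<partial>M)"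
    by (intro nn_integral_mono) (simp add: norm_triangle_sub flip: ennreal_plus)
  also have "\<dots> = (\<integral>\<^sup>+x. ennreal (cmod (v x)) \<partial>M) + (\<integral>\<^sup>+x. ennreal (cmod (u x - v x)) \<partial>M)"
    using assms by (intro nn_integral_add) auto
  finally show ?thesis .
qed

context quasi_interpolation
begin

lemma stretch_measurable:
  "h \<in> borel_measurable lebesgue \<Longrightarrow> (\<lambda>x. radial_stretch (1 / p) (h x)) \<in> borel_measurable lebesgue"
  using p by (rule_tac measurable_compose[OF _ borel_measurable_continuous_onI[OF continuous_on_radial_stretch]]) auto

lemma N1_commute: "N1 (\<lambda>x. h x - g x) = N1 (\<lambda>x. g x - h x)"
  by (simp add: N1_def norm_minus_commute)

lemma Np_commute: "Np (\<lambda>x. h x - g x) = Np (\<lambda>x. g x - h x)"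
  by (simp add: Np_def norm_minus_commute)

lemma Np_triangle_diff:
  assumes "u \<in> borel_measurable lebesgue" "v \<in> borel_measurable lebesgue" "w \<in> borel_measurable lebesgue"
  shows "Np (\<lambda>x. u x - w x) \<le> Np (\<lambda>x. u x - v x) + Np (\<lambda>x. v x - w x)"
  using Np_triangle[of "\<lambda>x. u x - v x" "\<lambda>x. v x - w x"] assms by simp

lemma Np_stretch_diff:
  assumes h: "h \<in> borel_measurable lebesgue" and g: "g \<in> borel_measurable lebesgue"
    and C: "0 \<le> \<epsilon>" "0 \<le> C" "\<And>z w. cmod (radial_stretch (1 / p) z - radial_stretch (1 / p) w) powr p
        \<le> \<epsilon> * (cmod z + cmod w) + C * cmod (z - w)"
  shows "Np (\<lambda>x. radial_stretch (1 / p) (h x) - radial_stretch (1 / p) (g x))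
    \<le> ennreal \<epsilon> * (N1 h + N1 g) + ennreal C * N1 (\<lambda>x. h x - g x)"
proof -
  have "Np (\<lambda>x. radial_stretch (1 / p) (h x) - radial_stretch (1 / p) (g x))
    \<le> (\<integral>\<^sup>+x. ennreal \<epsilon> * (ennreal (cmod (h x)) + ennreal (cmod (g x))) + ennreal C * ennreal (cmod (h x - g x)) \<partial>lebesgue)"
    unfolding Np_def using C by (intro nn_integral_mono) (simp flip: ennreal_plus ennreal_mult)
  also have "\<dots> = ennreal \<epsilon> * (N1 h + N1 g) + ennreal C * N1 (\<lambda>x. h x - g x)"
    unfolding N1_def using h g by (simp add: nn_integral_add nn_integral_cmult del: nn_integral_completion)
  finally show ?thesis .
qed

text \<open>A single \<open>g\<close> must serve three purposes: closeness of the data, of the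
  stretched data, and of the interpolants for all invertible \<open>M\<close> at once. The
  tolerances are fixed before \<open>g\<close> is known, which works because
  \<open>\<rho> \<le> 1\<close> bounds \<open>N1 g\<close> by \<open>n + 1\<close>.\<close>

lemma approximation_error:
  assumes h: "integrable lebesgue h" and e: "0 < e"
  obtains g R where "continuous_on UNIV g" "\<And>x. R < norm x \<Longrightarrow> g x = 0" "N1 (\<lambda>x. h x - g x) \<le> ennreal e"
    "\<And>M. det M \<noteq> 0 \<Longrightarrow> Np (\<lambda>x. interpolant M h x - interpolant M g x) \<le> ennreal e"
    "Np (\<lambda>x. radial_stretch (1 / p) (h x) - radial_stretch (1 / p) (g x)) \<le> ennreal e"
proof -
  have "N1 h < \<infinity>" by (rule N1_finite[OF h])
  then obtain n where n: "n \<ge> 0" "N1 h = ennreal n" by (metis ennreal_cases infinity_ennreal_def less_irrefl)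
  obtain s where s: "s \<ge> 0" "Np \<psi> = ennreal s" using Np_psi by (metis ennreal_cases infinity_ennreal_def less_irrefl)
  \<comment> \<open>One tolerance for both error bounds: \<open>e'\<close> serves the stretched
    data, \<open>K * s * e'\<close> the interpolants.\<close>
  define e' where "e' = e / (K * s + 1)"
  have Ks: "K * s + 1 > 0" using K s by (simp add: add_nonneg_pos)
  have e': "e' > 0" "K * s * e' \<le> e" "e' \<le> e" 
    using e K s Ks by (auto simp: e'_def field_simps)
  \<comment> \<open>As \<open>N1 h + N1 g \<le> 2 * n + 1\<close>, the \<epsilon>-term uses up half
    of \<open>e'\<close>.\<close>
  define \<epsilon> where "\<epsilon> = e' / (2 * (2 * n + 1))"
  have \<epsilon>: "\<epsilon> > 0" using e' n by (simp add: \<epsilon>_def)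
  obtain C where C: "C \<ge> 0" "\<And>z w. cmod (radial_stretch (1 / p) z - radial_stretch (1 / p) w) powr p
        \<le> \<epsilon> * (cmod z + cmod w) + C * cmod (z - w)"
    using radial_stretch_diff_bound[of "1 / p" \<epsilon>] p \<epsilon> by auto
  \<comment> \<open>The bound 1 controls \<open>N1 g\<close>, the bound \<open>e\<close> the
    distance of the data, and the last one makes \<open>C * \<rho>\<close> the other half of
    \<open>e'\<close>.\<close>
  define \<rho> where "\<rho> = min (min 1 e) (e' / (2 * (C + 1)))"
  have \<rho>: "\<rho> > 0" "\<rho> \<le> 1" "\<rho> \<le> e" using e e' C by (auto simp: \<rho>_def)
  have "\<rho> \<le> e' / (2 * (C + 1))" by (simp add: \<rho>_def)
  then have C\<rho>: "C * \<rho> \<le> e' / 2" using C(1) \<rho> by (simp add: field_simps)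
  obtain g R where g: "continuous_on UNIV g" "\<And>x. R < norm x \<Longrightarrow> g x = 0"
    "(\<integral>\<^sup>+x. ennreal (cmod (h x - g x)) \<partial>lebesgue) < ennreal \<rho>"
    using L1_approx_compactly_supported[OF h \<rho>(1)] by blast
  have gi: "integrable lebesgue g" by (rule compactly_supported_integrable[OF g(1,2)])
  have hg: "N1 (\<lambda>x. h x - g x) \<le> ennreal \<rho>" using g(3) by (simp add: N1_def)
  have "N1 g \<le> N1 h + N1 (\<lambda>x. g x - h x)"
    unfolding N1_def using gi h by (intro nn_integral_norm_triangle) auto
  also have "\<dots> \<le> ennreal n + ennreal 1"
    using hg \<rho> unfolding N1_commute[of g h] n by (intro add_mono) (auto intro: order_trans ennreal_leI)
  finally have "N1 g \<le> ennreal (n + 1)" using n by simp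
  then have "ennreal \<epsilon> * (N1 h + N1 g) + ennreal C * N1 (\<lambda>x. h x - g x)
     \<le> ennreal \<epsilon> * (ennreal n + ennreal (n + 1)) + ennreal C * ennreal \<rho>"
    using hg unfolding n by (intro add_mono mult_left_mono) auto
  also have "\<dots> = ennreal (\<epsilon> * (2 * n + 1) + C * \<rho>)"
    using \<epsilon> n C \<rho> by (simp add: ennreal_mult[symmetric] ennreal_plus[symmetric] del: ennreal_plus)
  also have "\<dots> \<le> ennreal e'"
  proof (rule ennreal_leI)
    have "\<epsilon> * (2 * n + 1) = e' / 2" using n by (simp add: \<epsilon>_def field_simps)
    then show "\<epsilon> * (2 * n + 1) + C * \<rho> \<le> e'" using C\<rho> by simp
  qed
  finally have X: "ennreal \<epsilon> * (N1 h + N1 g) + ennreal C * N1 (\<lambda>x. h x - g x) \<le> ennreal e'" .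
  show thesis
  proof (rule that[OF g(1,2)])
    show "N1 (\<lambda>x. h x - g x) \<le> ennreal e" using hg \<rho>(3) by (auto intro: order_trans ennreal_leI)
    show "Np (\<lambda>x. radial_stretch (1 / p) (h x) - radial_stretch (1 / p) (g x)) \<le> ennreal e"
      using Np_stretch_diff[OF _ _ less_imp_le[OF \<epsilon>] C, of h g] h gi X e'(3)
      by (auto intro: order_trans ennreal_leI)
    fix M :: "real^'n^'n" assume d: "det M \<noteq> 0"
    have "Np (\<lambda>x. interpolant M h x - interpolant M g x) \<le> ennreal K * (ennreal \<epsilon> * (N1 h + N1 g) + ennreal C * N1 (\<lambda>x. h x - g x)) * Np \<psi>"
      by (rule Np_interpolant_diff[OF d h gi less_imp_le[OF \<epsilon>] C])
    also have "\<dots> \<le> ennreal K * ennreal e' * ennreal s"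
      unfolding s by (intro mult_right_mono mult_left_mono X) auto
    also have "\<dots> = ennreal (K * s * e')" using K s e' by (simp add: ennreal_mult[symmetric] ac_simps)
    also have "\<dots> \<le> ennreal e" using e'(2) by (rule ennreal_leI)
    finally show "Np (\<lambda>x. interpolant M h x - interpolant M g x) \<le> ennreal e" .
  qed
qed

theorem interpolant_error_tendsto:
  fixes M :: "nat \<Rightarrow> real^'n^'n"
  assumes M: "\<And>j. expanding (M j)" and lim: "(\<lambda>j. onorm ((*v) (matrix_inv (M j)))) \<longlonglongrightarrow> 0"
    and h: "integrable lebesgue h"
  shows "(\<lambda>j. Np (\<lambda>x. interpolant (M j) h x - radial_stretch (1 / p) (h x))) \<longlonglongrightarrow> N1 h * defect"
proof -
  have d: "det (M j) \<noteq> 0" for j using M[of j] by (simp add: expanding_def)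
  have hm: "h \<in> borel_measurable lebesgue" using h by auto
  obtain D where D: "D \<ge> 0" "defect = ennreal D" using defect_finite by (metis ennreal_cases infinity_ennreal_def less_irrefl)
  have both: "\<forall>\<^sub>F j in sequentially. Np (\<lambda>x. interpolant (M j) h x - radial_stretch (1 / p) (h x)) \<le> N1 h * defect + ennreal e
    \<and> N1 h * defect \<le> Np (\<lambda>x. interpolant (M j) h x - radial_stretch (1 / p) (h x)) + ennreal e" if e: "0 < e" for e :: real
  proof -
    \<comment> \<open>The budget: four errors of size \<open>c\<close>, two from approximation, one
      from the remainder and one from equidistribution, plus \<open>c * defect\<close> for
      exchanging \<open>N1 g\<close> and \<open>N1 h\<close>.\<close>
    define c where "c = e / (D + 4)"
    have c: "c > 0" using e D by (simp add: c_def)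
    have c4: "(D + 4) * c = e" using D by (simp add: c_def)
    obtain g R where g: "continuous_on UNIV g" and supp: "\<And>x. R < norm x \<Longrightarrow> g x = 0"
      and hg: "N1 (\<lambda>x. h x - g x) \<le> ennreal c"
      and interpolant: "\<And>M. det M \<noteq> 0 \<Longrightarrow> Np (\<lambda>x. interpolant M h x - interpolant M g x) \<le> ennreal c"
      and st: "Np (\<lambda>x. radial_stretch (1 / p) (h x) - radial_stretch (1 / p) (g x)) \<le> ennreal c"
      using approximation_error[OF h c] by blast
    have gm: "g \<in> borel_measurable lebesgue" by (rule continuous_imp_lebesgue_measurable[OF g])
    define Lh Lg where "Lh x = radial_stretch (1 / p) (h x)" and "Lg x = radial_stretch (1 / p) (g x)" for x
    \<comment> \<open>The middle link of the chain from the interpolant of \<open>h\<close> over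
      that of \<open>g\<close> to \<open>Y j\<close>, then to \<open>Lg\<close> and
      \<open>Lh\<close>. Only the step from \<open>Y j\<close> to \<open>Lg\<close> does not become
      small.\<close>
    define Y where "Y j x = Lg x * per (M j *v x)" for j x
    have Lm: "Lh \<in> borel_measurable lebesgue" "Lg \<in> borel_measurable lebesgue"
      unfolding Lh_def[abs_def] Lg_def[abs_def] by (rule stretch_measurable[OF hm], rule stretch_measurable[OF gm])
    have pm: "(\<lambda>x. per (M j *v x)) \<in> borel_measurable lebesgue" for j
      using measurable_compose[OF measurable_lebesgue_linear[OF d] per_meas] .
    have Ym: "Y j \<in> borel_measurable lebesgue" for j unfolding Y_def[abs_def] using Lm pm by simp
    have qm: "interpolant (M j) u \<in> borel_measurable lebesgue" for j u by (rule interpolant_meas[OF d])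
    have q: "(\<lambda>x. ennreal (cmod (per x - 1) powr p)) \<in> borel_measurable lebesgue" using per_meas by simp
    obtain r where r: "r \<longlonglongrightarrow> (0::ennreal)"
      and r1: "\<And>j. (\<integral>\<^sup>+x. ennreal (cmod (g x)) * ennreal (cmod (per (M j *v x) - 1) powr p) \<partial>lebesgue) \<le> N1 g * defect + r j"
      and r2: "\<And>j. N1 g * defect \<le> (\<integral>\<^sup>+x. ennreal (cmod (g x)) * ennreal (cmod (per (M j *v x) - 1) powr p) \<partial>lebesgue) + r j"
      unfolding N1_def
      by (rule equidistribution[OF M lim g supp q _ defect_def[symmetric] defect_finite]) (simp_all add: per_periodic)
    have YL: "Np (\<lambda>x. Y j x - Lg x) = (\<integral>\<^sup>+x. ennreal (cmod (g x)) * ennreal (cmod (per (M j *v x) - 1) powr p) \<partial>lebesgue)" for j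
    proof -
      \<comment> \<open>The \<open>p\<close>-th power undoes the stretch, leaving \<open>|g|\<close>
        times a periodic function, which is the shape that equidistribution handles.\<close>
      have "cmod (Y j x - Lg x) powr p = cmod (g x) * cmod (per (M j *v x) - 1) powr p" for x
      proof -
        have "Y j x - Lg x = Lg x * (per (M j *v x) - 1)" by (simp add: Y_def right_diff_distrib)
        then show ?thesis using p by (simp add: norm_mult powr_mult Lg_def cmod_radial_stretch powr_powr)
      qed
      then show ?thesis unfolding Np_def by (simp add: ennreal_mult)
    qed
    have "\<forall>\<^sub>F j in sequentially. r j < ennreal c" using r c by (intro order_tendstoD(2)) auto
    moreover have "\<forall>\<^sub>F j in sequentially. Np (\<lambda>x. interpolant (M j) g x - Y j x) < ennreal c"
      using interpolant_remainder_tendsto_0[OF M lim g supp] c unfolding Y_def Lg_def by (intro order_tendstoD(2)) auto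
    ultimately show ?thesis
    proof eventually_elim
      case (elim j)
      have gh: "N1 g \<le> N1 h + ennreal c" "N1 h \<le> N1 g + ennreal c"
        using nn_integral_norm_triangle[OF gm hm] nn_integral_norm_triangle[OF hm gm] hg N1_commute[of g h]
        unfolding N1_def by (auto intro: order_trans add_left_mono)
      have s4: "ennreal c + (ennreal c + (ennreal c + (ennreal c + ennreal c * defect))) = ennreal e"
        using c D c4 by (simp add: ennreal_mult[symmetric] ennreal_plus[symmetric] algebra_simps del: ennreal_plus)
      have st': "Np (\<lambda>x. Lg x - Lh x) \<le> ennreal c" "Np (\<lambda>x. Lh x - Lg x) \<le> ennreal c"
        using st unfolding Np_commute[of Lg Lh] by (simp_all add: Lh_def Lg_def)
      let ?X = "Np (\<lambda>x. interpolant (M j) h x - Lh x)" and ?Y = "Np (\<lambda>x. Y j x - Lg x)"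
      have "?X \<le> Np (\<lambda>x. interpolant (M j) h x - interpolant (M j) g x) + (Np (\<lambda>x. interpolant (M j) g x - Y j x) + (?Y + Np (\<lambda>x. Lg x - Lh x)))"
        by (intro order_trans[OF Np_triangle_diff[OF qm qm Lm(1)] add_left_mono]
            order_trans[OF Np_triangle_diff[OF qm Ym Lm(1)] add_left_mono] Np_triangle_diff[OF Ym Lm(2) Lm(1)])
      also have "\<dots> \<le> ennreal c + (ennreal c + (?Y + ennreal c))"
        using interpolant[OF d] elim(2) st'
        by (intro add_mono order_refl) auto
      also have "?Y \<le> (N1 h + ennreal c) * defect + ennreal c"
        unfolding YL using elim(1) by (intro order_trans[OF r1[of j]] add_mono mult_right_mono gh) auto
      finally have up: "?X \<le> N1 h * defect + ennreal e"
        unfolding s4[symmetric] by (simp add: algebra_simps add_left_mono add_right_mono)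
      have "N1 h * defect \<le> (N1 g + ennreal c) * defect" by (intro mult_right_mono gh) auto
      also have "\<dots> \<le> (?Y + ennreal c) + ennreal c * defect"
        unfolding distrib_right YL using elim(1) by (intro add_right_mono order_trans[OF r2[of j]] add_left_mono) auto
      also have "?Y \<le> Np (\<lambda>x. Y j x - interpolant (M j) g x) + (Np (\<lambda>x. interpolant (M j) g x - interpolant (M j) h x) + (?X + Np (\<lambda>x. Lh x - Lg x)))"
        by (intro order_trans[OF Np_triangle_diff[OF Ym qm Lm(2)] add_left_mono]
            order_trans[OF Np_triangle_diff[OF qm qm Lm(2)] add_left_mono] Np_triangle_diff[OF qm Lm(1) Lm(2)])
      also have "\<dots> \<le> ennreal c + (ennreal c + (?X + ennreal c))"
        using interpolant[OF d] elim(2) st' unfolding Np_commute[of "Y j" "interpolant (M j) g"] Np_commute[of "interpolant (M j) g" "interpolant (M j) h"]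
        by (intro add_mono order_refl) auto
      finally have lo: "N1 h * defect \<le> ?X + ennreal e"
        unfolding s4[symmetric] by (simp add: ac_simps add_left_mono add_right_mono)
      from up lo show ?case unfolding Lh_def by blast
    qed
  qed
  have fin: "N1 h * defect < \<infinity>" using N1_finite[OF h] defect_finite by (simp add: ennreal_mult_less_top)
  show ?thesis
    by (rule tendsto_ennreal_sandwich[OF fin]; rule eventually_mono[OF both]) (assumption | blast)+
qed

end

section \<open>Reduction to the integer lattice\<close>

lemma lattice_point_eq: "lattice_point b k = b *v lattice_vec k"
  by (simp add: lattice_point_def lattice_vec_def)

lemma Lp_norm_eq:
  assumes "u \<in> borel_measurable M"
  shows "Lp_norm p M u = enn2real (\<integral>\<^sup>+x. ennreal (cmod (u x) powr p) \<partial>M) powr (1 / p)"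
  using assms by (simp add: Lp_norm_def integral_eq_nn_integral)

lemma Lp_space_iff:
  "u \<in> Lp_space p M \<longleftrightarrow> u \<in> borel_measurable M \<and> (\<integral>\<^sup>+x. ennreal (cmod (u x) powr p) \<partial>M) < \<infinity>"
  by (auto simp: Lp_space_def integrable_iff_bounded)

lemma matrix_inv_unique:
  fixes A B :: "real^'n^'n"
  assumes "A ** B = mat 1"
  shows "matrix_inv A = B"
proof -
  have "B ** A = mat 1" using assms matrix_left_right_inverse by blast
  then have "invertible A" using assms unfolding invertible_def by blast
  then have "matrix_inv A = matrix_inv A ** (A ** B)" by (simp add: assms)
  also have "\<dots> = B" using \<open>invertible A\<close> by (simp add: matrix_mul_assoc matrix_inv_mult_left)
  finally show ?thesis .
qed

text \<open>The factor \<open>|det b|\<close> keeps the integral of \<phi> equal to 1 under dilation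
  and is also the one in the definition of the periodization, so the bound on the latter becomes
  \<open>phi_sum\<close>.\<close>

lemma rescaled_quasi_interpolation:
  fixes b :: "real^'n^'n" and \<psi> \<phi> :: "real^'n \<Rightarrow> complex"
  assumes b_inv: "invertible b" and p: "0 < p" "p \<le> 1"
    and psi: "\<psi> \<in> Lp_space p lebesgue" and phi: "\<phi> \<in> Linf_space lebesgue"
    and P_phi: "periodization_in_Linf b (\<lambda>x. of_real (cmod (\<phi> x)))"
    and int_phi: "(\<integral>x. \<phi> x \<partial>lebesgue) = 1"
  obtains K where "quasi_interpolation p K (\<lambda>x. of_real \<bar>det b\<bar> * \<psi> (b *v x)) (\<lambda>x. of_real \<bar>det b\<bar> * cnj (\<phi> (b *v x)))"
proof -
  have db: "det b \<noteq> 0" using b_inv by (simp add: invertible_det_nz)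
  let ?psi = "\<lambda>x. of_real \<bar>det b\<bar> * \<psi> (b *v x)" and ?phi = "\<lambda>x. of_real \<bar>det b\<bar> * cnj (\<phi> (b *v x))"
  note lin = measurable_lebesgue_linear[OF db]
  have psim: "\<psi> \<in> borel_measurable lebesgue" and psif: "(\<integral>\<^sup>+x. ennreal (cmod (\<psi> x) powr p) \<partial>lebesgue) < \<infinity>"
    using psi by (auto simp: Lp_space_iff)
  have phim: "\<phi> \<in> borel_measurable lebesgue" using phi by (simp add: Linf_space_def)
  have bpsi: "(\<lambda>x. \<psi> (b *v x)) \<in> borel_measurable lebesgue" using measurable_compose[OF lin psim] .
  have cphi: "(\<lambda>x. cnj (\<phi> x)) \<in> borel_measurable lebesgue"
    by (rule measurable_compose[OF phim borel_measurable_continuous_onI]) (intro continuous_intros)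
  have bphi: "(\<lambda>x. cnj (\<phi> (b *v x))) \<in> borel_measurable lebesgue"
    using measurable_compose[OF lin cphi] .
  obtain K0 where K0: "AE x in lebesgue. cmod (periodization b (\<lambda>x. of_real (cmod (\<phi> x))) x) \<le> K0"
    and sm: "AE x in lebesgue. (\<lambda>k. complex_of_real (cmod (\<phi> (x - lattice_point b k)))) summable_on UNIV"
    using P_phi unfolding periodization_in_Linf_def Linf_space_def by auto
  \<comment> \<open>An almost everywhere bound \<open>K0\<close> comes without a sign, whereas the
    locale asks for a nonnegative one.\<close>
  define K where "K = max 0 K0"
  have sum: "AE x in lebesgue. (\<integral>\<^sup>+k. ennreal (\<bar>det b\<bar> * cmod (\<phi> (x - lattice_point b k))) \<partial>count_space UNIV) \<le> ennreal K"
    using K0 sm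
  proof eventually_elim
    case (elim x)
    let ?g = "\<lambda>k. complex_of_real (cmod (\<phi> (x - lattice_point b k)))"
    let ?c = "\<lambda>k. cmod (\<phi> (x - lattice_point b k))"
    \<comment> \<open>Where summability fails, \<open>infsum\<close> is 0 and \<open>K0\<close> says
      nothing about the sum; hence the summability part of \<open>periodization_in_Linf\<close>
      enters here.\<close>
    have "Infinite_Set_Sum.abs_summable_on ?g UNIV"
      using elim(2) unfolding summable_on_iff_abs_summable_on_complex abs_summable_equivalent .
    then have int: "integrable (count_space UNIV) ?g" by (simp add: Infinite_Set_Sum.abs_summable_on_def)
    then have intc: "integrable (count_space UNIV) ?c" by (simp add: complex_of_real_integrable_eq)
    have "periodization b (\<lambda>x. of_real (cmod (\<phi> x))) x = of_real (\<bar>det b\<bar> * (\<integral>k. ?c k \<partial>count_space UNIV))"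
      by (simp add: periodization_def infsum_eq_integral_count_space)
    then have "\<bar>det b\<bar> * (\<integral>k. ?c k \<partial>count_space UNIV) \<le> K"
      using elim(1) by (simp add: K_def norm_mult del: of_real_mult)
    then have "ennreal \<bar>det b\<bar> * ennreal (\<integral>k. ?c k \<partial>count_space UNIV) \<le> ennreal K"
      by (subst ennreal_mult[symmetric]) (auto intro: ennreal_leI)
    moreover have "ennreal (\<integral>k. ?c k \<partial>count_space UNIV) = (\<integral>\<^sup>+k. ennreal (?c k) \<partial>count_space UNIV)"
      using intc by (intro nn_integral_eq_integral[symmetric]) auto
    ultimately show ?case by (simp add: ennreal_mult nn_integral_cmult)
  qed
  have "quasi_interpolation p K ?psi ?phi"
  proof
    show "0 < p" "p \<le> 1" "0 \<le> K" using p by (auto simp: K_def)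
    show "?psi \<in> borel_measurable lebesgue" "?phi \<in> borel_measurable lebesgue" using bpsi bphi by auto
    have pm: "(\<lambda>x. ennreal (cmod (\<psi> x) powr p)) \<in> borel_measurable lebesgue" using psim by simp
    have "(\<integral>\<^sup>+x. ennreal (cmod (\<psi> (b *v x)) powr p) \<partial>lebesgue) < \<infinity>"
    proof -
      have "ennreal \<bar>det b\<bar> * (\<integral>\<^sup>+x. ennreal (cmod (\<psi> (b *v x)) powr p) \<partial>lebesgue) < \<infinity>"
        using nn_integral_lebesgue_affine[OF db pm, of 0] psif by simp
      then show ?thesis using db by (auto simp: ennreal_mult_less_top)
    qed
    then show "(\<integral>\<^sup>+x. ennreal (cmod (?psi x) powr p) \<partial>lebesgue) < \<infinity>"
      using bpsi by (simp add: norm_mult powr_mult ennreal_mult nn_integral_cmult ennreal_mult_less_top del: nn_integral_completion)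
    show "AE x in lebesgue. (\<integral>\<^sup>+k. ennreal (cmod (?phi (x - lattice_vec k))) \<partial>count_space UNIV) \<le> ennreal K"
      using AE_lebesgue_affine[OF db sum, of 0]
      by (simp add: norm_mult lattice_point_eq matrix_vector_mult_diff_distrib)
    have "(\<integral>x. ?phi x \<partial>lebesgue) = of_real \<bar>det b\<bar> * (\<integral>x. cnj (\<phi> (b *v x)) \<partial>lebesgue)" by simp
    also have "\<dots> = (\<integral>x. cnj (\<phi> x) \<partial>lebesgue)"
      using integral_lebesgue_affine[OF db cphi, of 0] by simp
    also have "\<dots> = 1" using int_phi by simp
    finally show "(\<integral>x. ?phi x \<partial>lebesgue) = 1" .
  qed
  then show thesis by (rule that)
qed

theorem theorem3:
  fixes a :: "nat \<Rightarrow> real ^ 'd ^ 'd"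
    and b :: "real ^ 'd ^ 'd"
    and p :: real
    and \<psi> \<phi> f :: "real ^ 'd \<Rightarrow> complex"
  assumes a_inv: "\<And>j. j > 0 \<Longrightarrow> invertible (a j)"
    and a_expand: "(\<lambda>j. onorm (\<lambda>x. matrix_inv (a j) *v x)) \<longlonglongrightarrow> 0"
    and b_inv: "invertible b"
    and p: "0 < p" "p \<le> 1"
    and psi: "\<psi> \<in> Lp_space p lebesgue"
    and phi: "\<phi> \<in> Linf_space lebesgue"
    and P_phi: "periodization_in_Linf b (\<lambda>x. of_real (cmod (\<phi> x)))"
    and int_phi: "(\<integral>x. \<phi> x \<partial>lebesgue) = 1"
    and f: "f \<in> Lp_space p lebesgue"
  shows "(\<forall>j>0. synthesis p (a j) b \<psi> (analysis p (a j) b \<phi> f) \<in> Lp_space p lebesgue)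
    \<and> (\<lambda>x. periodization b \<psi> (b *v x)) \<in> Lp_space p (lebesgue_on unit_cube)
    \<and> (\<lambda>j. Lp_norm p lebesgue (\<lambda>x. synthesis p (a j) b \<psi> (analysis p (a j) b \<phi> f) x - f x))
        \<longlonglongrightarrow> Lp_norm p (lebesgue_on unit_cube) (\<lambda>x. periodization b \<psi> (b *v x) - 1)
              * Lp_norm p lebesgue f
    \<and> ((AE x in lebesgue. periodization b \<psi> x = 1) \<longrightarrow>
        Lp_tendsto p lebesgue (\<lambda>j. synthesis p (a j) b \<psi> (analysis p (a j) b \<phi> f)) f)"
proof -
  let ?psi = "\<lambda>x. of_real \<bar>det b\<bar> * \<psi> (b *v x)" and ?phi = "\<lambda>x. of_real \<bar>det b\<bar> * cnj (\<phi> (b *v x))"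
  obtain K where "quasi_interpolation p K ?psi ?phi"
    using rescaled_quasi_interpolation[OF b_inv p psi phi P_phi int_phi] by blast
  then interpret quasi_interpolation p K ?psi ?phi .
  have db: "det b \<noteq> 0" using b_inv by (simp add: invertible_det_nz)
  \<comment> \<open>Then \<open>a j = b ** M j\<close>, so sampling along the lattice of
    \<open>b\<close> at scale \<open>a j\<close> is sampling along the integers at scale
    \<open>M j\<close>.\<close>
  define M where "M j = matrix_inv b ** a j" for j
  have bM: "b ** M j = a j" for j
    using b_inv by (simp add: M_def matrix_mul_assoc matrix_inv_mult_right)
  have bMv: "b *v (M j *v x) = a j *v x" for j x
    by (simp add: matrix_vector_mul_assoc bM)
  have da: "det (a j) = det b * det (M j)" for j using bM[of j] det_mul[of b "M j"] by simp
  have dM: "det (M j) \<noteq> 0" if "j > 0" for j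
    using a_inv[OF that] da[of j] by (auto simp: invertible_det_nz)
  have inv_M: "matrix_inv (M j) = matrix_inv (a j) ** b" if "j > 0" for j
  proof (rule matrix_inv_unique)
    have "M j ** (matrix_inv (a j) ** b) = matrix_inv b ** (a j ** matrix_inv (a j)) ** b"
      by (simp add: M_def matrix_mul_assoc)
    then show "M j ** (matrix_inv (a j) ** b) = mat 1"
      using a_inv[OF that] b_inv by (simp add: matrix_inv_mult_left matrix_inv_mult_right)
  qed
  define H where "H x = radial_stretch p (f x)" for x
  have fm: "f \<in> borel_measurable lebesgue" and ff: "(\<integral>\<^sup>+x. ennreal (cmod (f x) powr p) \<partial>lebesgue) < \<infinity>"
    using f by (auto simp: Lp_space_iff)
  have Hm: "H \<in> borel_measurable lebesgue"
    unfolding H_def[abs_def]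
    by (rule measurable_compose[OF fm borel_measurable_continuous_onI[OF continuous_on_radial_stretch[OF p(1)]]])
  have Hi: "integrable lebesgue H"
    using Hm ff by (simp add: integrable_iff_bounded H_def cmod_radial_stretch)
  have N1H: "N1 H = (\<integral>\<^sup>+x. ennreal (cmod (f x) powr p) \<partial>lebesgue)"
    by (simp add: N1_def H_def cmod_radial_stretch)
  have fH: "radial_stretch (1 / p) (H x) = f x" for x
    using radial_stretch_inverse[of "1 / p" "f x"] p by (simp add: H_def)
  have per_eq: "periodization b \<psi> (b *v x) = per x" for x
    by (simp add: periodization_def per_def infsum_eq_integral_count_space lattice_point_eq matrix_vector_mult_diff_distrib)
  have syn_eq: "synthesis p (a j) b \<psi> (analysis p (a j) b \<phi> f) x = interpolant (M j) H x" for j x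
  proof -
    have arg: "a j *v x - lattice_point b k = b *v (M j *v x - lattice_vec k)" for k x
      by (simp add: lattice_point_eq matrix_vector_mult_diff_distrib bMv)
    have "analysis p (a j) b \<phi> f k * wavelet p (a j) b \<psi> k x
       = radial_stretch (1 / p) (coef (M j) H k) * ?psi (M j *v x - lattice_vec k)" for k
    proof -
      \<comment> \<open>The scalars match as follows: \<open>|det (M j)|\<close> and the
        \<open>|det b|\<close> in \<open>?phi\<close> form \<open>|det (a j)|\<close>, whose power
        \<open>1 / p\<close> is the normalisation of the wavelet; the \<open>|det b|\<close> of the
        analysis operator sits in \<open>?psi\<close>.\<close>
      let ?P = "pairing (\<lambda>x. radial_stretch p (f x)) (\<lambda>x. \<phi> (a j *v x - lattice_point b k))"
      have "coef (M j) H k = of_real \<bar>det (M j)\<bar> * (of_real \<bar>det b\<bar> * ?P)"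
        unfolding coef_def pairing_def arg H_def
        by (simp only: mult.left_commute[of "radial_stretch p (f _)" "complex_of_real \<bar>det b\<bar>"] integral_mult_right_zero)
      also have "\<dots> = of_real \<bar>det (a j)\<bar> * ?P"
        by (simp add: da abs_mult)
      finally have "radial_stretch (1 / p) (coef (M j) H k) = of_real (\<bar>det (a j)\<bar> powr (1 / p)) * radial_stretch (1 / p) ?P"
        by (simp add: radial_stretch_scale)
      then show ?thesis
        using p by (simp add: analysis_def wavelet_def inv_radial_stretch arg)
    qed
    then show ?thesis by (simp add: synthesis_def interpolant_def infsum_eq_integral_count_space)
  qed
  have syn: "synthesis p (a j) b \<psi> (analysis p (a j) b \<phi> f) = interpolant (M j) H" for j
    by (rule ext) (rule syn_eq)
  have Lp_interpolant: "interpolant (M j) H \<in> Lp_space p lebesgue" if "j > 0" for j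
  proof -
    have "Np (interpolant (M j) H) < \<infinity>"
      using N1_finite[OF Hi] Np_psi by (intro le_less_trans[OF Np_interpolant[OF dM[OF that] Hi]]) (simp add: ennreal_mult_less_top)
    then show ?thesis using interpolant_meas[OF dM[OF that]] by (simp add: Lp_space_iff Np_def)
  qed
  have cube: "unit_cube \<in> sets lebesgue" by (simp add: unit_cube_borel)
  have on_cube: "(\<integral>\<^sup>+x. g x \<partial>lebesgue_on unit_cube) = (\<integral>\<^sup>+x. indicator unit_cube x * g x \<partial>lebesgue)" for g :: "real^'d \<Rightarrow> ennreal"
    using cube nn_integral_restrict_space[of unit_cube lebesgue g]
    by (simp add: mult.commute del: nn_integral_completion)
  have perm: "per \<in> borel_measurable (lebesgue_on unit_cube)"
    using per_meas by (rule measurable_restrict_space1)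
  have Lp_per: "per \<in> Lp_space p (lebesgue_on unit_cube)"
    using perm cube_per_finite by (simp add: Lp_space_iff on_cube)
  have norm_per: "Lp_norm p (lebesgue_on unit_cube) (\<lambda>x. per x - 1) = enn2real defect powr (1 / p)"
    using perm by (simp add: Lp_norm_eq on_cube defect_def)
  have norm_f: "Lp_norm p lebesgue f = enn2real (N1 H) powr (1 / p)"
    using fm by (simp add: Lp_norm_eq N1H)

  have prod0: "(\<lambda>j. onorm ((*v) (matrix_inv (a j))) * onorm ((*v) b)) \<longlonglongrightarrow> 0"
    using tendsto_mult_right[OF a_expand, of "onorm ((*v) b)"] by simp
  have lim: "(\<lambda>j. onorm ((*v) (matrix_inv (M j)))) \<longlonglongrightarrow> 0"
  proof (rule tendsto_sandwich[OF _ _ tendsto_const prod0])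
    show "\<forall>\<^sub>F j in sequentially. onorm ((*v) (matrix_inv (M j))) \<le> onorm ((*v) (matrix_inv (a j))) * onorm ((*v) b)"
    proof (rule eventually_sequentiallyI[of 1])
      fix j :: nat assume "1 \<le> j"
      then have "(*v) (matrix_inv (M j)) = (*v) (matrix_inv (a j)) \<circ> (*v) b"
        by (simp add: inv_M o_def matrix_vector_mul_assoc fun_eq_iff)
      then show "onorm ((*v) (matrix_inv (M j))) \<le> onorm ((*v) (matrix_inv (a j))) * onorm ((*v) b)"
        by (simp add: onorm_compose[OF matrix_vector_mul_bounded_linear matrix_vector_mul_bounded_linear])
    qed
    show "\<forall>\<^sub>F j in sequentially. 0 \<le> onorm ((*v) (matrix_inv (M j)))"
      by (simp add: onorm_pos_le)
  qed
  have "(\<lambda>j. onorm ((*v) (matrix_inv (M j))) * CARD('d)) \<longlonglongrightarrow> 0"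
    using tendsto_mult_right[OF lim, of "real CARD('d)"] by simp
  then have "\<forall>\<^sub>F j in sequentially. onorm ((*v) (matrix_inv (M j))) * CARD('d) < 1"
    by (rule order_tendstoD(2)) simp
  then obtain N where N: "\<And>j. j \<ge> N \<Longrightarrow> onorm ((*v) (matrix_inv (M j))) * CARD('d) < 1"
    by (auto simp: eventually_sequentially)
  \<comment> \<open>\<open>expanding\<close> is guaranteed only from some index on, and
    invertibility only for positive indices; the shift by \<open>Suc N\<close> secures both.\<close>
  have "(\<lambda>j. Np (\<lambda>x. interpolant (M (j + Suc N)) H x - radial_stretch (1 / p) (H x))) \<longlonglongrightarrow> N1 H * defect"
  proof (rule interpolant_error_tendsto[OF _ _ Hi])
    show "expanding (M (j + Suc N))" for j
      using N[of "j + Suc N"] dM[of "j + Suc N"] by (simp add: expanding_def less_imp_le)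
    show "(\<lambda>j. onorm ((*v) (matrix_inv (M (j + Suc N))))) \<longlonglongrightarrow> 0"
      using LIMSEQ_ignore_initial_segment[OF lim] .
  qed
  then have "(\<lambda>j. Np (\<lambda>x. interpolant (M (j + Suc N)) H x - f x)) \<longlonglongrightarrow> N1 H * defect" by (simp only: fH)
  then have Nlim: "(\<lambda>j. Np (\<lambda>x. interpolant (M j) H x - f x)) \<longlonglongrightarrow> N1 H * defect" by (rule LIMSEQ_offset)
  have fin: "N1 H * defect < top" using N1_finite[OF Hi] defect_finite by (simp add: ennreal_mult_less_top)
  \<comment> \<open>The root is taken only now: it is continuous also at 0 because
    \<open>1 / p\<close> is positive, and \<open>enn2real\<close> is continuous at the finite
    limit.\<close>
  have "(\<lambda>j. enn2real (Np (\<lambda>x. interpolant (M j) H x - f x)) powr (1 / p)) \<longlonglongrightarrow> enn2real (N1 H * defect) powr (1 / p)"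
    using p fin Nlim by (intro tendsto_powr' tendsto_enn2real tendsto_const) auto
  moreover have "\<forall>\<^sub>F j in sequentially. enn2real (Np (\<lambda>x. interpolant (M j) H x - f x)) powr (1 / p) = Lp_norm p lebesgue (\<lambda>x. interpolant (M j) H x - f x)"
  proof (rule eventually_sequentiallyI[of 1])
    fix j :: nat assume "1 \<le> j"
    then have "interpolant (M j) H \<in> borel_measurable lebesgue" using interpolant_meas[OF dM] by simp
    then show "enn2real (Np (\<lambda>x. interpolant (M j) H x - f x)) powr (1 / p) = Lp_norm p lebesgue (\<lambda>x. interpolant (M j) H x - f x)"
      using fm by (simp add: Lp_norm_eq Np_def del: nn_integral_completion)
  qed
  ultimately have "(\<lambda>j. Lp_norm p lebesgue (\<lambda>x. interpolant (M j) H x - f x)) \<longlonglongrightarrow> enn2real (N1 H * defect) powr (1 / p)"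
    by (rule Lim_transform_eventually)
  then have main: "(\<lambda>j. Lp_norm p lebesgue (\<lambda>x. interpolant (M j) H x - f x)) \<longlonglongrightarrow>
      Lp_norm p (lebesgue_on unit_cube) (\<lambda>x. per x - 1) * Lp_norm p lebesgue f"
    by (simp add: norm_per norm_f enn2real_mult powr_mult mult.commute)
  have "Lp_tendsto p lebesgue (\<lambda>j. interpolant (M j) H) f" if one: "AE x in lebesgue. periodization b \<psi> x = 1"
  proof -
    \<comment> \<open>The exceptional null set is pulled back along the dilation by
      \<open>b\<close>, under which null sets remain null.\<close>
    have "AE x in lebesgue. per x = 1" using AE_lebesgue_affine[OF db one, of 0] by (simp add: per_eq)
    then have "defect = (\<integral>\<^sup>+x. 0 \<partial>(lebesgue :: (real^'d) measure))"
      unfolding defect_def by (intro nn_integral_cong_AE) auto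
    then have "defect = 0" by simp
    then have "(\<lambda>j. Lp_norm p lebesgue (\<lambda>x. interpolant (M j) H x - f x)) \<longlonglongrightarrow> 0"
      using main by (simp add: norm_per)
    then have "(\<lambda>j. Lp_norm p lebesgue (\<lambda>x. interpolant (M j) H x - f x) powr p) \<longlonglongrightarrow> 0"
      using p by (intro tendsto_zero_powrI[where b=p]) (auto simp: Lp_norm_def)
    moreover have "\<forall>\<^sub>F j in sequentially. interpolant (M j) H \<in> Lp_space p lebesgue"
      by (rule eventually_sequentiallyI[of 1]) (simp add: Lp_interpolant)
    ultimately show ?thesis using f by (simp add: Lp_tendsto_def Lp_dist_def)
  qed
  with main Lp_interpolant Lp_per show ?thesis
    by (simp add: syn per_eq)
qed

end
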